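(* Let $\mathbf{X}^-=\{\mathbf{x}^1,\mathbf{x}^2,-\mathbf{x}^3\}\subset\mathbb{R}^2$, where $\mathbf{x}^3=\mathbf{x}^1+\mathbf{x}^2=(1,0)^T$, be a knot set in $\mathbb{R}^2$, and write $\mathbf{x}^j=(x^j_1,x^j_2)^T$. Suppose that the knots $\mathbf{x}^1$ and $\mathbf{x}^2$ satisfy the following two conditions: (i) for $j=1,2$ there is a positive constant $\vartheta_j$ with $|x^j_1|+|x^j_2|\le\vartheta_j<2$; (ii) $x^j_2/x^j_1\notin\mathbb{Q}$ for $j=1,2$ (assuming without loss of generality that $x^j_1\neq0$). Let $\boldsymbol{\alpha}=(\alpha_1,\alpha_2,\alpha_3)$ have positive real components, and assume further that $|\boldsymbol{\alpha}|:=\alpha_1+\alpha_2+\alpha_3>1$. Then the family $\{B_{\boldsymbol{\alpha}}(\cdot-\mathbf{k}\mid\mathbf{X}^-) : \mathbf{k}\in\mathbb{Z}^2\}$ of bivariate hex splines is a Riesz basis for the principal shift-invariant subspace $$\mathcal{S}^{\boldsymbol{\alpha}}=\Big\{f\in L^2(\mathbb{R}^2) : \exists\,a\in\ell^2(\mathbb{Z}^2)\text{ with } f(\mathbf{x})=\sum_{\mathbf{k}\in\mathbb{Z}^2}a(\mathbf{k})\,B_{\boldsymbol{\alpha}}(\mathbf{x}-\mathbf{k}\mid\mathbf{X}^-)\Big\}$$ of $L^2(\mathbb{R}^2)$.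
   Context: Fourier transform convention: $\hat f(\boldsymbol{\omega})=\int f(\mathbf{x})e^{-i\langle\boldsymbol{\omega},\mathbf{x}\rangle}d\mathbf{x}$, extended to tempered distributions. For linearly independent $\mathbf{x}^1,\mathbf{x}^2\in\mathbb{R}^2$ with $\mathbf{x}^3=\mathbf{x}^1+\mathbf{x}^2=(1,0)^T$, and $\boldsymbol{\alpha}$ with positive real components, the (fractional) hex spline $B_{\boldsymbol{\alpha}}(\cdot\mid\mathbf{X}^-)$ of order $\boldsymbol{\alpha}$ is defined by its Fourier transform $$\widehat{B_{\boldsymbol{\alpha}}}(\boldsymbol{\omega}\mid\mathbf{X}^-)=\left(\frac{1-e^{-i\langle\boldsymbol{\omega},\mathbf{x}^1\rangle}}{i\langle\boldsymbol{\omega},\mathbf{x}^1\rangle}\right)^{\alpha_1}\left(\frac{1-e^{-i\langle\boldsymbol{\omega},\mathbf{x}^2\rangle}}{i\langle\boldsymbol{\omega},\mathbf{x}^2\rangle}\right)^{\alpha_2}\left(\frac{e^{i\langle\boldsymbol{\omega},\mathbf{x}^3\rangle}-1}{i\langle\boldsymbol{\omega},\mathbf{x}^3\rangle}\right)^{\alpha_3},$$ with principal-branch powers and each quotient read as $1$ where its denominator vanishes. A family $\{g_{\mathbf{k}}\}_{\mathbf{k}\in\mathbb{Z}^2}$ in $L^2(\mathbb{R}^2)$ is a Riesz basis for a closed subspace $V$ if its closed linear span is $V$ and there are constants $0<A\le B<\infty$ with $A\|a\|_{\ell^2}^2\le\|\sum_{\mathbf{k}}a(\mathbf{k})g_{\mathbf{k}}\|_{L^2}^2\le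 B\|a\|_{\ell^2}^2$ for all $a\in\ell^2(\mathbb{Z}^2)$.
   Formalization: It is additionally assumed that the shifts of the hex spline lie in L²(R²); |α|>1 alone does not give this (e.g. α=(2,1/10,1/10), where the transform is not square integrable along the strip |⟨ω,x¹⟩|≤1), and without it the claim fails. *)

theory Defs
  imports "HOL-Analysis.Analysis"
begin

text \<open>Square-integrable functions are handled as functions rather than as almost-everywhere
  classes; all sets of functions below are closed under almost-everywhere equality inside
  \<open>L2\<close>. The value of \<open>L2_norm\<close> is meaningful only on \<open>L2\<close>.\<close>

definition L2 :: "('a::euclidean_space \<Rightarrow> complex) set" where
  "L2 = {f \<in> borel_measurable borel. integrable lborel (\<lambda>x. (cmod (f x))\<^sup>2)}"

definition L2_norm :: "('a::euclidean_space \<Rightarrow> complex) \<Rightarrow> real" where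
  "L2_norm f = sqrt (LINT x|lborel. (cmod (f x))\<^sup>2)"

definition l2 :: "('k \<Rightarrow> complex) set" where
  "l2 = {a. (\<lambda>k. (cmod (a k))\<^sup>2) summable_on UNIV}"

definition l2_norm :: "('k \<Rightarrow> complex) \<Rightarrow> real" where
  "l2_norm a = sqrt (\<Sum>\<^sub>\<infinity>k. (cmod (a k))\<^sup>2)"

text \<open>\<open>f\<close> is the sum of the family \<open>k \<mapsto> a k * g k\<close>, with unconditional convergence in \<open>L2\<close>.\<close>

definition L2_has_sum ::
  "('k \<Rightarrow> complex) \<Rightarrow> ('k \<Rightarrow> 'a::euclidean_space \<Rightarrow> complex) \<Rightarrow> ('a \<Rightarrow> complex) \<Rightarrow> bool" where
  "L2_has_sum a g f \<longleftrightarrow>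
     ((\<lambda>F. L2_norm (\<lambda>x. f x - (\<Sum>k\<in>F. a k * g k x))) \<longlongrightarrow> 0) (finite_subsets_at_top UNIV)"

definition L2_closed_span ::
  "('k \<Rightarrow> 'a::euclidean_space \<Rightarrow> complex) \<Rightarrow> ('a \<Rightarrow> complex) set" where
  "L2_closed_span g =
     {f \<in> L2. \<forall>e>0. \<exists>F c. finite F \<and> L2_norm (\<lambda>x. f x - (\<Sum>k\<in>F. c k * g k x)) < e}"

definition riesz_basis ::
  "('k \<Rightarrow> 'a::euclidean_space \<Rightarrow> complex) \<Rightarrow> ('a \<Rightarrow> complex) set \<Rightarrow> bool" where
  "riesz_basis g V \<longleftrightarrow>
     (\<forall>k. g k \<in> L2) \<and> L2_closed_span g = V \<and>
     (\<exists>A B. 0 < A \<and> A \<le> B \<and>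
        (\<forall>a\<in>l2. \<exists>f\<in>L2. L2_has_sum a g f \<and>
           A * (l2_norm a)\<^sup>2 \<le> (L2_norm f)\<^sup>2 \<and> (L2_norm f)\<^sup>2 \<le> B * (l2_norm a)\<^sup>2))"

primrec iterated_deriv ::
  "'a::euclidean_space list \<Rightarrow> ('a \<Rightarrow> complex) \<Rightarrow> 'a \<Rightarrow> complex" where
  "iterated_deriv [] f = f"
| "iterated_deriv (v # vs) f = (\<lambda>x. frechet_derivative (iterated_deriv vs f) (at x) v)"

definition schwartz :: "('a::euclidean_space \<Rightarrow> complex) \<Rightarrow> bool" where
  "schwartz f \<longleftrightarrow>
     (\<forall>vs. set vs \<subseteq> Basis \<longrightarrow>
        iterated_deriv vs f differentiable_on UNIV \<and>
        (\<forall>m::nat. bounded (range (\<lambda>x. norm x ^ m *\<^sub>R iterated_deriv vs f x))))"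

definition fourier :: "('a::euclidean_space \<Rightarrow> complex) \<Rightarrow> 'a \<Rightarrow> complex" where
  "fourier f \<omega> = (LINT x|lborel. f x * exp (- (\<i> * complex_of_real (\<omega> \<bullet> x))))"

text \<open>The function \<open>f\<close>, as a regular tempered distribution, has the function \<open>h\<close> as its
  Fourier transform: the transform is moved to the Schwartz test function.\<close>

definition has_fourier_transform ::
  "('a::euclidean_space \<Rightarrow> complex) \<Rightarrow> ('a \<Rightarrow> complex) \<Rightarrow> bool" where
  "has_fourier_transform f h \<longleftrightarrow>
     f \<in> borel_measurable borel \<and> h \<in> borel_measurable borel \<and>
     (\<forall>\<phi>. schwartz \<phi> \<longrightarrow>
        integrable lborel (\<lambda>x. f x * fourier \<phi> x) \<and>
        integrable lborel (\<lambda>\<omega>. h \<omega> * \<phi> \<omega>) \<and>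
        (LINT x|lborel. f x * fourier \<phi> x) = (LINT \<omega>|lborel. h \<omega> * \<phi> \<omega>))"

definition quot_minus :: "real \<Rightarrow> complex" where
  "quot_minus s = (if s = 0 then 1 else (1 - exp (- (\<i> * of_real s))) / (\<i> * of_real s))"

definition quot_plus :: "real \<Rightarrow> complex" where
  "quot_plus s = (if s = 0 then 1 else (exp (\<i> * of_real s) - 1) / (\<i> * of_real s))"

definition hex_spline_hat ::
  "real^3 \<Rightarrow> real^2 \<Rightarrow> real^2 \<Rightarrow> real^2 \<Rightarrow> real^2 \<Rightarrow> complex" where
  "hex_spline_hat \<alpha> x1 x2 x3 \<omega> =
     quot_minus (\<omega> \<bullet> x1) powr of_real (\<alpha> $ 1) *
     quot_minus (\<omega> \<bullet> x2) powr of_real (\<alpha> $ 2) *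
     quot_plus (\<omega> \<bullet> x3) powr of_real (\<alpha> $ 3)"

text \<open>A function is pinned down by its Fourier transform only up to null sets, so being a hex
  spline is a predicate on representatives. Pitfall: positivity of the orders together with
  \<open>\<alpha>\<^sub>1 + \<alpha>\<^sub>2 + \<alpha>\<^sub>3 > 1\<close> does not make the transform square-integrable. On the strip
  \<open>\<bar>\<omega> \<bullet> x\<^sub>i\<bar> \<le> 1\<close> it decays only with exponent \<open>\<alpha>\<^sub>j + \<alpha>\<^sub>k\<close>, so membership in \<open>L2\<close> needs in
  addition every sum of two of the orders to exceed \<open>1/2\<close>. Membership of the hex spline
  in \<open>L2\<close> is therefore not part of the predicate.\<close>

definition is_hex_spline ::
  "real^3 \<Rightarrow> real^2 \<Rightarrow> real^2 \<Rightarrow> real^2 \<Rightarrow> (real^2 \<Rightarrow> complex) \<Rightarrow> bool" where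
  "is_hex_spline \<alpha> x1 x2 x3 B \<longleftrightarrow> has_fourier_transform B (hex_spline_hat \<alpha> x1 x2 x3)"

definition int_shift :: "(real^2 \<Rightarrow> complex) \<Rightarrow> int^2 \<Rightarrow> real^2 \<Rightarrow> complex" where
  "int_shift B k = (\<lambda>x. B (x - (\<chi> i. of_int (k $ i))))"

definition shift_invariant_space :: "(real^2 \<Rightarrow> complex) \<Rightarrow> (real^2 \<Rightarrow> complex) set" where
  "shift_invariant_space B = {f \<in> L2. \<exists>a\<in>l2. L2_has_sum a (int_shift B) f}"

end

theory Submission
  imports Defs "HOL-Probability.Characteristic_Functions"
begin

text \<open>
  Let \<open>h\<close> be the Fourier transform of the hex spline \<open>B\<close>. By Plancherel's theorem a finite
  combination \<open>\<Sum>k. c k * B (x - k)\<close> has the squared norm of \<open>P * h\<close>, up to the factor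
  \<open>(2 * pi)\<^sup>2\<close>, where \<open>P\<close> is the trigonometric polynomial with coefficients \<open>c\<close>. As \<open>P\<close> is
  periodic, this is the integral over the cell \<open>[-pi, pi]\<^sup>2\<close> of \<open>\<bar>P\<bar>\<^sup>2\<close> against the periodization
  \<open>\<Sum>k. \<bar>h (\<omega> + 2 * pi * k)\<bar>\<^sup>2\<close>, and by orthogonality the integral of \<open>\<bar>P\<bar>\<^sup>2\<close> alone is
  \<open>(2 * pi)\<^sup>2\<close> times \<open>\<Sum>k. \<bar>c k\<bar>\<^sup>2\<close>. So bounds for the periodization are Riesz bounds
  (\<open>riesz_bounds_translates\<close>).

  \<^item> From below: on the cell the numbers \<open>\<omega> \<bullet> x1\<close>, \<open>\<omega> \<bullet> x2\<close>, \<open>\<omega> \<bullet> x3\<close> stay in a compact part of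
    the interval from \<open>- 2 * pi\<close> to \<open>2 * pi\<close>, because the \<open>l1\<close> norms of the knots are less than
    2. There the quotients in \<open>h\<close> do not vanish, so the term \<open>k = 0\<close> of the periodization is
    bounded away from zero (\<open>hex_spline_hat_lower_bound\<close>).

  \<^item> From above: the modulus of a quotient is \<open>2 * \<bar>sin (s / 2)\<bar> / \<bar>s\<bar>\<close>, which is at most
    \<open>3 / (1 + \<bar>s\<bar>)\<close>, and at least \<open>1 / (1 + \<bar>s\<bar>)\<close> where the sine is at least \<open>1 / 2\<close>. The three
    sines are simultaneously that large on a small ball near every point, so a value of \<open>\<bar>h\<bar>\<^sup>2\<close> is
    controlled by its integral over a ball of fixed radius (\<open>hex_spline_hat_local_bound\<close>). The
    balls around the points \<open>\<omega> + 2 * pi * k\<close> overlap boundedly often, and \<open>\<bar>h\<bar>\<^sup>2\<close> is integrable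
    because \<open>B\<close> is in \<open>L2\<close>; hence the periodization is bounded.

  The Fourier transform of \<open>B\<close> is given by duality with Schwartz functions. Modulated Gaussians
  already identify the mollifications of \<open>B\<close> with inverse transforms of damped copies of \<open>h\<close>
  (\<open>mollify_eq_inv_fourier\<close>); these converge to \<open>B\<close> in \<open>L2\<close> because translations act
  continuously on \<open>L2\<close>, which gives Plancherel's theorem (\<open>Plancherel_translates\<close>).

  Riesz inequalities for finite combinations extend to all of \<open>l2\<close> and identify the closed span
  with the set of sums because \<open>L2\<close> and \<open>l2\<close> are complete (\<open>riesz_basis_if_finite_bounds\<close>).
\<close>

section \<open>The space of square-integrable functions\<close>

lemma L2_measurable [measurable_dest]: "f \<in> L2 \<Longrightarrow> f \<in> borel_measurable borel"
  by (simp add: L2_def)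

lemma L2_integrable: "f \<in> L2 \<Longrightarrow> integrable lborel (\<lambda>x. (cmod (f x))\<^sup>2)"
  by (simp add: L2_def)

lemma L2_iff_nn_integral:
  "f \<in> L2 \<longleftrightarrow> f \<in> borel_measurable borel \<and> (\<integral>\<^sup>+x. ennreal ((cmod (f x))\<^sup>2) \<partial>lborel) < \<infinity>"
  by (auto simp: L2_def integrable_iff_bounded)

lemma L2_norm_nonneg [simp]: "0 \<le> L2_norm f"
  by (simp add: L2_norm_def)

lemma L2_norm_squared: "(L2_norm f)\<^sup>2 = (LINT x|lborel. (cmod (f x))\<^sup>2)"
  by (simp add: L2_norm_def)

lemma nn_integral_L2:
  "f \<in> L2 \<Longrightarrow> (\<integral>\<^sup>+x. ennreal ((cmod (f x))\<^sup>2) \<partial>lborel) = ennreal ((L2_norm f)\<^sup>2)"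
  unfolding L2_norm_squared by (intro nn_integral_eq_integral L2_integrable) auto

lemma L2_norm_le_iff:
  assumes "f \<in> L2" "0 \<le> K"
  shows "L2_norm f \<le> K \<longleftrightarrow> (\<integral>\<^sup>+x. ennreal ((cmod (f x))\<^sup>2) \<partial>lborel) \<le> ennreal (K\<^sup>2)"
  using assms by (auto simp: nn_integral_L2 power2_le_iff_abs_le)

lemma L2_I_nn_integral_le:
  assumes "f \<in> borel_measurable borel" "0 \<le> K"
    and "(\<integral>\<^sup>+x. ennreal ((cmod (f x))\<^sup>2) \<partial>lborel) \<le> ennreal (K\<^sup>2)"
  shows "f \<in> L2" "L2_norm f \<le> K"
proof -
  show "f \<in> L2"
    using assms le_less_trans[OF assms(3), of \<infinity>] by (auto simp: L2_iff_nn_integral)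
  then show "L2_norm f \<le> K"
    using assms by (simp add: L2_norm_le_iff)
qed

lemma cmod_add_squared_le:
  assumes "0 < s"
  shows "(cmod (u + v))\<^sup>2 \<le> (1 + s) * (cmod u)\<^sup>2 + (1 + 1 / s) * (cmod v)\<^sup>2"
proof -
  have "(cmod (u + v))\<^sup>2 \<le> (cmod u + cmod v)\<^sup>2"
    by (intro power_mono norm_triangle_ineq) auto
  also have "\<dots> = (1 + s) * (cmod u)\<^sup>2 + (1 + 1 / s) * (cmod v)\<^sup>2 - (s * cmod u - cmod v)\<^sup>2 / s"
    using assms by (simp add: field_simps power2_eq_square)
  also have "\<dots> \<le> (1 + s) * (cmod u)\<^sup>2 + (1 + 1 / s) * (cmod v)\<^sup>2"
    using assms by simp
  finally show ?thesis .
qed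

lemma L2_scale: "f \<in> L2 \<Longrightarrow> (\<lambda>x. c * f x) \<in> L2"
  by (auto simp: L2_def norm_mult power_mult_distrib)

lemma L2_norm_scale: "L2_norm (\<lambda>x. c * f x) = cmod c * L2_norm f"
  by (simp add: L2_norm_def norm_mult power_mult_distrib real_sqrt_mult)

lemma L2_zero: "(\<lambda>_. 0) \<in> L2"
  by (simp add: L2_def)

lemma L2_add: assumes "f \<in> L2" "g \<in> L2" shows "(\<lambda>x. f x + g x) \<in> L2"
proof -
  note [measurable] = assms[THEN L2_measurable]
  have "integrable lborel (\<lambda>x. (cmod (f x + g x))\<^sup>2)"
  proof (rule Bochner_Integration.integrable_bound)
    show "integrable lborel (\<lambda>x. 2 * (cmod (f x))\<^sup>2 + 2 * (cmod (g x))\<^sup>2)"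
      using assms by (intro Bochner_Integration.integrable_add integrable_mult_right L2_integrable)
    show "AE x in lborel. norm ((cmod (f x + g x))\<^sup>2) \<le> norm (2 * (cmod (f x))\<^sup>2 + 2 * (cmod (g x))\<^sup>2)"
      using cmod_add_squared_le[of 1] by auto
  qed auto
  then show ?thesis by (simp add: L2_def)
qed

lemma L2_diff: assumes "f \<in> L2" "g \<in> L2" shows "(\<lambda>x. f x - g x) \<in> L2"
  using L2_add[OF assms(1) L2_scale[OF assms(2), of "-1"]] by simp

lemma L2_sum: "(\<And>k. k \<in> F \<Longrightarrow> g k \<in> L2) \<Longrightarrow> (\<lambda>x. \<Sum>k\<in>F. c k * g k x) \<in> L2"
  by (induction F rule: infinite_finite_induct) (auto intro!: L2_add L2_scale L2_zero)

lemma L2_norm_triangle: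
  assumes "f \<in> L2" "g \<in> L2"
  shows "L2_norm (\<lambda>x. f x + g x) \<le> L2_norm f + L2_norm g"
proof (rule field_le_epsilon)
  fix e :: real assume "0 < e"
  define a where "a = L2_norm f + e / 2"
  define b where "b = L2_norm g + e / 2"
  have ab: "0 < a" "0 < b" "L2_norm f \<le> a" "L2_norm g \<le> b"
    using \<open>0 < e\<close> by (auto simp: a_def b_def intro: add_nonneg_pos)
  note I = assms[THEN L2_integrable] L2_add[OF assms, THEN L2_integrable]
  \<comment> \<open>The weight \<open>b / a\<close> makes the elementary inequality an equality at \<open>(a, b)\<close>.\<close>
  have "(L2_norm (\<lambda>x. f x + g x))\<^sup>2
      \<le> (LINT x|lborel. (1 + b / a) * (cmod (f x))\<^sup>2 + (1 + a / b) * (cmod (g x))\<^sup>2)"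
    unfolding L2_norm_squared using I ab cmod_add_squared_le[of "b / a"]
    by (intro integral_mono) auto
  also have "\<dots> = (1 + b / a) * (L2_norm f)\<^sup>2 + (1 + a / b) * (L2_norm g)\<^sup>2"
    using I by (simp add: L2_norm_squared)
  also have "\<dots> \<le> (1 + b / a) * a\<^sup>2 + (1 + a / b) * b\<^sup>2"
    using ab by (intro add_mono mult_left_mono power_mono) auto
  also have "\<dots> = (a + b)\<^sup>2"
    using ab by (simp add: field_simps power2_eq_square)
  finally have "L2_norm (\<lambda>x. f x + g x) \<le> a + b"
    using ab by (simp add: power2_le_iff_abs_le)
  then show "L2_norm (\<lambda>x. f x + g x) \<le> L2_norm f + L2_norm g + e"
    by (simp add: a_def b_def)
qed

lemma L2_norm_minus_commute: "L2_norm (\<lambda>x. f x - g x) = L2_norm (\<lambda>x. g x - f x)"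
  by (simp add: L2_norm_def norm_minus_commute)

lemma L2_norm_diff_triangle:
  assumes "f \<in> L2" "g \<in> L2" "h \<in> L2"
  shows "L2_norm (\<lambda>x. f x - h x) \<le> L2_norm (\<lambda>x. f x - g x) + L2_norm (\<lambda>x. g x - h x)"
  using L2_norm_triangle[OF L2_diff[OF assms(1,2)] L2_diff[OF assms(2,3)]] by simp

lemma L2_norm_diff_ge:
  assumes "f \<in> L2" "g \<in> L2"
  shows "\<bar>L2_norm f - L2_norm g\<bar> \<le> L2_norm (\<lambda>x. f x - g x)"
  using L2_norm_diff_triangle[OF assms L2_zero] L2_norm_diff_triangle[OF assms(2,1) L2_zero]
  by (simp add: L2_norm_minus_commute[of g f])

lemma L2_norm_tendsto:
  assumes "\<And>i. u i \<in> L2" "f \<in> L2" "((\<lambda>i. L2_norm (\<lambda>x. f x - u i x)) \<longlongrightarrow> 0) F"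
  shows "((\<lambda>i. L2_norm (u i)) \<longlongrightarrow> L2_norm f) F"
proof -
  have "((\<lambda>i. L2_norm (u i) - L2_norm f) \<longlongrightarrow> 0) F"
    by (rule Lim_null_comparison[OF _ assms(3)])
      (auto intro!: always_eventually simp: L2_norm_minus_commute[of f] L2_norm_diff_ge assms)
  then show ?thesis by (rule LIM_zero_cancel)
qed

text \<open>Riesz and Fischer: along a subsequence with
  \<open>\<Sum>j. 2^j * \<parallel>u (j + 1) - u j\<parallel>\<^sup>2 < \<infinity>\<close> the integrand \<open>\<Sum>j. 2^j * \<bar>u (j + 1) - u j\<bar>\<^sup>2\<close> is
  finite almost everywhere, so that the increments are there dominated by a geometric series.
  Fatou's lemma then turns pointwise convergence into convergence in norm.\<close>

lemma L2_complete:
  fixes u :: "nat \<Rightarrow> 'a::euclidean_space \<Rightarrow> complex"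
  assumes u: "\<And>n. u n \<in> L2"
    and Cauchy: "\<And>e. 0 < e \<Longrightarrow> \<exists>N. \<forall>m\<ge>N. \<forall>n\<ge>N. L2_norm (\<lambda>x. u m x - u n x) < e"
  obtains f where "f \<in> L2" "(\<lambda>n. L2_norm (\<lambda>x. f x - u n x)) \<longlonglongrightarrow> 0"
proof -
  note [measurable] = u[THEN L2_measurable]
  obtain N where N: "\<And>j m n. m \<ge> N j \<Longrightarrow> n \<ge> N j \<Longrightarrow> L2_norm (\<lambda>x. u m x - u n x) < (1/2)^j"
    using Cauchy[of "(1/2)^_"] by (metis zero_less_power half_gt_zero_iff zero_less_one)
  define r where "r j = (\<Sum>i\<le>j. N i) + j" for j
  have r: "N j \<le> r j" "r j \<le> r (Suc j)" "j \<le> r j" for j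
    using member_le_sum[of j "{..j}" N] by (auto simp: r_def)
  define d where "d j x = cmod (u (r (Suc j)) x - u (r j) x)" for j x
  have [measurable]: "d j \<in> borel_measurable borel" for j
    unfolding d_def by measurable
  have "(\<integral>\<^sup>+x. (\<Sum>j. ennreal (2^j * (d j x)\<^sup>2)) \<partial>lborel) = (\<Sum>j. \<integral>\<^sup>+x. ennreal (2^j * (d j x)\<^sup>2) \<partial>lborel)"
    by (rule nn_integral_suminf) auto
  also have "\<dots> \<le> (\<Sum>j. ennreal ((1/2)^j))"
  proof (rule suminf_le)
    fix j
    have "(\<integral>\<^sup>+x. ennreal (2^j * (d j x)\<^sup>2) \<partial>lborel) = ennreal (2^j) * (\<integral>\<^sup>+x. ennreal ((d j x)\<^sup>2) \<partial>lborel)"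
      by (simp add: ennreal_mult nn_integral_cmult)
    also have "\<dots> = ennreal (2^j) * ennreal ((L2_norm (\<lambda>x. u (r (Suc j)) x - u (r j) x))\<^sup>2)"
      unfolding d_def using u by (subst nn_integral_L2) (auto intro: L2_diff)
    also have "\<dots> \<le> ennreal (2^j) * ennreal (((1/2)^j)\<^sup>2)"
      using less_imp_le[OF N[of j "r (Suc j)" "r j"]] r(1,2)[of j]
      by (intro mult_left_mono ennreal_leI power_mono) auto
    also have "\<dots> = ennreal ((1/2)^j)"
      by (simp add: ennreal_mult[symmetric] power2_eq_square power_one_over)
    finally show "(\<integral>\<^sup>+x. ennreal (2^j * (d j x)\<^sup>2) \<partial>lborel) \<le> ennreal ((1/2)^j)" .
  qed auto
  also have "\<dots> < \<infinity>"
    by (subst suminf_ennreal2) auto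
  finally have "AE x in lborel. (\<Sum>j. ennreal (2^j * (d j x)\<^sup>2)) \<noteq> \<infinity>"
    by (intro nn_integral_PInf_AE) auto
  then have conv: "AE x in lborel. convergent (\<lambda>j. u (r j) x)"
  proof eventually_elim
    fix x assume "(\<Sum>j. ennreal (2^j * (d j x)\<^sup>2)) \<noteq> \<infinity>"
    then have "summable (\<lambda>j. 2^j * (d j x)\<^sup>2)"
      by (intro summable_suminf_not_top) auto
    then have "bounded (range (\<lambda>j. 2^j * (d j x)\<^sup>2))"
      by (rule summable_imp_bounded)
    then obtain C where C: "\<And>j. norm (2^j * (d j x)\<^sup>2) \<le> C"
      unfolding bounded_iff by blast
    define q where "q = sqrt (1/2 :: real)"
    have q: "0 < q" "q < 1" "q\<^sup>2 = 1/2"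
      by (auto simp: q_def real_sqrt_lt_1_iff)
    have "0 \<le> C" using C[of 0] by (meson norm_ge_zero order_trans)
    have "d j x \<le> sqrt C * q^j" for j
    proof (rule power2_le_imp_le)
      have "(q ^ j)\<^sup>2 = (1/2) ^ j"
        by (metis q(3) power_mult mult.commute)
      then have "(d j x)\<^sup>2 = (2^j * (d j x)\<^sup>2) * (q ^ j)\<^sup>2"
        by (simp add: power_one_over)
      also have "\<dots> \<le> C * (q ^ j)\<^sup>2"
        using C[of j] by (intro mult_right_mono) auto
      finally show "(d j x)\<^sup>2 \<le> (sqrt C * q ^ j)\<^sup>2"
        using \<open>0 \<le> C\<close> by (simp add: power_mult_distrib)
    qed (use q \<open>0 \<le> C\<close> in auto)
    then have incr: "cmod (u (r (Suc j)) x - u (r j) x) \<le> sqrt C * q^j" for j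
      by (simp add: d_def)
    have geom: "summable (\<lambda>j. sqrt C * q^j)"
      using q by (intro summable_mult summable_geometric) auto
    have "summable (\<lambda>j. u (r (Suc j)) x - u (r j) x)"
      by (rule summable_comparison_test'[OF geom incr])
    then have "convergent (\<lambda>j. (\<Sum>i<j. u (r (Suc i)) x - u (r i) x) + u (r 0) x)"
      by (intro convergent_add convergent_const) (simp add: summable_iff_convergent)
    then show "convergent (\<lambda>j. u (r j) x)"
      unfolding sum_lessThan_telescope[of "\<lambda>i. u (r i) x"] by simp
  qed
  define f where "f x = lim (\<lambda>j. u (r j) x)" for x
  have [measurable]: "f \<in> borel_measurable borel"
    unfolding f_def by measurable
  have lim: "AE x in lborel. (\<lambda>j. u (r j) x) \<longlonglongrightarrow> f x"
    using conv by eventually_elim (simp add: f_def convergent_LIMSEQ_iff)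
  have bound: "(\<lambda>x. f x - u n x) \<in> L2 \<and> L2_norm (\<lambda>x. f x - u n x) \<le> (1/2)^i" if n: "n \<ge> N i" for n i
  proof -
    have "(\<integral>\<^sup>+x. ennreal ((cmod (f x - u n x))\<^sup>2) \<partial>lborel)
        = (\<integral>\<^sup>+x. liminf (\<lambda>j. ennreal ((cmod (u (r j) x - u n x))\<^sup>2)) \<partial>lborel)"
    proof (rule nn_integral_cong_AE, use lim in eventually_elim)
      fix x assume "(\<lambda>j. u (r j) x) \<longlonglongrightarrow> f x"
      then have "(\<lambda>j. ennreal ((cmod (u (r j) x - u n x))\<^sup>2)) \<longlonglongrightarrow> ennreal ((cmod (f x - u n x))\<^sup>2)"
        by (intro tendsto_ennrealI tendsto_intros)
      then show "ennreal ((cmod (f x - u n x))\<^sup>2) = liminf (\<lambda>j. ennreal ((cmod (u (r j) x - u n x))\<^sup>2))"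
        by (rule lim_imp_Liminf[OF sequentially_bot, symmetric])
    qed
    also have "\<dots> \<le> liminf (\<lambda>j. \<integral>\<^sup>+x. ennreal ((cmod (u (r j) x - u n x))\<^sup>2) \<partial>lborel)"
      by (rule nn_integral_liminf) auto
    also have "\<dots> \<le> ennreal (((1/2)^i)\<^sup>2)"
    proof (rule Liminf_le)
      show "\<forall>\<^sub>F j in sequentially.
          (\<integral>\<^sup>+x. ennreal ((cmod (u (r j) x - u n x))\<^sup>2) \<partial>lborel) \<le> ennreal (((1/2)^i)\<^sup>2)"
        using eventually_ge_at_top[of "N i"]
      proof eventually_elim
        fix j assume "N i \<le> j"
        then have "L2_norm (\<lambda>x. u (r j) x - u n x) \<le> (1/2)^i"
          using n r(3)[of j] by (intro less_imp_le[OF N]) auto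
        then show "(\<integral>\<^sup>+x. ennreal ((cmod (u (r j) x - u n x))\<^sup>2) \<partial>lborel) \<le> ennreal (((1/2)^i)\<^sup>2)"
          using u by (subst L2_norm_le_iff[symmetric]) (auto intro: L2_diff)
      qed
    qed auto
    finally show ?thesis
      using L2_I_nn_integral_le[of "\<lambda>x. f x - u n x" "(1/2)^i"] by auto
  qed
  show thesis
  proof
    show "f \<in> L2"
      using L2_add[OF bound[OF order_refl[of "N 0"], THEN conjunct1] u[of "N 0"]] by simp
    show "(\<lambda>n. L2_norm (\<lambda>x. f x - u n x)) \<longlonglongrightarrow> 0"
    proof (rule LIMSEQ_I)
      fix e :: real assume "0 < e"
      then obtain i where "(1/2)^i < e"
        using real_arch_pow_inv[of e "1/2"] by auto
      then show "\<exists>no. \<forall>n\<ge>no. norm (L2_norm (\<lambda>x. f x - u n x) - 0) < e"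
        using bound by (intro exI[of _ "N i"]) (auto intro: le_less_trans)
    qed
  qed
qed

section \<open>From Riesz inequalities for finite sums to Riesz bases\<close>

lemma L2_norm_sum_le:
  assumes upper: "\<And>F c. finite F \<Longrightarrow>
      (L2_norm (\<lambda>x. \<Sum>k\<in>F. c k * g k x))\<^sup>2 \<le> B * (\<Sum>k\<in>F. (cmod (c k))\<^sup>2)"
    and "finite F" "(\<Sum>k\<in>F. (cmod (c k))\<^sup>2) \<le> e" "0 \<le> B"
  shows "L2_norm (\<lambda>x. \<Sum>k\<in>F. c k * g k x) \<le> sqrt (B * e)"
proof (rule real_le_rsqrt)
  show "(L2_norm (\<lambda>x. \<Sum>k\<in>F. c k * g k x))\<^sup>2 \<le> B * e"
    using upper[OF assms(2), of c] mult_left_mono[OF assms(3,4)] by linarith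
qed

text \<open>Smallness of the tails is the form of square summability that transfers, through the upper
  Riesz inequality, to the partial sums of the series in \<open>L2\<close>.\<close>

lemma l2_tail:
  assumes "a \<in> l2" "0 < e"
  obtains F0 where "finite F0" "\<And>G. finite G \<Longrightarrow> G \<inter> F0 = {} \<Longrightarrow> (\<Sum>k\<in>G. (cmod (a k))\<^sup>2) \<le> e"
proof -
  let ?f = "\<lambda>k. (cmod (a k))\<^sup>2"
  have sum: "?f summable_on UNIV"
    using assms by (simp add: l2_def)
  then have "(sum ?f \<longlongrightarrow> infsum ?f UNIV) (finite_subsets_at_top UNIV)"
    by (simp add: has_sum_infsum has_sum_def[symmetric])
  then have "\<forall>\<^sub>F F in finite_subsets_at_top UNIV. infsum ?f UNIV - e < sum ?f F"
    using \<open>0 < e\<close> by (intro order_tendstoD) auto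
  then obtain F0 where F0: "finite F0" "infsum ?f UNIV - e < sum ?f F0"
    unfolding eventually_finite_subsets_at_top by blast
  show thesis
  proof (rule that[OF F0(1)])
    fix G assume G: "finite G" "G \<inter> F0 = {}"
    have "sum ?f G + sum ?f F0 = sum ?f (G \<union> F0)"
      using G F0(1) by (simp add: sum.union_disjoint)
    also have "\<dots> \<le> infsum ?f UNIV"
      using sum G F0(1) by (intro finite_sum_le_infsum) auto
    finally show "sum ?f G \<le> e"
      using F0(2) by linarith
  qed
qed

lemma l2_norm_sums:
  assumes "a \<in> l2"
  shows "((\<lambda>F. \<Sum>k\<in>F. (cmod (a k))\<^sup>2) \<longlongrightarrow> (l2_norm a)\<^sup>2) (finite_subsets_at_top UNIV)"
  using assms by (simp add: l2_def l2_norm_def infsum_nonneg has_sum_infsum has_sum_def[symmetric])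

lemma l2I_finite_sums_le:
  assumes "\<And>F. finite F \<Longrightarrow> (\<Sum>k\<in>F. (cmod (a k))\<^sup>2) \<le> K"
  shows "a \<in> l2"
  unfolding l2_def mem_Collect_eq
  by (rule nonneg_bdd_above_summable_on) (auto intro!: bdd_aboveI2[of _ _ K] assms)

lemma sum_restrict:
  assumes "finite F" "F \<subseteq> G" "finite G"
  shows "(\<Sum>k\<in>G. (if k \<in> F then c k else 0) * (h k :: complex)) = (\<Sum>k\<in>F. c k * h k)"
  using assms by (intro sum.mono_neutral_cong_right) auto

lemma L2_has_sum_I:
  assumes "\<And>e. 0 < e \<Longrightarrow> \<exists>F0. finite F0 \<and>
     (\<forall>F. finite F \<longrightarrow> F0 \<subseteq> F \<longrightarrow> L2_norm (\<lambda>x. f x - (\<Sum>k\<in>F. a k * g k x)) < e)"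
  shows "L2_has_sum a g f"
  unfolding L2_has_sum_def tendsto_iff eventually_finite_subsets_at_top
  using assms by (simp, meson)

text \<open>By the upper Riesz inequality the partial sums over finite index sets containing a suitable
  \<open>F0\<close> differ from the one over \<open>F0\<close> by little. A sequence of such \<open>F0\<close> gives a Cauchy sequence in
  \<open>L2\<close>, whose limit is then also the limit along all finite index sets.\<close>

lemma L2_has_sum_exists:
  fixes g :: "'k \<Rightarrow> 'a::euclidean_space \<Rightarrow> complex"
  assumes g: "\<And>k. g k \<in> L2" and "0 \<le> B"
    and upper: "\<And>F c. finite F \<Longrightarrow>
      (L2_norm (\<lambda>x. \<Sum>k\<in>F. c k * g k x))\<^sup>2 \<le> B * (\<Sum>k\<in>F. (cmod (c k))\<^sup>2)"
    and a: "a \<in> l2"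
  obtains f where "f \<in> L2" "L2_has_sum a g f"
proof -
  define S where "S F = (\<lambda>x. \<Sum>k\<in>F. a k * g k x)" for F
  have S: "S F \<in> L2" for F
    unfolding S_def using g by (intro L2_sum)
  define \<epsilon> where "\<epsilon> n = sqrt (B * inverse (real (Suc n)))" for n
  have \<epsilon>: "\<epsilon> \<longlonglongrightarrow> 0"
    using tendsto_real_sqrt[OF tendsto_mult_left[OF LIMSEQ_inverse_real_of_nat, of B]]
    unfolding \<epsilon>_def by simp
  have "\<exists>F0. finite F0 \<and> (\<forall>G. finite G \<longrightarrow> G \<inter> F0 = {} \<longrightarrow> (\<Sum>k\<in>G. (cmod (a k))\<^sup>2) \<le> inverse (real (Suc n)))" for n
    by (rule l2_tail[OF a, of "inverse (real (Suc n))"]) auto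
  then obtain F0 where F0: "\<And>n. finite (F0 n)"
      "\<And>n G. finite G \<Longrightarrow> G \<inter> F0 n = {} \<Longrightarrow> (\<Sum>k\<in>G. (cmod (a k))\<^sup>2) \<le> inverse (real (Suc n))"
    by metis
  have near: "L2_norm (\<lambda>x. S (F0 n) x - S F x) \<le> \<epsilon> n" if "finite F" "F0 n \<subseteq> F" for n F
  proof -
    have "S F x - S (F0 n) x = (\<Sum>k\<in>F - F0 n. a k * g k x)" for x
      using that by (simp add: S_def sum_diff F0(1))
    then show ?thesis
      unfolding \<epsilon>_def using that F0(2)[of "F - F0 n" n] upper \<open>0 \<le> B\<close>
      by (subst L2_norm_minus_commute) (auto intro!: L2_norm_sum_le simp del: of_nat_Suc)
  qed
  obtain f where f: "f \<in> L2" "(\<lambda>n. L2_norm (\<lambda>x. f x - S (F0 n) x)) \<longlonglongrightarrow> 0"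
  proof (rule L2_complete[of "\<lambda>n. S (F0 n)"])
    fix e :: real assume "0 < e"
    then obtain N where N: "\<And>n. n \<ge> N \<Longrightarrow> \<epsilon> n < e / 2"
      using order_tendstoD(2)[OF \<epsilon>, of "e / 2"] by (auto simp: eventually_sequentially)
    have "L2_norm (\<lambda>x. S (F0 m) x - S (F0 n) x) < e" if mn: "m \<ge> N" "n \<ge> N" for m n
    proof -
      have "L2_norm (\<lambda>x. S (F0 m) x - S (F0 n) x) \<le>
          L2_norm (\<lambda>x. S (F0 m) x - S (F0 m \<union> F0 n) x) + L2_norm (\<lambda>x. S (F0 m \<union> F0 n) x - S (F0 n) x)"
        by (intro L2_norm_diff_triangle S)
      also have "\<dots> \<le> \<epsilon> m + \<epsilon> n"
        using near[of "F0 m \<union> F0 n"] F0(1)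
        by (intro add_mono) (auto simp: L2_norm_minus_commute[of "S (F0 m \<union> F0 n)"])
      also have "\<dots> < e"
        using N[OF mn(1)] N[OF mn(2)] by simp
      finally show ?thesis .
    qed
    then show "\<exists>N. \<forall>m\<ge>N. \<forall>n\<ge>N. L2_norm (\<lambda>x. S (F0 m) x - S (F0 n) x) < e"
      by blast
  qed (use S in auto)
  show thesis
  proof (rule that[OF f(1)], rule L2_has_sum_I)
    fix e :: real assume "0 < e"
    have "(\<lambda>n. L2_norm (\<lambda>x. f x - S (F0 n) x) + \<epsilon> n) \<longlonglongrightarrow> 0"
      using tendsto_add[OF f(2) \<epsilon>] by simp
    from order_tendstoD(2)[OF this \<open>0 < e\<close>] obtain n
      where n: "L2_norm (\<lambda>x. f x - S (F0 n) x) + \<epsilon> n < e"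
      by (auto simp: eventually_sequentially)
    have "L2_norm (\<lambda>x. f x - S F x) < e" if F: "finite F" "F0 n \<subseteq> F" for F
      using L2_norm_diff_triangle[OF f(1) S[of "F0 n"] S[of F]] near[OF F] n by linarith
    then show "\<exists>F0. finite F0 \<and>
        (\<forall>F. finite F \<longrightarrow> F0 \<subseteq> F \<longrightarrow> L2_norm (\<lambda>x. f x - (\<Sum>k\<in>F. a k * g k x)) < e)"
      using F0(1)[of n] unfolding S_def by blast
  qed
qed

text \<open>The lower Riesz inequality makes the coefficients of approximating finite sums a Cauchy
  family in \<open>l2\<close>, and the upper one carries the convergence of the coefficients back to the
  sums.\<close>

lemma L2_closed_span_subset:
  fixes g :: "'k \<Rightarrow> 'a::euclidean_space \<Rightarrow> complex"
  assumes g: "\<And>k. g k \<in> L2" and "0 < A" "0 \<le> B"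
    and lower: "\<And>F c. finite F \<Longrightarrow>
      A * (\<Sum>k\<in>F. (cmod (c k))\<^sup>2) \<le> (L2_norm (\<lambda>x. \<Sum>k\<in>F. c k * g k x))\<^sup>2"
    and upper: "\<And>F c. finite F \<Longrightarrow>
      (L2_norm (\<lambda>x. \<Sum>k\<in>F. c k * g k x))\<^sup>2 \<le> B * (\<Sum>k\<in>F. (cmod (c k))\<^sup>2)"
    and f: "f \<in> L2_closed_span g"
  shows "\<exists>a\<in>l2. L2_has_sum a g f"
proof -
  define \<epsilon> where "\<epsilon> n = inverse (real (Suc n))" for n
  have \<epsilon>: "0 < \<epsilon> n" "m \<ge> n \<Longrightarrow> \<epsilon> m \<le> \<epsilon> n" "\<epsilon> \<longlonglongrightarrow> 0" for m n
    using LIMSEQ_inverse_real_of_nat by (auto simp: \<epsilon>_def[abs_def])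
  have fL2: "f \<in> L2"
    using f by (simp add: L2_closed_span_def)
  have "\<exists>F c. finite F \<and> L2_norm (\<lambda>x. f x - (\<Sum>k\<in>F. c k * g k x)) < \<epsilon> n" for n
    using f \<epsilon>(1)[of n] by (simp add: L2_closed_span_def)
  then obtain F0 c0 where F0: "\<And>n. finite (F0 n)"
      and c0: "\<And>n. L2_norm (\<lambda>x. f x - (\<Sum>k\<in>F0 n. c0 n k * g k x)) < \<epsilon> n"
    by metis
  \<comment> \<open>Extended by zero, the coefficient families can be subtracted from each other.\<close>
  define c where "c n k = (if k \<in> F0 n then c0 n k else 0)" for n k
  have S: "(\<lambda>x. \<Sum>k\<in>F. c n k * g k x) \<in> L2" for n F
    using g by (intro L2_sum)
  have c: "L2_norm (\<lambda>x. f x - (\<Sum>k\<in>F. c n k * g k x)) < \<epsilon> n" if "finite F" "F0 n \<subseteq> F" for n F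
    using c0[of n] F0[of n] that by (simp add: c_def sum_restrict)
  have near: "(\<Sum>k\<in>G. (cmod (c m k - c n k))\<^sup>2) \<le> (2 * \<epsilon> n)\<^sup>2 / A" if G: "finite G" and mn: "m \<ge> n" for G m n
  proof -
    let ?F = "G \<union> F0 m \<union> F0 n"
    have fin: "finite ?F" using G F0 by auto
    have "(\<Sum>k\<in>G. (cmod (c m k - c n k))\<^sup>2) \<le> (\<Sum>k\<in>?F. (cmod (c m k - c n k))\<^sup>2)"
      using fin by (intro sum_mono2) auto
    also have "A * \<dots> \<le> (L2_norm (\<lambda>x. \<Sum>k\<in>?F. (c m k - c n k) * g k x))\<^sup>2"
      by (rule lower[OF fin])
    also have "\<dots> \<le> (2 * \<epsilon> n)\<^sup>2"
    proof (rule power_mono)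
      have "L2_norm (\<lambda>x. \<Sum>k\<in>?F. (c m k - c n k) * g k x)
          = L2_norm (\<lambda>x. (\<Sum>k\<in>?F. c m k * g k x) - (\<Sum>k\<in>?F. c n k * g k x))"
        by (simp add: left_diff_distrib sum_subtractf)
      also have "\<dots> \<le> L2_norm (\<lambda>x. (\<Sum>k\<in>?F. c m k * g k x) - f x) + L2_norm (\<lambda>x. f x - (\<Sum>k\<in>?F. c n k * g k x))"
        by (intro L2_norm_diff_triangle S fL2)
      also have "\<dots> \<le> \<epsilon> m + \<epsilon> n"
        using fin by (subst L2_norm_minus_commute) (auto intro!: add_mono less_imp_le[OF c])
      also have "\<dots> \<le> 2 * \<epsilon> n"
        using \<epsilon>(2)[OF mn] by simp
      finally show "L2_norm (\<lambda>x. \<Sum>k\<in>?F. (c m k - c n k) * g k x) \<le> 2 * \<epsilon> n" .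
    qed simp
    finally show ?thesis
      using \<open>0 < A\<close> by (simp add: field_simps)
  qed
  have "convergent (\<lambda>n. c n k)" for k
  proof -
    have "Cauchy (\<lambda>n. c n k)"
    proof (rule CauchyI')
      fix e :: real assume "0 < e"
      have "(\<lambda>n. 2 * \<epsilon> n / sqrt A) \<longlonglongrightarrow> 0"
        using \<epsilon>(3) \<open>0 < A\<close> by (auto intro!: tendsto_eq_intros)
      from order_tendstoD(2)[OF this \<open>0 < e\<close>] obtain N where N: "\<And>n. n \<ge> N \<Longrightarrow> 2 * \<epsilon> n / sqrt A < e"
        by (auto simp: eventually_sequentially)
      have "dist (c n k) (c m k) < e" if "n \<ge> N" "m > n" for m n
      proof -
        have "(cmod (c m k - c n k))\<^sup>2 \<le> (2 * \<epsilon> n / sqrt A)\<^sup>2"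
          using near[of "{k}" n m] that \<open>0 < A\<close> by (simp add: power_divide)
        then have "cmod (c m k - c n k) \<le> 2 * \<epsilon> n / sqrt A"
          by (rule power2_le_imp_le) (use \<epsilon>(1)[of n] \<open>0 < A\<close> in auto)
        then show ?thesis
          using N[OF that(1)] by (simp add: dist_norm norm_minus_commute)
      qed
      then show "\<exists>M. \<forall>n\<ge>M. \<forall>m>n. dist (c n k) (c m k) < e"
        by blast
    qed
    then show ?thesis by (rule Cauchy_convergent)
  qed
  then obtain a where a: "\<And>k. (\<lambda>n. c n k) \<longlonglongrightarrow> a k"
    unfolding convergent_def by metis
  have a_near: "(\<Sum>k\<in>G. (cmod (a k - c n k))\<^sup>2) \<le> (2 * \<epsilon> n)\<^sup>2 / A" if "finite G" for G n
  proof (rule LIMSEQ_le_const2)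
    show "(\<lambda>m. \<Sum>k\<in>G. (cmod (c m k - c n k))\<^sup>2) \<longlonglongrightarrow> (\<Sum>k\<in>G. (cmod (a k - c n k))\<^sup>2)"
      by (intro tendsto_intros a)
    show "\<exists>N. \<forall>m\<ge>N. (\<Sum>k\<in>G. (cmod (c m k - c n k))\<^sup>2) \<le> (2 * \<epsilon> n)\<^sup>2 / A"
      using near[OF that] by blast
  qed
  have "a \<in> l2"
  proof (rule l2I_finite_sums_le)
    fix F :: "'k set" assume F: "finite F"
    have "(\<Sum>k\<in>F. (cmod (a k))\<^sup>2) \<le> (\<Sum>k\<in>F. 2 * (cmod (a k - c 0 k))\<^sup>2 + 2 * (cmod (c 0 k))\<^sup>2)"
    proof (rule sum_mono)
      fix k show "(cmod (a k))\<^sup>2 \<le> 2 * (cmod (a k - c 0 k))\<^sup>2 + 2 * (cmod (c 0 k))\<^sup>2"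
        using cmod_add_squared_le[of 1 "a k - c 0 k" "c 0 k"] by simp
    qed
    also have "\<dots> = 2 * (\<Sum>k\<in>F. (cmod (a k - c 0 k))\<^sup>2) + 2 * (\<Sum>k\<in>F. (cmod (c 0 k))\<^sup>2)"
      by (simp add: sum.distrib sum_distrib_left)
    also have "(\<Sum>k\<in>F. (cmod (c 0 k))\<^sup>2) = (\<Sum>k\<in>F \<inter> F0 0. (cmod (c 0 k))\<^sup>2)"
      using F by (intro sum.mono_neutral_right) (auto simp: c_def)
    also have "\<dots> \<le> (\<Sum>k\<in>F0 0. (cmod (c 0 k))\<^sup>2)"
      using F0 by (intro sum_mono2) auto
    finally show "(\<Sum>k\<in>F. (cmod (a k))\<^sup>2) \<le> 2 * ((2 * \<epsilon> 0)\<^sup>2 / A) + 2 * (\<Sum>k\<in>F0 0. (cmod (c 0 k))\<^sup>2)"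
      using a_near[OF F, of 0] by linarith
  qed
  moreover have "L2_has_sum a g f"
  proof (rule L2_has_sum_I)
    fix e :: real assume "0 < e"
    have "(\<lambda>n. \<epsilon> n + sqrt (B * ((2 * \<epsilon> n)\<^sup>2 / A))) \<longlonglongrightarrow> 0"
      using \<epsilon>(3) \<open>0 < A\<close> by (auto intro!: tendsto_eq_intros)
    from order_tendstoD(2)[OF this \<open>0 < e\<close>] obtain n where n: "\<epsilon> n + sqrt (B * ((2 * \<epsilon> n)\<^sup>2 / A)) < e"
      by (auto simp: eventually_sequentially)
    have "L2_norm (\<lambda>x. f x - (\<Sum>k\<in>F. a k * g k x)) < e" if F: "finite F" "F0 n \<subseteq> F" for F
    proof -
      have "L2_norm (\<lambda>x. f x - (\<Sum>k\<in>F. a k * g k x)) \<le> L2_norm (\<lambda>x. f x - (\<Sum>k\<in>F. c n k * g k x))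
          + L2_norm (\<lambda>x. (\<Sum>k\<in>F. c n k * g k x) - (\<Sum>k\<in>F. a k * g k x))"
        by (intro L2_norm_diff_triangle S fL2 L2_sum g)
      also have "L2_norm (\<lambda>x. (\<Sum>k\<in>F. c n k * g k x) - (\<Sum>k\<in>F. a k * g k x))
          = L2_norm (\<lambda>x. \<Sum>k\<in>F. (a k - c n k) * g k x)"
        by (subst L2_norm_minus_commute) (simp add: left_diff_distrib sum_subtractf)
      also have "\<dots> \<le> sqrt (B * ((2 * \<epsilon> n)\<^sup>2 / A))"
        using upper F(1) a_near[OF F(1)] \<open>0 \<le> B\<close> by (rule L2_norm_sum_le)
      finally show ?thesis
        using c[OF F] n by linarith
    qed
    then show "\<exists>F0. finite F0 \<and>
        (\<forall>F. finite F \<longrightarrow> F0 \<subseteq> F \<longrightarrow> L2_norm (\<lambda>x. f x - (\<Sum>k\<in>F. a k * g k x)) < e)"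
      using F0 by blast
  qed
  ultimately show ?thesis by blast
qed

text \<open>Both Riesz inequalities pass to the limit along the finite index sets, since norms are
  continuous and the partial sums of \<open>\<bar>a k\<bar>\<^sup>2\<close> converge.\<close>

lemma riesz_basis_if_finite_bounds:
  fixes g :: "'k \<Rightarrow> 'a::euclidean_space \<Rightarrow> complex"
  assumes g: "\<And>k. g k \<in> L2" and "0 < A" "A \<le> B"
    and lower: "\<And>F c. finite F \<Longrightarrow>
      A * (\<Sum>k\<in>F. (cmod (c k))\<^sup>2) \<le> (L2_norm (\<lambda>x. \<Sum>k\<in>F. c k * g k x))\<^sup>2"
    and upper: "\<And>F c. finite F \<Longrightarrow>
      (L2_norm (\<lambda>x. \<Sum>k\<in>F. c k * g k x))\<^sup>2 \<le> B * (\<Sum>k\<in>F. (cmod (c k))\<^sup>2)"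
  shows "riesz_basis g {f \<in> L2. \<exists>a\<in>l2. L2_has_sum a g f}"
proof -
  have "0 \<le> B" using assms by linarith
  have "L2_closed_span g = {f \<in> L2. \<exists>a\<in>l2. L2_has_sum a g f}"
  proof (intro set_eqI iffI)
    fix f assume f: "f \<in> L2_closed_span g"
    then have "f \<in> L2"
      by (simp add: L2_closed_span_def)
    moreover have "\<exists>a\<in>l2. L2_has_sum a g f"
      by (rule L2_closed_span_subset[OF g \<open>0 < A\<close> \<open>0 \<le> B\<close> lower upper f])
    ultimately show "f \<in> {f \<in> L2. \<exists>a\<in>l2. L2_has_sum a g f}"
      by simp
  next
    fix f assume "f \<in> {f \<in> L2. \<exists>a\<in>l2. L2_has_sum a g f}"
    then obtain a where f: "f \<in> L2" "L2_has_sum a g f" by blast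
    have "\<exists>F c. finite F \<and> L2_norm (\<lambda>x. f x - (\<Sum>k\<in>F. c k * g k x)) < e" if "0 < e" for e
    proof -
      have "\<forall>\<^sub>F F in finite_subsets_at_top UNIV. L2_norm (\<lambda>x. f x - (\<Sum>k\<in>F. a k * g k x)) < e"
        using f(2) that unfolding L2_has_sum_def by (rule order_tendstoD(2))
      then show ?thesis
        unfolding eventually_finite_subsets_at_top by blast
    qed
    then show "f \<in> L2_closed_span g"
      using f(1) by (simp add: L2_closed_span_def)
  qed
  moreover have "\<exists>f\<in>L2. L2_has_sum a g f \<and>
      A * (l2_norm a)\<^sup>2 \<le> (L2_norm f)\<^sup>2 \<and> (L2_norm f)\<^sup>2 \<le> B * (l2_norm a)\<^sup>2" if a: "a \<in> l2" for a
  proof -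
    obtain f where f: "f \<in> L2" "L2_has_sum a g f"
      by (rule L2_has_sum_exists[OF g \<open>0 \<le> B\<close> upper a])
    let ?U = "finite_subsets_at_top UNIV :: 'k set filter"
    have lim: "((\<lambda>F. (L2_norm (\<lambda>x. \<Sum>k\<in>F. a k * g k x))\<^sup>2) \<longlongrightarrow> (L2_norm f)\<^sup>2) ?U"
      using f(2) unfolding L2_has_sum_def
      by (intro tendsto_power L2_norm_tendsto[OF _ f(1)] L2_sum g)
    have fin: "\<forall>\<^sub>F F in ?U. finite F"
      by (rule eventually_finite_subsets_at_top_weakI)
    note l2lim = tendsto_mult_left[OF l2_norm_sums[OF a]]
    have "A * (l2_norm a)\<^sup>2 \<le> (L2_norm f)\<^sup>2"
      by (rule tendsto_le[OF _ lim l2lim]) (auto intro: eventually_mono[OF fin] lower)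
    moreover have "(L2_norm f)\<^sup>2 \<le> B * (l2_norm a)\<^sup>2"
      by (rule tendsto_le[OF _ l2lim lim]) (auto intro: eventually_mono[OF fin] upper)
    ultimately show ?thesis
      using f by blast
  qed
  ultimately show ?thesis
    unfolding riesz_basis_def using g \<open>0 < A\<close> \<open>A \<le> B\<close> by blast
qed

section \<open>Affine substitutions and continuity of translations\<close>

context
  fixes c :: real and t :: "'a::euclidean_space"
  assumes c: "c \<noteq> 0"
begin

lemma nn_integral_affine:
  assumes [measurable]: "f \<in> borel_measurable borel"
  shows "(\<integral>\<^sup>+x. f x \<partial>lborel) = ennreal (\<bar>c\<bar> ^ DIM('a)) * (\<integral>\<^sup>+x. f (t + c *\<^sub>R x) \<partial>lborel)"
  by (subst lborel_affine[OF c, of t])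
    (simp add: nn_integral_density nn_integral_distr nn_integral_cmult)

lemma integrable_affine:
  fixes f :: "'a \<Rightarrow> 'b::{banach, second_countable_topology}"
  assumes "integrable lborel f"
  shows "integrable lborel (\<lambda>x. f (t + c *\<^sub>R x))"
proof -
  have [measurable]: "f \<in> borel_measurable borel"
    using assms by (simp add: borel_measurable_integrable)
  have "ennreal (\<bar>c\<bar> ^ DIM('a)) * (\<integral>\<^sup>+x. norm (f (t + c *\<^sub>R x)) \<partial>lborel) < \<infinity>"
    using assms by (subst nn_integral_affine[symmetric]) (auto simp: integrable_iff_bounded)
  then have "(\<integral>\<^sup>+x. norm (f (t + c *\<^sub>R x)) \<partial>lborel) < \<infinity>"
    using c by (auto simp: ennreal_mult_less_top)
  then show ?thesis
    by (simp add: integrable_iff_bounded)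
qed

lemma integral_affine:
  fixes f :: "'a \<Rightarrow> 'b::{banach, second_countable_topology}"
  assumes "integrable lborel f"
  shows "(LINT x|lborel. f x) = (\<bar>c\<bar> ^ DIM('a)) *\<^sub>R (LINT x|lborel. f (t + c *\<^sub>R x))"
proof -
  have [measurable]: "f \<in> borel_measurable borel"
    using assms by (simp add: borel_measurable_integrable)
  show ?thesis
    using integrable_affine[OF assms]
    by (subst lborel_affine[OF c, of t]) (simp add: integral_density integral_distr)
qed

end

lemma nn_integral_translate:
  fixes t :: "'a::euclidean_space"
  assumes "f \<in> borel_measurable borel"
  shows "(\<integral>\<^sup>+x. f (x + t) \<partial>lborel) = (\<integral>\<^sup>+x. f x \<partial>lborel)"
  using nn_integral_affine[of 1 f t, OF _ assms] by (simp add: add.commute)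

lemma integrable_translate:
  fixes f :: "'a::euclidean_space \<Rightarrow> 'b::{banach, second_countable_topology}"
  assumes "integrable lborel f"
  shows "integrable lborel (\<lambda>x. f (x + t))"
  using integrable_affine[of 1 f t, OF _ assms] by (simp add: add.commute)

lemma integral_translate:
  fixes f :: "'a::euclidean_space \<Rightarrow> 'b::{banach, second_countable_topology}"
  assumes "integrable lborel f"
  shows "(LINT x|lborel. f (x + t)) = (LINT x|lborel. f x)"
  using integral_affine[of 1 f t, OF _ assms] by (simp add: add.commute)

lemma integral_norm_translate_diff_le:
  fixes f g :: "'a::euclidean_space \<Rightarrow> 'b::{banach, second_countable_topology}"
  assumes f: "integrable lborel f" and g: "integrable lborel g"
  shows "(LINT x|lborel. norm (f (x + t) - f x))
     \<le> (LINT x|lborel. norm (g (x + t) - g x)) + 2 * (LINT x|lborel. norm (f x - g x))"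
proof -
  have d: "integrable lborel (\<lambda>x. norm (f x - g x))"
    using f g by auto
  have "(LINT x|lborel. norm (f (x + t) - f x)) \<le>
      (LINT x|lborel. norm (f (x + t) - g (x + t)) + norm (g (x + t) - g x) + norm (f x - g x))"
  proof (rule integral_mono)
    fix x show "norm (f (x + t) - f x) \<le>
        norm (f (x + t) - g (x + t)) + norm (g (x + t) - g x) + norm (f x - g x)"
      by (rule norm_diff_triangle_le[where y = "g x"] norm_diff_triangle_le[where y = "g (x + t)"]
          norm_diff_triangle_ineq | simp add: norm_minus_commute)+
  qed (use f g d in \<open>auto intro!: Bochner_Integration.integrable_add integrable_norm Bochner_Integration.integrable_diff integrable_translate\<close>)
  also have "\<dots> = (LINT x|lborel. norm (f (x + t) - g (x + t))) + (LINT x|lborel. norm (g (x + t) - g x))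
      + (LINT x|lborel. norm (f x - g x))"
    using f g d by (simp add: integrable_translate[OF d] integrable_translate)
  also have "(LINT x|lborel. norm (f (x + t) - g (x + t))) = (LINT x|lborel. norm (f x - g x))"
    by (rule integral_translate[OF d])
  finally show ?thesis by simp
qed

lemma translate_tendsto_if_approx:
  fixes f :: "'a::euclidean_space \<Rightarrow> 'b::{banach, second_countable_topology}"
  assumes f: "integrable lborel f"
    and approx: "\<And>e. 0 < e \<Longrightarrow> \<exists>g. integrable lborel g \<and> (LINT x|lborel. norm (f x - g x)) \<le> e \<and>
          (\<lambda>n. LINT x|lborel. norm (g (x + t n) - g x)) \<longlonglongrightarrow> 0"
  shows "(\<lambda>n. LINT x|lborel. norm (f (x + t n) - f x)) \<longlonglongrightarrow> 0"
proof (rule tendstoI)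
  fix e :: real assume "0 < e"
  then obtain g where g: "integrable lborel g" "(LINT x|lborel. norm (f x - g x)) \<le> e / 4"
      "(\<lambda>n. LINT x|lborel. norm (g (x + t n) - g x)) \<longlonglongrightarrow> 0"
    using approx[of "e / 4"] by auto
  have "\<forall>\<^sub>F n in sequentially. (LINT x|lborel. norm (g (x + t n) - g x)) < e / 2"
    using g(3) \<open>0 < e\<close> by (intro order_tendstoD) auto
  then show "\<forall>\<^sub>F n in sequentially. dist (LINT x|lborel. norm (f (x + t n) - f x)) 0 < e"
  proof eventually_elim
    fix n assume "(LINT x|lborel. norm (g (x + t n) - g x)) < e / 2"
    then show "dist (LINT x|lborel. norm (f (x + t n) - f x)) 0 < e"
      using integral_norm_translate_diff_le[OF f g(1), of "t n"] g(2)
      by (simp add: dist_real_def)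
  qed
qed

text \<open>For an open set \<open>U\<close> of finite measure, \<open>U - (U - t)\<close> shrinks to the empty set pointwise,
  and \<open>(U - t) - U\<close> has the same measure because both sets have the measure of \<open>U\<close>.\<close>

lemma translate_tendsto_open:
  fixes U :: "'a::euclidean_space set" and c :: "'b::{banach, second_countable_topology}"
  assumes U: "open U" "emeasure lborel U < \<infinity>" and t: "t \<longlonglongrightarrow> 0"
  shows "(\<lambda>n. LINT x|lborel. norm (indicator U (x + t n) *\<^sub>R c - indicator U x *\<^sub>R c)) \<longlonglongrightarrow> 0"
proof -
  let ?u = "indicator U :: 'a \<Rightarrow> real"
  have [measurable]: "U \<in> sets borel" using U by simp
  have int: "integrable lborel ?u"
    using U by (simp add: integrable_indicator_iff)
  note int' = integrable_translate[OF int]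
  have int2: "integrable lborel (\<lambda>x. ?u x * (1 - ?u (x + s)))" for s
    by (rule Bochner_Integration.integrable_bound[OF int]) (auto simp: indicator_def)
  have "(\<lambda>n. LINT x|lborel. ?u x * (1 - ?u (x + t n))) \<longlonglongrightarrow> (LINT x|(lborel :: 'a measure). (0::real))"
  proof (rule integral_dominated_convergence[where w = ?u])
    show "AE x in lborel. (\<lambda>n. ?u x * (1 - ?u (x + t n))) \<longlonglongrightarrow> 0"
    proof (rule AE_I2)
      fix x
      show "(\<lambda>n. ?u x * (1 - ?u (x + t n))) \<longlonglongrightarrow> 0"
      proof (cases "x \<in> U")
        case True
        have "(\<lambda>n. x + t n) \<longlonglongrightarrow> x"
          using tendsto_add[OF tendsto_const t, of x] by simp
        then have "\<forall>\<^sub>F n in sequentially. x + t n \<in> U"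
          using U(1) True by (rule topological_tendstoD)
        then show ?thesis
          by (intro tendsto_eventually) (erule eventually_mono, simp)
      qed simp
    qed
  qed (use int in \<open>auto simp: indicator_def\<close>)
  then have lim: "(\<lambda>n. 2 * norm c * (LINT x|lborel. ?u x * (1 - ?u (x + t n)))) \<longlonglongrightarrow> 0"
    by (intro tendsto_mult_right_zero) simp
  have "(LINT x|lborel. norm (?u (x + s) *\<^sub>R c - ?u x *\<^sub>R c)) =
      2 * norm c * (LINT x|lborel. ?u x * (1 - ?u (x + s)))" for s
  proof -
    have "(LINT x|lborel. norm (?u (x + s) *\<^sub>R c - ?u x *\<^sub>R c)) =
        (LINT x|lborel. norm c * (2 * (?u x * (1 - ?u (x + s))) + (?u (x + s) - ?u x)))"
      by (intro Bochner_Integration.integral_cong) (auto simp: indicator_def)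
    also have "\<dots> = norm c * (2 * (LINT x|lborel. ?u x * (1 - ?u (x + s))) +
        ((LINT x|lborel. ?u (x + s)) - (LINT x|lborel. ?u x)))"
      using int int' int2 by simp
    also have "(LINT x|lborel. ?u (x + s)) = (LINT x|lborel. ?u x)"
      by (rule integral_translate[OF int])
    finally show ?thesis by simp
  qed
  then show ?thesis using lim by simp
qed

text \<open>Continuity of translations in \<open>L1\<close> is inherited from open sets by measurable sets of finite
  measure, through outer regularity, and from these by all integrable functions.\<close>

lemma translate_tendsto_L1:
  fixes f :: "'a::euclidean_space \<Rightarrow> 'b::{banach, second_countable_topology}"
  assumes f: "integrable lborel f" and t: "t \<longlonglongrightarrow> 0"
  shows "(\<lambda>n. LINT x|lborel. norm (f (x + t n) - f x)) \<longlonglongrightarrow> 0"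
  using f
proof (induction rule: integrable_induct)
  case (base A c)
  then have A[measurable]: "A \<in> sets borel" by simp
  show ?case
  proof (rule translate_tendsto_if_approx)
    show "integrable lborel (\<lambda>x. indicator A x *\<^sub>R c)"
      using base by simp
    fix e :: real assume "0 < e"
    define d where "d = e / (norm c + 1)"
    have d: "0 < d" "d * norm c \<le> e"
      using \<open>0 < e\<close> norm_ge_zero[of c] by (auto simp: d_def divide_simps add_nonneg_pos)
    obtain U where U: "open U" "A \<subseteq> U" "emeasure lborel (U - A) < ennreal d"
      by (rule outer_regular_lborel[OF A \<open>0 < d\<close>])
    have [measurable]: "U \<in> sets borel" using U by simp
    have "emeasure lborel U = emeasure lborel (U - A) + emeasure lborel A"
      using U by (subst plus_emeasure) (auto intro: arg_cong[where f = "emeasure lborel"])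
    moreover have finD: "emeasure lborel (U - A) < \<infinity>"
      using less_trans[OF U(3) ennreal_less_top] by simp
    ultimately have fin: "emeasure lborel U < \<infinity>"
      using base(2) by (simp add: less_top[symmetric] ennreal_add_eq_top)
    have "(LINT x|lborel. norm (indicator A x *\<^sub>R c - indicator U x *\<^sub>R c)) =
        (LINT x|lborel. norm c * indicator (U - A) x)"
      using U(2) by (intro Bochner_Integration.integral_cong) (auto simp: indicator_def)
    also have "\<dots> = norm c * measure lborel (U - A)"
      using finD by simp
    also have "measure lborel (U - A) \<le> d"
      using U(3) \<open>0 < d\<close> by (simp add: measure_def enn2real_leI less_imp_le)
    finally have "(LINT x|lborel. norm (indicator A x *\<^sub>R c - indicator U x *\<^sub>R c)) \<le> norm c * d"
      by (simp add: mult_left_mono)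
    then have "(LINT x|lborel. norm (indicator A x *\<^sub>R c - indicator U x *\<^sub>R c)) \<le> e"
      using d(2) by (simp add: mult.commute)
    then show "\<exists>g. integrable lborel g \<and> (LINT x|lborel. norm (indicator A x *\<^sub>R c - g x)) \<le> e \<and>
          (\<lambda>n. LINT x|lborel. norm (g (x + t n) - g x)) \<longlonglongrightarrow> 0"
      using fin translate_tendsto_open[OF U(1) fin t, of c]
      by (intro exI[of _ "\<lambda>x. indicator U x *\<^sub>R c"]) simp
  qed
next
  case (add f g)
  have "(\<lambda>n. (LINT x|lborel. norm (f (x + t n) - f x)) + (LINT x|lborel. norm (g (x + t n) - g x))) \<longlonglongrightarrow> 0"
    using tendsto_add[OF add.IH] by simp
  then show ?case
  proof (rule Lim_null_comparison[rotated], intro always_eventually allI)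
    fix n
    have I: "integrable lborel (\<lambda>x. norm (f (x + t n) - f x))" "integrable lborel (\<lambda>x. norm (g (x + t n) - g x))"
      using add by (auto intro!: integrable_norm Bochner_Integration.integrable_diff integrable_translate)
    have "(LINT x|lborel. norm (f (x + t n) + g (x + t n) - (f x + g x))) \<le>
        (LINT x|lborel. norm (f (x + t n) - f x) + norm (g (x + t n) - g x))"
      using I add by (intro integral_mono integrable_norm Bochner_Integration.integrable_diff
        Bochner_Integration.integrable_add integrable_translate norm_diff_triangle_ineq) auto
    then show "norm (LINT x|lborel. norm (f (x + t n) + g (x + t n) - (f x + g x))) \<le>
        (LINT x|lborel. norm (f (x + t n) - f x)) + (LINT x|lborel. norm (g (x + t n) - g x))"
      using I by simp
  qed
next
  case (lim f s)
  have [measurable]: "f \<in> borel_measurable lborel" "s i \<in> borel_measurable lborel" for i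
    using lim by (auto simp: borel_measurable_integrable)
  show ?case
  proof (rule translate_tendsto_if_approx)
    fix e :: real assume "0 < e"
    have "(\<lambda>i. LINT x|lborel. norm (f x - s i x)) \<longlonglongrightarrow> (LINT x|(lborel :: 'a measure). (0::real))"
    proof (rule integral_dominated_convergence[where w = "\<lambda>x. 3 * norm (f x)"])
      show "AE x in lborel. (\<lambda>i. norm (f x - s i x)) \<longlonglongrightarrow> 0"
        using lim.hyps(2) by (auto intro!: AE_I2 tendsto_eq_intros)
      show "AE x in lborel. norm (norm (f x - s i x)) \<le> 3 * norm (f x)" for i
        using lim.hyps(3)[of _ i] by (auto intro!: AE_I2 order_trans[OF norm_triangle_ineq4])
    qed (use lim in auto)
    then have "\<forall>\<^sub>F i in sequentially. (LINT x|lborel. norm (f x - s i x)) < e"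
      using \<open>0 < e\<close> by (intro order_tendstoD) auto
    then obtain i where "(LINT x|lborel. norm (f x - s i x)) < e"
      by (auto simp: eventually_sequentially)
    then show "\<exists>g. integrable lborel g \<and> (LINT x|lborel. norm (f x - g x)) \<le> e \<and>
          (\<lambda>n. LINT x|lborel. norm (g (x + t n) - g x)) \<longlonglongrightarrow> 0"
      using lim by (intro exI[of _ "s i"]) auto
  qed (use lim in auto)
qed

text \<open>The map \<open>u \<mapsto> \<bar>u\<bar> * u\<close> is strongly monotone; it transports continuity of translations from
  \<open>L1\<close> to \<open>L2\<close> without a second approximation argument.\<close>

lemma cmod_diff_squared_le:
  "(cmod (u - v))\<^sup>2 \<le> 2 * cmod (of_real (cmod u) * u - of_real (cmod v) * v)"
proof (cases "u = v")
  case False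
  define w where "w = cmod u *\<^sub>R u - cmod v *\<^sub>R v"
  have "w \<bullet> (u - v) = (cmod u + cmod v) / 2 * (cmod (u - v))\<^sup>2 + (cmod u - cmod v)\<^sup>2 * (cmod u + cmod v) / 2"
  proof -
    have e1: "w \<bullet> (u - v) = cmod u * (cmod u)\<^sup>2 + cmod v * (cmod v)\<^sup>2 - (cmod u + cmod v) * (u \<bullet> v)"
      by (simp add: w_def inner_diff inner_commute[of v u] dot_square_norm algebra_simps)
    have e2: "(cmod (u - v))\<^sup>2 = (cmod u)\<^sup>2 + (cmod v)\<^sup>2 - 2 * (u \<bullet> v)"
      by (simp add: power2_norm_eq_inner inner_diff inner_commute[of v u])
    show ?thesis
      unfolding e1 e2 by (simp add: field_simps power2_eq_square)
  qed
  moreover have "0 \<le> (cmod u - cmod v)\<^sup>2 * (cmod u + cmod v) / 2"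
    by simp
  moreover have "cmod (u - v) / 2 * (cmod (u - v))\<^sup>2 \<le> (cmod u + cmod v) / 2 * (cmod (u - v))\<^sup>2"
    by (intro mult_right_mono divide_right_mono norm_triangle_ineq4) auto
  moreover have "w \<bullet> (u - v) \<le> cmod w * cmod (u - v)"
    by (rule norm_cauchy_schwarz)
  ultimately have "cmod (u - v) / 2 * (cmod (u - v))\<^sup>2 \<le> cmod w * cmod (u - v)"
    by linarith
  then have "cmod (u - v) * (cmod (u - v))\<^sup>2 \<le> cmod (u - v) * (2 * cmod w)"
    by (simp add: field_simps)
  then have "(cmod (u - v))\<^sup>2 \<le> 2 * cmod w"
    using False by (simp only: mult_le_cancel_left) auto
  then show ?thesis by (simp add: w_def scaleR_conv_of_real)
qed simp

lemma L2_translate: "f \<in> L2 \<Longrightarrow> (\<lambda>x. f (x + t)) \<in> L2"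
  using integrable_translate[OF L2_integrable, of f t] by (simp add: L2_def measurable_compose[of "\<lambda>x. x + t" borel borel f])

lemma L2_norm_translate: "f \<in> L2 \<Longrightarrow> L2_norm (\<lambda>x. f (x + t)) = L2_norm f"
  using integral_translate[OF L2_integrable, of f t] by (simp add: L2_norm_def)

lemma translate_tendsto_L2:
  fixes f :: "'a::euclidean_space \<Rightarrow> complex"
  assumes f: "f \<in> L2" and t: "t \<longlonglongrightarrow> 0"
  shows "(\<lambda>n. L2_norm (\<lambda>x. f (x + t n) - f x)) \<longlonglongrightarrow> 0"
proof -
  note [measurable] = L2_measurable[OF f]
  define g where "g x = of_real (cmod (f x)) * f x" for x
  have g: "integrable lborel g"
    using L2_integrable[OF f] unfolding g_def
    by (rule Bochner_Integration.integrable_bound) (auto simp: norm_mult power2_eq_square)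
  have "(\<lambda>n. 2 * (LINT x|lborel. norm (g (x + t n) - g x))) \<longlonglongrightarrow> 0"
    by (intro tendsto_mult_right_zero translate_tendsto_L1 g t)
  then have "(\<lambda>n. (L2_norm (\<lambda>x. f (x + t n) - f x))\<^sup>2) \<longlonglongrightarrow> 0"
  proof (rule Lim_null_comparison[rotated], intro always_eventually allI)
    fix n
    have "(LINT x|lborel. (cmod (f (x + t n) - f x))\<^sup>2) \<le> (LINT x|lborel. 2 * norm (g (x + t n) - g x))"
    proof (rule integral_mono)
      show "integrable lborel (\<lambda>x. 2 * norm (g (x + t n) - g x))"
        using g by (auto intro!: integrable_translate)
      show "integrable lborel (\<lambda>x. (cmod (f (x + t n) - f x))\<^sup>2)"
        by (intro L2_integrable L2_diff L2_translate f)
      show "(cmod (f (x + t n) - f x))\<^sup>2 \<le> 2 * norm (g (x + t n) - g x)" for x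
        unfolding g_def by (rule cmod_diff_squared_le)
    qed
    then show "norm ((L2_norm (\<lambda>x. f (x + t n) - f x))\<^sup>2) \<le> 2 * (LINT x|lborel. norm (g (x + t n) - g x))"
      by (simp add: L2_norm_squared)
  qed
  from tendsto_real_sqrt[OF this] show ?thesis by simp
qed

section \<open>Gaussian mollification\<close>

text \<open>Integrals of products of functions of the single coordinates factor; this reduces the
  Fourier transform of the Gaussian, and later the orthogonality of characters, to dimension one.\<close>

lemma
  fixes f :: "'a::euclidean_space \<Rightarrow> real \<Rightarrow> complex"
  assumes f: "\<And>b. b \<in> Basis \<Longrightarrow> integrable lborel (f b)"
  shows integrable_prod_Basis: "integrable lborel (\<lambda>x::'a. \<Prod>b\<in>Basis. f b (x \<bullet> b))"
    and integral_prod_Basis: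
      "(LINT x|lborel. (\<Prod>b\<in>Basis. f b ((x::'a) \<bullet> b))) = (\<Prod>b\<in>Basis. (LINT s|lborel. f b s))"
proof -
  interpret product_sigma_finite "\<lambda>_::'a. lborel :: real measure"
    by standard
  let ?T = "\<lambda>z::'a \<Rightarrow> real. \<Sum>b\<in>Basis. z b *\<^sub>R b"
  have [measurable]: "f b \<in> borel_measurable borel" if "b \<in> Basis" for b
    using f[OF that] by (simp add: borel_measurable_integrable)
  have [measurable]: "?T \<in> (\<Pi>\<^sub>M b\<in>Basis. lborel) \<rightarrow>\<^sub>M borel"
    by measurable
  have [measurable]: "(\<lambda>x::'a. \<Prod>b\<in>Basis. f b (x \<bullet> b)) \<in> borel_measurable borel"
    by (intro borel_measurable_prod) measurable
  have eq: "(\<Prod>b\<in>Basis. f b (?T z \<bullet> b)) = (\<Prod>b\<in>Basis. f b (z b))" for z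
    by (intro prod.cong) (simp_all add: inner_sum_left inner_Basis if_distrib cong: if_cong)
  show "integrable lborel (\<lambda>x::'a. \<Prod>b\<in>Basis. f b (x \<bullet> b))"
    unfolding lborel_eq[where 'a = 'a]
    by (subst integrable_distr_eq) (auto simp: eq f intro!: product_integrable_prod)
  show "(LINT x|lborel. (\<Prod>b\<in>Basis. f b ((x::'a) \<bullet> b))) = (\<Prod>b\<in>Basis. (LINT s|lborel. f b s))"
    unfolding lborel_eq[where 'a = 'a]
    by (subst integral_distr) (auto simp: eq f intro!: product_integral_prod)
qed

text \<open>The Gaussian is left unnormalized, with value 1 at the origin, because it serves as a damping
  factor as often as it serves as a kernel.\<close>

definition gauss :: "'a::euclidean_space \<Rightarrow> real" where
  "gauss t = exp (- (norm t)\<^sup>2 / 2)"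

abbreviation gauss_mass :: "'a::euclidean_space itself \<Rightarrow> real" where
  "gauss_mass _ \<equiv> sqrt (2 * pi) ^ DIM('a)"

lemma gauss_le_1: "gauss t \<le> 1" and gauss_minus: "gauss (- t) = gauss t"
  by (simp_all add: gauss_def)

lemma gauss_nonneg [simp]: "0 \<le> gauss t"
  by (simp add: gauss_def)

lemma borel_measurable_gauss [measurable]: "gauss \<in> borel_measurable borel"
  unfolding gauss_def by measurable

lemma
  shows integrable_gauss_real: "integrable lborel (\<lambda>s. of_real (exp (- s\<^sup>2 / 2)) * exp (\<i> * of_real (y * s)))"
    and integral_gauss_real:
      "(LINT s|lborel. of_real (exp (- s\<^sup>2 / 2)) * exp (\<i> * of_real (y * s))) = of_real (sqrt (2 * pi) * exp (- y\<^sup>2 / 2))"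
proof -
  have eq: "of_real (exp (- s\<^sup>2 / 2)) * exp (\<i> * of_real (y * s)) =
      of_real (sqrt (2 * pi)) * (std_normal_density s *\<^sub>R iexp (y * s))" for s
    by (simp add: std_normal_density_def scaleR_conv_of_real)
  have "integrable lborel (\<lambda>s. std_normal_density s *\<^sub>R iexp (y * s))"
    by (rule Bochner_Integration.integrable_bound[OF integrable_normal_density[of 1 0]]) auto
  then show "integrable lborel (\<lambda>s. of_real (exp (- s\<^sup>2 / 2)) * exp (\<i> * of_real (y * s)))"
    unfolding eq by (rule integrable_mult_right)
  have "(LINT s|lborel. std_normal_density s *\<^sub>R iexp (y * s)) = char std_normal_distribution y"
    unfolding char_def by (subst integral_density) auto
  then show "(LINT s|lborel. of_real (exp (- s\<^sup>2 / 2)) * exp (\<i> * of_real (y * s))) = of_real (sqrt (2 * pi) * exp (- y\<^sup>2 / 2))"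
    unfolding eq integral_mult_right_zero char_std_normal_distribution by simp
qed

lemma gauss_prod: "gauss (t::'a::euclidean_space) = (\<Prod>b\<in>Basis. exp (- (t \<bullet> b)\<^sup>2 / 2))"
proof -
  have "(norm t)\<^sup>2 = (\<Sum>b\<in>Basis. (t \<bullet> b)\<^sup>2)"
    unfolding power2_norm_eq_inner by (subst euclidean_inner) (simp add: power2_eq_square)
  then show ?thesis
    by (simp add: gauss_def exp_sum[symmetric] sum_divide_distrib[symmetric] sum_negf)
qed

lemma gauss_character_prod:
  "of_real (gauss t) * exp (\<i> * of_real (x \<bullet> t)) =
     (\<Prod>b\<in>Basis. of_real (exp (- (t \<bullet> b)\<^sup>2 / 2)) * exp (\<i> * of_real ((x \<bullet> b) * (t \<bullet> b))))"
  for t x :: "'a::euclidean_space"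
proof -
  have "exp (\<i> * of_real (x \<bullet> t)) = (\<Prod>b\<in>Basis. exp (\<i> * of_real ((x \<bullet> b) * (t \<bullet> b))))"
    by (subst euclidean_inner) (simp add: exp_sum[symmetric] sum_distrib_left)
  then show ?thesis
    by (simp add: prod.distrib gauss_prod[of t])
qed

lemma integrable_gauss_character:
  "integrable lborel (\<lambda>t::'a::euclidean_space. of_real (gauss t) * exp (\<i> * of_real (x \<bullet> t)))"
  unfolding gauss_character_prod
  by (rule integrable_prod_Basis[where f = "\<lambda>b s. of_real (exp (- s\<^sup>2 / 2)) * exp (\<i> * of_real ((x \<bullet> b) * s))"])
    (rule integrable_gauss_real)

lemma integral_gauss_character:
  fixes x :: "'a::euclidean_space"
  shows "(LINT t|lborel. of_real (gauss t) * exp (\<i> * of_real (x \<bullet> t))) =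
    of_real (gauss_mass TYPE('a) * gauss x)"
  unfolding gauss_character_prod
    integral_prod_Basis[where f = "\<lambda>b s. of_real (exp (- s\<^sup>2 / 2)) * exp (\<i> * of_real ((x \<bullet> b) * s))", OF integrable_gauss_real]
    integral_gauss_real
  by (simp add: prod.distrib gauss_prod[of x])

lemma integrable_gauss: "integrable lborel (gauss :: 'a::euclidean_space \<Rightarrow> real)"
proof -
  have "integrable lborel (\<lambda>t::'a. of_real (gauss t) :: complex)"
    using integrable_gauss_character[of 0] by simp
  then show ?thesis
    using complex_of_real_integrable_eq by blast
qed

lemma integral_gauss: "(LINT t|lborel. gauss (t::'a::euclidean_space)) = gauss_mass TYPE('a)"
proof -
  have "complex_of_real (LINT t|lborel. gauss (t::'a)) = of_real (gauss_mass TYPE('a))"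
    using integral_gauss_character[of "0 :: 'a"] by (simp add: gauss_def)
  then show ?thesis
    using of_real_eq_iff by blast
qed

lemma integrable_gauss_scaled:
  "\<sigma> \<noteq> 0 \<Longrightarrow> integrable lborel (\<lambda>t::'a::euclidean_space. gauss (\<sigma> *\<^sub>R t))"
  using integrable_affine[of \<sigma> gauss 0, OF _ integrable_gauss] by simp

lemma integral_gauss_scaled_character:
  fixes x :: "'a::euclidean_space"
  assumes "0 < \<sigma>"
  shows "(LINT t|lborel. of_real (gauss (\<sigma> *\<^sub>R t)) * exp (\<i> * of_real (x \<bullet> t))) =
    of_real (gauss_mass TYPE('a) / \<sigma> ^ DIM('a) * gauss (x /\<^sub>R \<sigma>))"
proof -
  have "complex_of_real (gauss_mass TYPE('a) * gauss (x /\<^sub>R \<sigma>)) =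
      (LINT t|lborel. of_real (gauss t) * exp (\<i> * of_real ((x /\<^sub>R \<sigma>) \<bullet> t)))"
    by (rule integral_gauss_character[symmetric])
  also have "\<dots> = (\<bar>\<sigma>\<bar> ^ DIM('a)) *\<^sub>R (LINT t|lborel. of_real (gauss (0 + \<sigma> *\<^sub>R t)) * exp (\<i> * of_real ((x /\<^sub>R \<sigma>) \<bullet> (0 + \<sigma> *\<^sub>R t))))"
    using assms by (intro integral_affine integrable_gauss_character) auto
  finally show ?thesis
    using assms by (simp add: scaleR_conv_of_real field_simps)
qed

text \<open>With \<open>\<sigma>\<close> placed inside \<open>f\<close> instead of the kernel, this is visibly an average of translates of
  \<open>f\<close>. As \<open>gauss\<close> is even it is the convolution with the Gaussian density of deviation \<open>\<sigma>\<close>.\<close>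

definition mollify :: "real \<Rightarrow> ('a::euclidean_space \<Rightarrow> complex) \<Rightarrow> 'a \<Rightarrow> complex" where
  "mollify \<sigma> f y = (LINT t|lborel. of_real (gauss t) * f (y + \<sigma> *\<^sub>R t)) / of_real (gauss_mass TYPE('a))"

lemma borel_measurable_mollify [measurable]:
  assumes [measurable]: "f \<in> borel_measurable borel"
  shows "mollify \<sigma> f \<in> borel_measurable borel"
  unfolding mollify_def by measurable

text \<open>Jensen's inequality for the square: the variance of \<open>\<bar>\<phi>\<bar>\<close> with respect to the weight \<open>w\<close> is
  nonnegative.\<close>

lemma cmod_integral_squared_le:
  fixes \<phi> :: "'a \<Rightarrow> complex"
  assumes w: "integrable M w" "\<And>x. 0 \<le> w x" "(LINT x|M. w x) = 1"
    and \<phi>[measurable]: "\<phi> \<in> borel_measurable M"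
    and sq: "integrable M (\<lambda>x. w x * (cmod (\<phi> x))\<^sup>2)"
  shows "integrable M (\<lambda>x. of_real (w x) * \<phi> x)"
    and "(cmod (LINT x|M. of_real (w x) * \<phi> x))\<^sup>2 \<le> (LINT x|M. w x * (cmod (\<phi> x))\<^sup>2)"
proof -
  have [measurable]: "w \<in> borel_measurable M"
    using w by auto
  have "cmod u \<le> 1 + (cmod u)\<^sup>2" for u
    using zero_le_power2[of "cmod u - 1/2"] by (simp add: power2_diff power_divide)
  then have le: "w x * cmod (\<phi> x) \<le> w x + w x * (cmod (\<phi> x))\<^sup>2" for x
    using mult_left_mono[OF _ w(2)[of x], of "cmod (\<phi> x)" "1 + (cmod (\<phi> x))\<^sup>2"]
    by (simp add: distrib_left)
  show I: "integrable M (\<lambda>x. of_real (w x) * \<phi> x)"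
  proof (rule Bochner_Integration.integrable_bound)
    show "integrable M (\<lambda>x. w x + w x * (cmod (\<phi> x))\<^sup>2)"
      using w(1) sq by (rule Bochner_Integration.integrable_add)
    show "AE x in M. norm (of_real (w x) * \<phi> x) \<le> norm (w x + w x * (cmod (\<phi> x))\<^sup>2)"
      using le w(2) by (intro AE_I2) (simp add: norm_mult)
  qed measurable
  have I': "integrable M (\<lambda>x. w x * cmod (\<phi> x))"
    using integrable_norm[OF I] w(2) by (simp add: norm_mult)
  define c where "c = (LINT x|M. w x * cmod (\<phi> x))"
  have "0 \<le> (LINT x|M. w x * (cmod (\<phi> x) - c)\<^sup>2)"
    using w(2) by (intro integral_nonneg_AE) auto
  also have "\<dots> = (LINT x|M. w x * (cmod (\<phi> x))\<^sup>2 - 2 * c * (w x * cmod (\<phi> x)) + c\<^sup>2 * w x)"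
    by (simp add: power2_diff algebra_simps)
  also have "\<dots> = (LINT x|M. w x * (cmod (\<phi> x))\<^sup>2) - 2 * c * c + c\<^sup>2 * 1"
    using w I' sq by (simp add: c_def)
  finally have "c\<^sup>2 \<le> (LINT x|M. w x * (cmod (\<phi> x))\<^sup>2)"
    by (simp add: power2_eq_square)
  moreover have "cmod (LINT x|M. of_real (w x) * \<phi> x) \<le> c"
    using integral_norm_bound[of M "\<lambda>x. of_real (w x) * \<phi> x"] w(2) by (simp add: c_def norm_mult)
  ultimately show "(cmod (LINT x|M. of_real (w x) * \<phi> x))\<^sup>2 \<le> (LINT x|M. w x * (cmod (\<phi> x))\<^sup>2)"
    by (meson norm_ge_zero order_trans power_mono)
qed

lemma L2_affine:
  assumes "f \<in> L2" "\<sigma> \<noteq> 0"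
  shows "(\<lambda>t. f (y + \<sigma> *\<^sub>R t)) \<in> L2"
proof -
  note [measurable] = L2_measurable[OF assms(1)]
  show ?thesis
    using integrable_affine[OF assms(2) L2_integrable[OF assms(1)], of y] by (simp add: L2_def)
qed

lemma integrable_gauss_L2:
  assumes f: "f \<in> L2" and "\<sigma> \<noteq> 0"
  shows "integrable lborel (\<lambda>t. of_real (gauss t) * f (y + \<sigma> *\<^sub>R t))"
proof -
  note L = L2_affine[OF assms, of y]
  note [measurable] = L2_measurable[OF f]
  show ?thesis
  proof (rule Bochner_Integration.integrable_bound)
    show "integrable lborel (\<lambda>t. gauss t + (cmod (f (y + \<sigma> *\<^sub>R t)))\<^sup>2)"
      by (intro Bochner_Integration.integrable_add integrable_gauss L2_integrable[OF L])
    have "gauss t * u \<le> gauss t + u\<^sup>2" if "0 \<le> u" for u :: real and t :: 'a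
    proof (cases "u \<le> 1")
      case True
      then have "gauss t * u \<le> gauss t * 1" by (intro mult_left_mono) auto
      then show ?thesis by (simp add: add_increasing2)
    next
      case False
      have "gauss t * u \<le> 1 * u" using that gauss_le_1 by (intro mult_right_mono) auto
      also have "\<dots> \<le> u * u" using False by (intro mult_right_mono) auto
      finally show ?thesis by (simp add: add_increasing power2_eq_square)
    qed
    then show "AE t in lborel. norm (of_real (gauss t) * f (y + \<sigma> *\<^sub>R t)) \<le> norm (gauss t + (cmod (f (y + \<sigma> *\<^sub>R t)))\<^sup>2)"
      by (auto simp: norm_mult)
  qed auto
qed

text \<open>Mollifying averages translates, so by convexity its squared distance to \<open>f\<close> is at most the
  average of the squared distances of the translates.\<close>

lemma nn_integral_mollify_diff_le:
  fixes f :: "'a::euclidean_space \<Rightarrow> complex"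
  assumes f: "f \<in> L2" and \<sigma>: "\<sigma> \<noteq> 0"
  shows "(\<integral>\<^sup>+y. ennreal ((cmod (mollify \<sigma> f y - f y))\<^sup>2) \<partial>lborel) \<le>
    (\<integral>\<^sup>+t. ennreal (gauss t / gauss_mass TYPE('a) * (L2_norm (\<lambda>y. f (y + \<sigma> *\<^sub>R t) - f y))\<^sup>2) \<partial>lborel)"
proof -
  note [measurable] = L2_measurable[OF f]
  let ?m = "gauss_mass TYPE('a)"
  have m: "0 < ?m" by simp
  have "ennreal ((cmod (mollify \<sigma> f y - f y))\<^sup>2) \<le>
      (\<integral>\<^sup>+t. ennreal (gauss t / ?m * (cmod (f (y + \<sigma> *\<^sub>R t) - f y))\<^sup>2) \<partial>lborel)" for y
  proof -
    let ?\<phi> = "\<lambda>t. f (y + \<sigma> *\<^sub>R t) - f y"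
    have sq: "integrable lborel (\<lambda>t. gauss t / ?m * (cmod (?\<phi> t))\<^sup>2)"
    proof (rule Bochner_Integration.integrable_bound)
      show "integrable lborel (\<lambda>t. (2 * (cmod (f (y + \<sigma> *\<^sub>R t)))\<^sup>2 + gauss t * (2 * (cmod (f y))\<^sup>2)) / ?m)"
        using L2_integrable[OF L2_affine[OF f \<sigma>, of y]] integrable_gauss[where 'a = 'a] by simp
      have "gauss t * (cmod (?\<phi> t))\<^sup>2 \<le> 2 * (cmod (f (y + \<sigma> *\<^sub>R t)))\<^sup>2 + gauss t * (2 * (cmod (f y))\<^sup>2)" for t
      proof -
        have "gauss t * (cmod (?\<phi> t))\<^sup>2 \<le> gauss t * (2 * (cmod (f (y + \<sigma> *\<^sub>R t)))\<^sup>2 + 2 * (cmod (f y))\<^sup>2)"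
          using cmod_add_squared_le[of 1 "f (y + \<sigma> *\<^sub>R t)" "- f y"] by (intro mult_left_mono) auto
        also have "\<dots> \<le> 1 * (2 * (cmod (f (y + \<sigma> *\<^sub>R t)))\<^sup>2) + gauss t * (2 * (cmod (f y))\<^sup>2)"
          unfolding distrib_left by (intro add_right_mono mult_right_mono gauss_le_1) auto
        finally show ?thesis by simp
      qed
      then show "AE t in lborel. norm (gauss t / ?m * (cmod (?\<phi> t))\<^sup>2) \<le>
          norm ((2 * (cmod (f (y + \<sigma> *\<^sub>R t)))\<^sup>2 + gauss t * (2 * (cmod (f y))\<^sup>2)) / ?m)"
        using m by (intro AE_I2) (simp add: divide_right_mono)
    qed auto
    have "mollify \<sigma> f y - f y = (LINT t|lborel. of_real (gauss t / ?m) * ?\<phi> t)"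
    proof -
      have "(LINT t|lborel. of_real (gauss t / ?m) * ?\<phi> t) =
          (LINT t|lborel. (of_real (gauss t) * f (y + \<sigma> *\<^sub>R t) - of_real (gauss t) * f y) / of_real ?m)"
        by (intro Bochner_Integration.integral_cong) (auto simp: field_simps)
      also have "\<dots> = ((LINT t|lborel. of_real (gauss t) * f (y + \<sigma> *\<^sub>R t)) - of_real ?m * f y) / of_real ?m"
        using integrable_gauss_L2[OF f \<sigma>, of y] integrable_gauss[where 'a = 'a] by (simp add: integral_gauss)
      finally show ?thesis
        using m by (simp add: mollify_def diff_divide_distrib)
    qed
    then have "(cmod (mollify \<sigma> f y - f y))\<^sup>2 \<le> (LINT t|lborel. gauss t / ?m * (cmod (?\<phi> t))\<^sup>2)"
      using cmod_integral_squared_le(2)[OF _ _ _ _ sq] integrable_gauss[where 'a = 'a] m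
      by (simp add: integral_gauss)
    then show ?thesis
      using m by (subst nn_integral_eq_integral[OF sq]) (auto intro!: AE_I2 ennreal_leI)
  qed
  then have "(\<integral>\<^sup>+y. ennreal ((cmod (mollify \<sigma> f y - f y))\<^sup>2) \<partial>lborel) \<le>
      (\<integral>\<^sup>+y. \<integral>\<^sup>+t. ennreal (gauss t / ?m * (cmod (f (y + \<sigma> *\<^sub>R t) - f y))\<^sup>2) \<partial>lborel \<partial>lborel)"
    by (intro nn_integral_mono)
  also have "\<dots> = (\<integral>\<^sup>+t. \<integral>\<^sup>+y. ennreal (gauss t / ?m * (cmod (f (y + \<sigma> *\<^sub>R t) - f y))\<^sup>2) \<partial>lborel \<partial>lborel)"
    by (rule lborel_pair.Fubini') measurable
  also have "\<dots> = (\<integral>\<^sup>+t. ennreal (gauss t / ?m * (L2_norm (\<lambda>y. f (y + \<sigma> *\<^sub>R t) - f y))\<^sup>2) \<partial>lborel)"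
  proof (rule nn_integral_cong)
    fix t :: 'a
    have "0 \<le> gauss t / ?m" using m by simp
    then show "(\<integral>\<^sup>+y. ennreal (gauss t / ?m * (cmod (f (y + \<sigma> *\<^sub>R t) - f y))\<^sup>2) \<partial>lborel) =
        ennreal (gauss t / ?m * (L2_norm (\<lambda>y. f (y + \<sigma> *\<^sub>R t) - f y))\<^sup>2)"
      by (simp only: ennreal_mult zero_le_power2 nn_integral_L2[OF L2_diff[OF L2_translate[OF f] f], symmetric])
        (rule nn_integral_cmult, measurable)
  qed
  finally show ?thesis .
qed

text \<open>The distances of the translates by \<open>\<sigma> *\<^sub>R t\<close> tend to zero with \<open>\<sigma>\<close> and never exceed
  \<open>2 * L2_norm f\<close>, so their Gaussian average tends to zero by dominated convergence.\<close>

lemma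
  fixes f :: "'a::euclidean_space \<Rightarrow> complex"
  assumes f: "f \<in> L2"
  shows L2_mollify: "\<sigma> \<noteq> 0 \<Longrightarrow> mollify \<sigma> f \<in> L2"
    and mollify_tendsto_L2: "\<lbrakk>\<And>n. \<sigma>n n \<noteq> 0; \<sigma>n \<longlonglongrightarrow> 0\<rbrakk> \<Longrightarrow>
      (\<lambda>n. L2_norm (\<lambda>y. mollify (\<sigma>n n) f y - f y)) \<longlonglongrightarrow> 0"
proof -
  note [measurable] = L2_measurable[OF f]
  let ?m = "gauss_mass TYPE('a)"
  have m: "0 < ?m" by simp
  define W where "W s t = gauss t / ?m * (L2_norm (\<lambda>y. f (y + s *\<^sub>R t) - f y))\<^sup>2" for s t
  have [measurable]: "W s \<in> borel_measurable borel" for s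
    unfolding W_def L2_norm_def by measurable
  have W_le: "W s t \<le> gauss t * ((2 * L2_norm f)\<^sup>2 / ?m)" for s t
  proof -
    have "L2_norm (\<lambda>y. f (y + s *\<^sub>R t) - f y) \<le> 2 * L2_norm f"
      using L2_norm_diff_triangle[OF L2_translate[OF f] L2_zero f, of "s *\<^sub>R t"]
        L2_norm_scale[of "-1" f]
      by (simp add: L2_norm_translate[OF f])
    then show ?thesis
      unfolding W_def times_divide_eq_left times_divide_eq_right
      by (intro divide_right_mono mult_left_mono power_mono) (use m in auto)
  qed
  have fin: "(\<integral>\<^sup>+t. ennreal (gauss t * ((2 * L2_norm f)\<^sup>2 / ?m)) \<partial>(lborel :: 'a measure)) < \<infinity>"
    using integrable_gauss[where 'a = 'a] by (subst nn_integral_eq_integral) (auto intro!: AE_I2)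
  have D: "(\<lambda>y. mollify \<sigma> f y - f y) \<in> L2" if "\<sigma> \<noteq> 0" for \<sigma>
  proof -
    have "(\<integral>\<^sup>+y. ennreal ((cmod (mollify \<sigma> f y - f y))\<^sup>2) \<partial>lborel) \<le>
        (\<integral>\<^sup>+t. ennreal (gauss t * ((2 * L2_norm f)\<^sup>2 / ?m)) \<partial>(lborel :: 'a measure))"
      using W_le by (intro order_trans[OF nn_integral_mollify_diff_le[OF f that]] nn_integral_mono ennreal_leI)
        (auto simp: W_def)
    then show ?thesis
      using fin unfolding L2_iff_nn_integral by (auto intro: le_less_trans)
  qed
  show "mollify \<sigma> f \<in> L2" if "\<sigma> \<noteq> 0" for \<sigma>
    using L2_add[OF D[OF that] f] by simp
  assume \<sigma>: "\<And>n. \<sigma>n n \<noteq> 0" "\<sigma>n \<longlonglongrightarrow> 0"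
  have "(\<lambda>n. \<integral>\<^sup>+t. ennreal (W (\<sigma>n n) t) \<partial>lborel) \<longlonglongrightarrow> (\<integral>\<^sup>+t. 0 \<partial>(lborel :: 'a measure))"
  proof (rule nn_integral_dominated_convergence[OF _ _ _ _ fin])
    show "AE t in lborel. ennreal (W (\<sigma>n n) t) \<le> ennreal (gauss t * ((2 * L2_norm f)\<^sup>2 / ?m))" for n
      using W_le by (auto intro!: ennreal_leI)
    show "AE t in lborel. (\<lambda>n. ennreal (W (\<sigma>n n) t)) \<longlonglongrightarrow> 0"
    proof (rule AE_I2)
      fix t :: 'a
      have "(\<lambda>n. \<sigma>n n *\<^sub>R t) \<longlonglongrightarrow> 0"
        using tendsto_scaleR[OF \<sigma>(2) tendsto_const] by simp
      from translate_tendsto_L2[OF f this] have "(\<lambda>n. W (\<sigma>n n) t) \<longlonglongrightarrow> 0"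
        unfolding W_def by (auto intro!: tendsto_eq_intros)
      from tendsto_ennrealI[OF this] show "(\<lambda>n. ennreal (W (\<sigma>n n) t)) \<longlonglongrightarrow> 0"
        by simp
    qed
  qed auto
  then have "(\<lambda>n. \<integral>\<^sup>+t. ennreal (W (\<sigma>n n) t) \<partial>lborel) \<longlonglongrightarrow> 0"
    by simp
  then have "(\<lambda>n. \<integral>\<^sup>+y. ennreal ((cmod (mollify (\<sigma>n n) f y - f y))\<^sup>2) \<partial>lborel) \<longlonglongrightarrow> 0"
    by (rule tendsto_sandwich[OF _ _ tendsto_const, rotated 2])
      (use nn_integral_mollify_diff_le[OF f \<sigma>(1)] in \<open>auto simp: W_def\<close>)
  then have "(\<lambda>n. ennreal ((L2_norm (\<lambda>y. mollify (\<sigma>n n) f y - f y))\<^sup>2)) \<longlonglongrightarrow> ennreal 0"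
    by (simp add: nn_integral_L2[OF D[OF \<sigma>(1)]])
  then have "(\<lambda>n. (L2_norm (\<lambda>y. mollify (\<sigma>n n) f y - f y))\<^sup>2) \<longlonglongrightarrow> 0"
    by (simp only: tendsto_ennreal_iff[OF always_eventually order_refl] zero_le_power2 simp_thms)
  from tendsto_real_sqrt[OF this]
  show "(\<lambda>n. L2_norm (\<lambda>y. mollify (\<sigma>n n) f y - f y)) \<longlonglongrightarrow> 0"
    by simp
qed

section \<open>Plancherel's theorem\<close>

text \<open>Squaring the triangle inequality for \<open>\<bar>f\<bar>\<close> and \<open>\<bar>g\<bar>\<close> leaves the inequality for their product.\<close>

lemma L2_Cauchy_Schwarz:
  assumes "f \<in> L2" "g \<in> L2"
  shows "integrable lborel (\<lambda>x. f x * g x)"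
    and "cmod (LINT x|lborel. f x * g x) \<le> L2_norm f * L2_norm g"
proof -
  note [measurable] = assms[THEN L2_measurable]
  define f' where "f' x = complex_of_real (cmod (f x))" for x
  define g' where "g' x = complex_of_real (cmod (g x))" for x
  have L: "f' \<in> L2" "g' \<in> L2" and N: "L2_norm f' = L2_norm f" "L2_norm g' = L2_norm g"
    using assms by (auto simp: f'_def[abs_def] g'_def[abs_def] L2_def L2_norm_def)
  have I: "integrable lborel (\<lambda>x. cmod (f x) * cmod (g x))"
  proof (rule Bochner_Integration.integrable_bound)
    show "integrable lborel (\<lambda>x. (cmod (f x))\<^sup>2 + (cmod (g x))\<^sup>2)"
      using assms by (intro Bochner_Integration.integrable_add L2_integrable)
    have "u * v \<le> u\<^sup>2 + v\<^sup>2" if "0 \<le> u" "0 \<le> v" for u v :: real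
      using sum_squares_bound[of u v] that by (simp add: power2_eq_square) (use mult_nonneg_nonneg[OF that] in linarith)
    then show "AE x in lborel. norm (cmod (f x) * cmod (g x)) \<le> norm ((cmod (f x))\<^sup>2 + (cmod (g x))\<^sup>2)"
      by (intro AE_I2) (simp add: norm_mult)
  qed measurable
  show "integrable lborel (\<lambda>x. f x * g x)"
    by (rule Bochner_Integration.integrable_bound[OF I]) (auto simp: norm_mult)
  have "(cmod (f' x + g' x))\<^sup>2 = (cmod (f x))\<^sup>2 + 2 * (cmod (f x) * cmod (g x)) + (cmod (g x))\<^sup>2" for x
    unfolding f'_def g'_def of_real_add[symmetric] norm_of_real by (simp add: power2_sum)
  then have "(L2_norm (\<lambda>x. f' x + g' x))\<^sup>2 =
      (LINT x|lborel. (cmod (f x))\<^sup>2 + 2 * (cmod (f x) * cmod (g x)) + (cmod (g x))\<^sup>2)"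
    unfolding L2_norm_squared by simp
  also have "\<dots> = (L2_norm f)\<^sup>2 + 2 * (LINT x|lborel. cmod (f x) * cmod (g x)) + (L2_norm g)\<^sup>2"
    using I assms[THEN L2_integrable] by (simp add: L2_norm_squared)
  finally have "(L2_norm f)\<^sup>2 + 2 * (LINT x|lborel. cmod (f x) * cmod (g x)) + (L2_norm g)\<^sup>2 \<le> (L2_norm f + L2_norm g)\<^sup>2"
    using L2_norm_triangle[OF L] power_mono[OF L2_norm_triangle[OF L], of 2] by (simp add: N)
  then have "(LINT x|lborel. cmod (f x) * cmod (g x)) \<le> L2_norm f * L2_norm g"
    by (simp add: power2_sum)
  then show "cmod (LINT x|lborel. f x * g x) \<le> L2_norm f * L2_norm g"
    using integral_norm_bound[of lborel "\<lambda>x. f x * g x"] by (simp add: norm_mult)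
qed

lemma nn_integral_gauss_damped_tendsto:
  fixes q :: "'a::euclidean_space \<Rightarrow> real"
  assumes [measurable]: "q \<in> borel_measurable borel" and q: "\<And>x. 0 \<le> q x"
  shows "(\<lambda>n. \<integral>\<^sup>+x. ennreal (q x * gauss (inverse (real (Suc n)) *\<^sub>R x) ^ p) \<partial>lborel)
    \<longlonglongrightarrow> (\<integral>\<^sup>+x. ennreal (q x) \<partial>lborel)"
proof (rule nn_integral_LIMSEQ)
  show "incseq (\<lambda>n x. ennreal (q x * gauss (inverse (real (Suc n)) *\<^sub>R x) ^ p))"
  proof (intro incseq_SucI le_funI ennreal_leI mult_left_mono power_mono q)
    fix n and x :: 'a
    have "norm (inverse (real (Suc (Suc n))) *\<^sub>R x) \<le> norm (inverse (real (Suc n)) *\<^sub>R x)"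
      by (auto intro!: mult_right_mono simp: field_simps)
    then show "gauss (inverse (real (Suc n)) *\<^sub>R x) \<le> gauss (inverse (real (Suc (Suc n))) *\<^sub>R x)"
      unfolding gauss_def by (auto intro!: power_mono)
  qed simp
  fix x :: 'a
  have "(\<lambda>n. q x * gauss (inverse (real (Suc n)) *\<^sub>R x) ^ p) \<longlonglongrightarrow> q x * (exp (- (norm (0 *\<^sub>R x))\<^sup>2 / 2)) ^ p"
    unfolding gauss_def by (intro tendsto_intros LIMSEQ_inverse_real_of_nat) auto
  then show "(\<lambda>n. ennreal (q x * gauss (inverse (real (Suc n)) *\<^sub>R x) ^ p)) \<longlonglongrightarrow> ennreal (q x)"
    by (intro tendsto_ennrealI) simp
qed measurable

lemma borel_measurable_cnj [measurable (raw)]: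
  "f \<in> borel_measurable M \<Longrightarrow> (\<lambda>x. cnj (f x)) \<in> borel_measurable M"
  by (rule measurable_compose[where g = cnj, OF _ borel_measurable_continuous_onI]) (auto intro: continuous_intros)

text \<open>The factor \<open>1 / (2 * pi) ^ DIM('a)\<close> of the inverse transform is omitted; it reappears in
  Plancherel's theorem.\<close>

definition inv_fourier :: "('a::euclidean_space \<Rightarrow> complex) \<Rightarrow> 'a \<Rightarrow> complex" where
  "inv_fourier F y = (LINT \<omega>|lborel. F \<omega> * exp (\<i> * of_real (y \<bullet> \<omega>)))"

lemma borel_measurable_inv_fourier [measurable]:
  assumes [measurable]: "F \<in> borel_measurable borel"
  shows "inv_fourier F \<in> borel_measurable borel"
  unfolding inv_fourier_def by measurable

lemma cmod_inv_fourier_le: "cmod (inv_fourier F y) \<le> (LINT \<omega>|lborel. cmod (F \<omega>))"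
  unfolding inv_fourier_def
  using integral_norm_bound[of lborel "\<lambda>\<omega>. F \<omega> * exp (\<i> * of_real (y \<bullet> \<omega>))"] by (simp add: norm_mult)

lemma Fubini_bounded_kernel:
  fixes u :: "'a::euclidean_space \<Rightarrow> complex" and v :: "'b::euclidean_space \<Rightarrow> complex"
  assumes u: "integrable lborel u" and v: "integrable lborel v"
    and K[measurable]: "case_prod K \<in> borel_measurable (borel \<Otimes>\<^sub>M borel)"
    and K1: "\<And>x y. cmod (K x y) \<le> 1"
  shows "(LINT x|lborel. u x * (LINT y|lborel. v y * K x y)) = (LINT y|lborel. v y * (LINT x|lborel. u x * K x y))"
proof -
  have [measurable]: "u \<in> borel_measurable borel" "v \<in> borel_measurable borel"
    using u v by (auto dest: borel_measurable_integrable)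
  have vK: "integrable lborel (\<lambda>y. v y * K x y)" for x
    by (rule Bochner_Integration.integrable_bound[OF v]) (auto simp: norm_mult intro!: mult_left_le K1)
  have "integrable (lborel \<Otimes>\<^sub>M lborel) (case_prod (\<lambda>x y. u x * (v y * K x y)))"
  proof (rule lborel_pair.Fubini_integrable)
    show "integrable lborel (\<lambda>x. LINT y|lborel. norm (case (x, y) of (x, y) \<Rightarrow> u x * (v y * K x y)))"
    proof (rule Bochner_Integration.integrable_bound)
      show "integrable lborel (\<lambda>x. cmod (u x) * (LINT y|lborel. cmod (v y)))"
        using u by simp
      have "(LINT y|lborel. cmod (u x) * cmod (v y * K x y)) \<le> (LINT y|lborel. cmod (u x) * cmod (v y))" for x
        using integrable_norm[OF vK[of x]] v K1
        by (intro integral_mono integrable_mult_right mult_left_mono) (auto simp: norm_mult intro: mult_left_le)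
      then show "AE x in lborel. norm (LINT y|lborel. norm (case (x, y) of (x, y) \<Rightarrow> u x * (v y * K x y)))
          \<le> norm (cmod (u x) * (LINT y|lborel. cmod (v y)))"
        by (intro AE_I2) (simp add: norm_mult)
    qed measurable
    show "AE x in lborel. integrable lborel (\<lambda>y. case (x, y) of (x, y) \<Rightarrow> u x * (v y * K x y))"
      using vK by auto
  qed measurable
  note swap = lborel_pair.Fubini_integral[OF this]
  have comm: "u x * (v y * K x y) = v y * (u x * K x y)" for x y
    by simp
  have "(LINT x|lborel. u x * (LINT y|lborel. v y * K x y)) = (LINT x|lborel. LINT y|lborel. u x * (v y * K x y))"
    by (simp only: integral_mult_right_zero)
  also have "\<dots> = (LINT y|lborel. LINT x|lborel. v y * (u x * K x y))"
    unfolding swap[symmetric] by (simp only: comm)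
  also have "\<dots> = (LINT y|lborel. v y * (LINT x|lborel. u x * K x y))"
    by (simp only: integral_mult_right_zero)
  finally show ?thesis .
qed

text \<open>Damping the squared inverse transform of \<open>F\<close> by a wide Gaussian pairs \<open>F\<close> with its narrow mollification: two
  exchanges of integrals leave the Fourier transform of the Gaussian, which is again a Gaussian.\<close>

lemma integral_inv_fourier_damped:
  fixes F :: "'a::euclidean_space \<Rightarrow> complex"
  assumes F: "integrable lborel F" and F2: "F \<in> L2" and \<sigma>: "0 < \<sigma>"
  shows "(LINT y|lborel. inv_fourier F y * cnj (inv_fourier F y) * of_real (gauss (\<sigma> *\<^sub>R y))) =
    of_real ((2 * pi) ^ DIM('a)) * (LINT \<omega>|lborel. F \<omega> * cnj (mollify \<sigma> F \<omega>))"
proof -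
  let ?m = "gauss_mass TYPE('a)"
  let ?G = "inv_fourier F"
  note [measurable] = L2_measurable[OF F2]
  have \<sigma>0: "\<sigma> \<noteq> 0" using \<sigma> by simp
  define C where "C = (LINT \<omega>|lborel. cmod (F \<omega>))"
  have gC: "integrable lborel (\<lambda>y::'a. C * gauss (\<sigma> *\<^sub>R y))"
    by (intro integrable_mult_right integrable_gauss_scaled \<sigma>0)
  have v: "integrable lborel (\<lambda>y. cnj (?G y) * of_real (gauss (\<sigma> *\<^sub>R y)))"
    by (rule Bochner_Integration.integrable_bound[OF gC])
      (use cmod_inv_fourier_le[of F] in \<open>auto simp: norm_mult C_def intro!: mult_right_mono order_trans[OF _ abs_ge_self]\<close>)
  have inner: "(LINT y|lborel. cnj (?G y) * of_real (gauss (\<sigma> *\<^sub>R y)) * exp (\<i> * of_real (y \<bullet> \<omega>))) =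
      of_real (?m * ?m) * cnj (mollify \<sigma> F \<omega>)" for \<omega> :: 'a
  proof -
    let ?E = "\<lambda>y. of_real (gauss (\<sigma> *\<^sub>R y)) * exp (\<i> * of_real (\<omega> \<bullet> y)) :: complex"
    have E: "integrable lborel ?E"
      by (rule Bochner_Integration.integrable_bound[OF integrable_gauss_scaled[OF \<sigma>0]]) (auto simp: norm_mult)
    have cF: "integrable lborel (\<lambda>x. cnj (F x))"
      using F by simp
    have cG: "cnj (?G y) = (LINT x|lborel. cnj (F x) * exp (- \<i> * of_real (y \<bullet> x)))" for y
      unfolding inv_fourier_def Bochner_Integration.integral_cnj[symmetric] by (simp only: complex_cnj_mult exp_cnj) simp
    have "(LINT y|lborel. cnj (?G y) * of_real (gauss (\<sigma> *\<^sub>R y)) * exp (\<i> * of_real (y \<bullet> \<omega>))) =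
        (LINT y|lborel. ?E y * (LINT x|lborel. cnj (F x) * exp (- \<i> * of_real (y \<bullet> x))))"
      unfolding cG by (intro Bochner_Integration.integral_cong) (simp_all add: inner_commute)
    also have "\<dots> = (LINT x|lborel. cnj (F x) * (LINT y|lborel. ?E y * exp (- \<i> * of_real (y \<bullet> x))))"
      by (rule Fubini_bounded_kernel[OF E cF]) (auto, measurable)
    also have "\<dots> = (LINT x|lborel. of_real (?m / \<sigma> ^ DIM('a)) * (cnj (F x) * of_real (gauss ((\<omega> - x) /\<^sub>R \<sigma>))))"
    proof (intro Bochner_Integration.integral_cong refl)
      fix x :: 'a
      have "?E y * exp (- \<i> * of_real (y \<bullet> x)) = of_real (gauss (\<sigma> *\<^sub>R y)) * exp (\<i> * of_real ((\<omega> - x) \<bullet> y))" for y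
        by (simp add: inner_diff_left inner_commute[of y x] algebra_simps flip: exp_add)
      then show "cnj (F x) * (LINT y|lborel. ?E y * exp (- \<i> * of_real (y \<bullet> x))) =
          of_real (?m / \<sigma> ^ DIM('a)) * (cnj (F x) * of_real (gauss ((\<omega> - x) /\<^sub>R \<sigma>)))"
        by (simp only: integral_gauss_scaled_character[OF \<sigma>]) (simp add: mult_ac)
    qed
    also have "\<dots> = of_real (?m / \<sigma> ^ DIM('a)) * (LINT x|lborel. cnj (F x) * of_real (gauss ((\<omega> - x) /\<^sub>R \<sigma>)))"
      by simp
    also have "(LINT x|lborel. cnj (F x) * of_real (gauss ((\<omega> - x) /\<^sub>R \<sigma>))) =
        (\<bar>\<sigma>\<bar> ^ DIM('a)) *\<^sub>R (LINT t|lborel. cnj (F (\<omega> + \<sigma> *\<^sub>R t)) * of_real (gauss ((\<omega> - (\<omega> + \<sigma> *\<^sub>R t)) /\<^sub>R \<sigma>)))"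
    proof (rule integral_affine[OF \<sigma>0])
      show "integrable lborel (\<lambda>x. cnj (F x) * of_real (gauss ((\<omega> - x) /\<^sub>R \<sigma>)))"
        by (rule Bochner_Integration.integrable_bound[OF cF]) (auto simp: norm_mult intro!: mult_left_le gauss_le_1)
    qed
    also have "(LINT t|lborel. cnj (F (\<omega> + \<sigma> *\<^sub>R t)) * of_real (gauss ((\<omega> - (\<omega> + \<sigma> *\<^sub>R t)) /\<^sub>R \<sigma>))) =
        cnj (LINT t|lborel. of_real (gauss t) * F (\<omega> + \<sigma> *\<^sub>R t))"
      using \<sigma>0 by (subst Bochner_Integration.integral_cnj[symmetric]) (auto intro!: Bochner_Integration.integral_cong simp: gauss_minus mult.commute)
    finally show ?thesis
      using \<sigma> by (simp add: mollify_def scaleR_conv_of_real field_simps)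
  qed
  have "(LINT y|lborel. ?G y * cnj (?G y) * of_real (gauss (\<sigma> *\<^sub>R y))) =
      (LINT y|lborel. (cnj (?G y) * of_real (gauss (\<sigma> *\<^sub>R y))) * (LINT \<omega>|lborel. F \<omega> * exp (\<i> * of_real (y \<bullet> \<omega>))))"
    by (intro Bochner_Integration.integral_cong) (simp_all add: inv_fourier_def mult_ac)
  also have "\<dots> = (LINT \<omega>|lborel. F \<omega> * (LINT y|lborel. (cnj (?G y) * of_real (gauss (\<sigma> *\<^sub>R y))) * exp (\<i> * of_real (y \<bullet> \<omega>))))"
    by (rule Fubini_bounded_kernel[OF v F]) (auto, measurable)
  also have "\<dots> = (LINT \<omega>|lborel. of_real (?m * ?m) * (F \<omega> * cnj (mollify \<sigma> F \<omega>)))"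
    unfolding inner by (simp only: mult.left_commute)
  also have "\<dots> = of_real (?m * ?m) * (LINT \<omega>|lborel. F \<omega> * cnj (mollify \<sigma> F \<omega>))"
    by (rule integral_mult_right_zero)
  also have "?m * ?m = (2 * pi) ^ DIM('a)"
    by (simp only: power_mult_distrib[symmetric]) simp
  finally show ?thesis .
qed

text \<open>In the damped identity the left side increases to the squared norm of the inverse transform
  as the Gaussian widens, while on the right the mollification returns to \<open>F\<close>.\<close>

theorem Plancherel_L1_L2:
  fixes F :: "'a::euclidean_space \<Rightarrow> complex"
  assumes F: "integrable lborel F" and F2: "F \<in> L2"
  shows "inv_fourier F \<in> L2" "(L2_norm (inv_fourier F))\<^sup>2 = (2 * pi) ^ DIM('a) * (L2_norm F)\<^sup>2"
proof -
  let ?G = "inv_fourier F"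
  let ?c = "(2 * pi) ^ DIM('a)"
  note [measurable] = L2_measurable[OF F2]
  define \<sigma> where "\<sigma> n = inverse (real (Suc n))" for n
  have \<sigma>: "0 < \<sigma> n" "\<sigma> n \<noteq> 0" "\<sigma> \<longlonglongrightarrow> 0" for n
    using LIMSEQ_inverse_real_of_nat by (auto simp: \<sigma>_def[abs_def])
  define J where "J n = (LINT y|lborel. (cmod (?G y))\<^sup>2 * gauss (\<sigma> n *\<^sub>R y))" for n
  define C where "C = (LINT \<omega>|lborel. cmod (F \<omega>))"
  have J_int: "integrable lborel (\<lambda>y. (cmod (?G y))\<^sup>2 * gauss (\<sigma> n *\<^sub>R y))" for n
  proof (rule Bochner_Integration.integrable_bound)
    show "integrable lborel (\<lambda>y::'a. C\<^sup>2 * gauss (\<sigma> n *\<^sub>R y))"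
      by (intro integrable_mult_right integrable_gauss_scaled \<sigma>)
    show "AE y in lborel. norm ((cmod (?G y))\<^sup>2 * gauss (\<sigma> n *\<^sub>R y)) \<le> norm (C\<^sup>2 * gauss (\<sigma> n *\<^sub>R y))"
      using cmod_inv_fourier_le[of F] by (auto simp: C_def intro!: AE_I2 mult_right_mono power_mono)
  qed measurable
  have J_eq: "complex_of_real (J n) = of_real ?c * (LINT \<omega>|lborel. F \<omega> * cnj (mollify (\<sigma> n) F \<omega>))" for n
    unfolding J_def integral_inv_fourier_damped[OF F F2 \<sigma>(1), symmetric] integral_complex_of_real[symmetric]
    by (simp only: of_real_mult complex_norm_square)
  have cnj_L2: "(\<lambda>x. cnj (h x)) \<in> L2" "L2_norm (\<lambda>x. cnj (h x)) = L2_norm h" if "h \<in> L2" for h :: "'a \<Rightarrow> complex"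
    using that by (auto simp: L2_def L2_norm_def)
  have "(\<lambda>n. of_real ?c * (LINT \<omega>|lborel. F \<omega> * cnj (mollify (\<sigma> n) F \<omega>)) - of_real (?c * (L2_norm F)\<^sup>2)) \<longlonglongrightarrow> (0::complex)"
  proof (rule Lim_null_comparison)
    show "(\<lambda>n. ?c * (L2_norm F * L2_norm (\<lambda>x. mollify (\<sigma> n) F x - F x))) \<longlonglongrightarrow> 0"
      by (intro tendsto_mult_right_zero mollify_tendsto_L2 F2 \<sigma>)
    show "\<forall>\<^sub>F n in sequentially. norm (of_real ?c * (LINT \<omega>|lborel. F \<omega> * cnj (mollify (\<sigma> n) F \<omega>)) - of_real (?c * (L2_norm F)\<^sup>2))
        \<le> ?c * (L2_norm F * L2_norm (\<lambda>x. mollify (\<sigma> n) F x - F x))"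
    proof (intro always_eventually allI)
      fix n
      note M = L2_mollify[OF F2 \<sigma>(2)[of n]]
      have "complex_of_real ((L2_norm F)\<^sup>2) = (LINT \<omega>|lborel. F \<omega> * cnj (F \<omega>))"
        unfolding L2_norm_squared integral_complex_of_real[symmetric] complex_norm_square ..
      then have "(LINT \<omega>|lborel. F \<omega> * cnj (mollify (\<sigma> n) F \<omega>)) - of_real ((L2_norm F)\<^sup>2) =
          (LINT \<omega>|lborel. F \<omega> * cnj (mollify (\<sigma> n) F \<omega>) - F \<omega> * cnj (F \<omega>))"
        using L2_Cauchy_Schwarz(1)[OF F2 cnj_L2(1)[OF M]] L2_Cauchy_Schwarz(1)[OF F2 cnj_L2(1)[OF F2]]
        by (simp only: Bochner_Integration.integral_diff)
      also have "\<dots> = (LINT \<omega>|lborel. F \<omega> * cnj (mollify (\<sigma> n) F \<omega> - F \<omega>))"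
        by (simp add: right_diff_distrib)
      finally have "cmod ((LINT \<omega>|lborel. F \<omega> * cnj (mollify (\<sigma> n) F \<omega>)) - of_real ((L2_norm F)\<^sup>2))
          \<le> L2_norm F * L2_norm (\<lambda>x. mollify (\<sigma> n) F x - F x)"
        using L2_Cauchy_Schwarz(2)[OF F2 cnj_L2(1)[OF L2_diff[OF M F2]]] cnj_L2(2)[OF L2_diff[OF M F2]]
        by (simp only:)
      then have "?c * cmod ((LINT \<omega>|lborel. F \<omega> * cnj (mollify (\<sigma> n) F \<omega>)) - of_real ((L2_norm F)\<^sup>2))
          \<le> ?c * (L2_norm F * L2_norm (\<lambda>x. mollify (\<sigma> n) F x - F x))"
        by (rule mult_left_mono) simp
      also have "?c * cmod ((LINT \<omega>|lborel. F \<omega> * cnj (mollify (\<sigma> n) F \<omega>)) - of_real ((L2_norm F)\<^sup>2)) =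
          cmod (of_real ?c * ((LINT \<omega>|lborel. F \<omega> * cnj (mollify (\<sigma> n) F \<omega>)) - of_real ((L2_norm F)\<^sup>2)))"
        by (simp only: norm_mult norm_of_real) simp
      finally show "norm (of_real ?c * (LINT \<omega>|lborel. F \<omega> * cnj (mollify (\<sigma> n) F \<omega>)) - of_real (?c * (L2_norm F)\<^sup>2))
        \<le> ?c * (L2_norm F * L2_norm (\<lambda>x. mollify (\<sigma> n) F x - F x))"
        by (simp only: right_diff_distrib of_real_mult)
    qed
  qed
  then have "(\<lambda>n. complex_of_real (J n)) \<longlonglongrightarrow> of_real (?c * (L2_norm F)\<^sup>2)"
    unfolding J_eq by (rule LIM_zero_cancel)
  then have J_lim: "J \<longlonglongrightarrow> ?c * (L2_norm F)\<^sup>2"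
    by (simp only: tendsto_of_real_iff)
  have "(\<lambda>n. ennreal (J n)) \<longlonglongrightarrow> (\<integral>\<^sup>+y. ennreal ((cmod (?G y))\<^sup>2) \<partial>lborel)"
    using nn_integral_gauss_damped_tendsto[of "\<lambda>y. (cmod (?G y))\<^sup>2" 1] J_int
    by (simp add: J_def nn_integral_eq_integral \<sigma>_def)
  then have eq: "(\<integral>\<^sup>+y. ennreal ((cmod (?G y))\<^sup>2) \<partial>lborel) = ennreal (?c * (L2_norm F)\<^sup>2)"
    using tendsto_ennrealI[OF J_lim] LIMSEQ_unique by blast
  then show "?G \<in> L2"
    by (simp add: L2_iff_nn_integral)
  from nn_integral_L2[OF this] show "(L2_norm ?G)\<^sup>2 = ?c * (L2_norm F)\<^sup>2"
    unfolding eq by (subst (asm) ennreal_inj) auto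
qed

text \<open>The mollifications of \<open>f\<close> are the inverse transforms of the damped symbols \<open>H\<close>, to which
  the previous theorem applies. Both sides converge when the Gaussian is widened.\<close>

theorem Plancherel_if_mollify_eq:
  fixes f H :: "'a::euclidean_space \<Rightarrow> complex"
  assumes f: "f \<in> L2" and H[measurable]: "H \<in> borel_measurable borel" and M: "\<And>\<omega>. cmod (H \<omega>) \<le> M"
    and eq: "\<And>\<sigma> y. 0 < \<sigma> \<Longrightarrow> of_real ((2 * pi) ^ DIM('a)) * mollify \<sigma> f y =
       inv_fourier (\<lambda>\<omega>. H \<omega> * of_real (gauss (\<sigma> *\<^sub>R \<omega>))) y"
  shows "H \<in> L2" "(L2_norm H)\<^sup>2 = (2 * pi) ^ DIM('a) * (L2_norm f)\<^sup>2"
proof -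
  let ?c = "(2 * pi) ^ DIM('a)"
  define \<sigma> where "\<sigma> n = inverse (real (Suc n))" for n
  have \<sigma>: "0 < \<sigma> n" "\<sigma> n \<noteq> 0" "\<sigma> \<longlonglongrightarrow> 0" for n
    using LIMSEQ_inverse_real_of_nat by (auto simp: \<sigma>_def[abs_def])
  define Hn where "Hn n \<omega> = H \<omega> * of_real (gauss (\<sigma> n *\<^sub>R \<omega>))" for n \<omega>
  have [measurable]: "Hn n \<in> borel_measurable borel" for n
    unfolding Hn_def by measurable
  have M0: "0 \<le> M" using M[of 0] by (meson norm_ge_zero order_trans)
  have Hn_le: "cmod (Hn n \<omega>) \<le> M * gauss (\<sigma> n *\<^sub>R \<omega>)" for n \<omega>
    using M by (simp add: Hn_def norm_mult mult_right_mono)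
  have g: "integrable lborel (\<lambda>\<omega>::'a. M * gauss (\<sigma> n *\<^sub>R \<omega>))" for n
    by (intro integrable_mult_right integrable_gauss_scaled \<sigma>)
  have Hn1: "integrable lborel (Hn n)" for n
    by (rule Bochner_Integration.integrable_bound[OF g[of n]])
      (use Hn_le M0 in \<open>auto intro!: order_trans[OF _ abs_ge_self]\<close>)
  have Hn2: "Hn n \<in> L2" for n
  proof -
    have "integrable lborel (\<lambda>\<omega>. (cmod (Hn n \<omega>))\<^sup>2)"
    proof (rule Bochner_Integration.integrable_bound)
      show "integrable lborel (\<lambda>\<omega>. M * (M * gauss (\<sigma> n *\<^sub>R \<omega>)))"
        by (intro integrable_mult_right integrable_gauss_scaled \<sigma>)
      have "(cmod (Hn n \<omega>))\<^sup>2 \<le> M * (M * gauss (\<sigma> n *\<^sub>R \<omega>))" for \<omega>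
      proof -
        have "cmod (Hn n \<omega>) \<le> M"
          using Hn_le[of n \<omega>] mult_left_mono[OF gauss_le_1 M0, of "\<sigma> n *\<^sub>R \<omega>"] by simp
        then show ?thesis
          unfolding power2_eq_square by (intro mult_mono Hn_le M0) auto
      qed
      then show "AE \<omega> in lborel. norm ((cmod (Hn n \<omega>))\<^sup>2) \<le> norm (M * (M * gauss (\<sigma> n *\<^sub>R \<omega>)))"
        by (intro AE_I2) (auto intro: order_trans[OF _ abs_ge_self])
    qed measurable
    then show ?thesis by (simp add: L2_def)
  qed
  have inv: "inv_fourier (Hn n) = (\<lambda>y. of_real ?c * mollify (\<sigma> n) f y)" for n
    using eq[OF \<sigma>(1)[of n]] by (auto simp: Hn_def[abs_def])
  have norms: "(L2_norm (Hn n))\<^sup>2 = ?c * (L2_norm (mollify (\<sigma> n) f))\<^sup>2" for n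
  proof -
    have "?c * (L2_norm (Hn n))\<^sup>2 = (?c * L2_norm (mollify (\<sigma> n) f))\<^sup>2"
      using Plancherel_L1_L2(2)[OF Hn1 Hn2, of n] unfolding inv L2_norm_scale norm_of_real by simp
    also have "\<dots> = ?c * (?c * (L2_norm (mollify (\<sigma> n) f))\<^sup>2)"
      by (simp add: power2_eq_square)
    finally show ?thesis by simp
  qed
  have "(\<lambda>n. L2_norm (mollify (\<sigma> n) f)) \<longlonglongrightarrow> L2_norm f"
    using mollify_tendsto_L2[OF f \<sigma>(2,3)]
    by (intro L2_norm_tendsto L2_mollify f \<sigma>) (simp add: L2_norm_minus_commute[of f])
  then have "(\<lambda>n. ennreal ((L2_norm (Hn n))\<^sup>2)) \<longlonglongrightarrow> ennreal (?c * (L2_norm f)\<^sup>2)"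
    unfolding norms by (intro tendsto_intros tendsto_ennrealI)
  moreover have "(\<lambda>n. ennreal ((L2_norm (Hn n))\<^sup>2)) \<longlonglongrightarrow> (\<integral>\<^sup>+\<omega>. ennreal ((cmod (H \<omega>))\<^sup>2) \<partial>lborel)"
    using nn_integral_gauss_damped_tendsto[of "\<lambda>\<omega>. (cmod (H \<omega>))\<^sup>2" 2]
    by (simp add: nn_integral_L2[OF Hn2, symmetric] Hn_def norm_mult power_mult_distrib \<sigma>_def)
  ultimately have eq: "(\<integral>\<^sup>+\<omega>. ennreal ((cmod (H \<omega>))\<^sup>2) \<partial>lborel) = ennreal (?c * (L2_norm f)\<^sup>2)"
    using LIMSEQ_unique by blast
  then show "H \<in> L2"
    by (simp add: L2_iff_nn_integral)
  from nn_integral_L2[OF this] show "(L2_norm H)\<^sup>2 = ?c * (L2_norm f)\<^sup>2"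
    unfolding eq by (subst (asm) ennreal_inj) auto
qed

section \<open>Modulated Gaussians as test functions\<close>

text \<open>Polynomial functions on a Euclidean space, generated so that closure under directional
  derivatives and polynomial growth follow by induction: these are the factors that the iterated
  derivatives of a modulated Gaussian acquire.\<close>

inductive poly_fun :: "('a::euclidean_space \<Rightarrow> complex) \<Rightarrow> bool" where
  const: "poly_fun (\<lambda>_. c)"
| inner: "poly_fun (\<lambda>x. of_real (x \<bullet> v))"
| add: "poly_fun p \<Longrightarrow> poly_fun q \<Longrightarrow> poly_fun (\<lambda>x. p x + q x)"
| mult: "poly_fun p \<Longrightarrow> poly_fun q \<Longrightarrow> poly_fun (\<lambda>x. p x * q x)"

lemma poly_fun_has_derivative:
  "poly_fun p \<Longrightarrow> \<exists>p'. (\<forall>x. (p has_derivative p' x) (at x)) \<and> (\<forall>v. poly_fun (\<lambda>x. p' x v))"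
proof (induction rule: poly_fun.induct)
  case (const c)
  show ?case
    by (intro exI[of _ "\<lambda>_ _. 0"]) (auto intro: poly_fun.const)
next
  case (inner w)
  show ?case
    by (intro exI[of _ "\<lambda>_ v. of_real (v \<bullet> w)"])
      (auto intro!: poly_fun.const derivative_eq_intros)
next
  case (add p q)
  then obtain p' q' where
    "\<And>x. (p has_derivative p' x) (at x)" "\<And>v. poly_fun (\<lambda>x. p' x v)"
    "\<And>x. (q has_derivative q' x) (at x)" "\<And>v. poly_fun (\<lambda>x. q' x v)" by blast
  then show ?case
    by (intro exI[of _ "\<lambda>x v. p' x v + q' x v"]) (auto intro!: poly_fun.add derivative_eq_intros)
next
  case (mult p q)
  then obtain p' q' where
    "\<And>x. (p has_derivative p' x) (at x)" "\<And>v. poly_fun (\<lambda>x. p' x v)"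
    "\<And>x. (q has_derivative q' x) (at x)" "\<And>v. poly_fun (\<lambda>x. q' x v)" by blast
  then show ?case
    using mult.hyps
    by (intro exI[of _ "\<lambda>x v. p x * q' x v + p' x v * q x"])
      (auto intro!: poly_fun.add poly_fun.mult has_derivative_mult)
qed

lemma poly_fun_growth:
  "poly_fun p \<Longrightarrow> \<exists>C n. 0 \<le> C \<and> (\<forall>x. cmod (p x) \<le> C * (1 + norm x) ^ n)"
proof (induction rule: poly_fun.induct)
  case (const c)
  show ?case
    by (intro exI[of _ "cmod c"] exI[of _ 0]) auto
next
  case (inner v)
  have "\<bar>x \<bullet> v\<bar> \<le> norm v * (1 + norm x) ^ 1" for x :: 'a
    using Cauchy_Schwarz_ineq2[of x v] norm_ge_zero[of v]
    by (simp add: distrib_left mult.commute[of "norm x"] add_increasing)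
  then show ?case
    by (intro exI[of _ "norm v"] exI[of _ 1]) auto
next
  case (add p q)
  then obtain C n D m where *: "0 \<le> C" "\<And>x. cmod (p x) \<le> C * (1 + norm x) ^ n"
    "0 \<le> D" "\<And>x. cmod (q x) \<le> D * (1 + norm x) ^ m" by blast
  have "cmod (p x + q x) \<le> (C + D) * (1 + norm x) ^ (n + m)" for x
  proof -
    have "cmod (p x + q x) \<le> C * (1 + norm x) ^ n + D * (1 + norm x) ^ m"
      using norm_triangle_ineq[of "p x" "q x"] *(2)[of x] *(4)[of x] by linarith
    also have "\<dots> \<le> C * (1 + norm x) ^ (n + m) + D * (1 + norm x) ^ (n + m)"
      using *(1,3) by (intro add_mono mult_left_mono power_increasing) auto
    finally show ?thesis by (simp add: distrib_right)
  qed
  then show ?case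
    using *(1,3) by (intro exI[of _ "C + D"] exI[of _ "n + m"]) auto
next
  case (mult p q)
  then obtain C n D m where *: "0 \<le> C" "\<And>x. cmod (p x) \<le> C * (1 + norm x) ^ n"
    "0 \<le> D" "\<And>x. cmod (q x) \<le> D * (1 + norm x) ^ m" by blast
  have "cmod (p x * q x) \<le> (C * D) * (1 + norm x) ^ (n + m)" for x
    using mult_mono[OF *(2) *(4), of x x] *(1) by (simp add: norm_mult power_add mult_ac)
  then show ?case
    using *(1,3) by (intro exI[of _ "C * D"] exI[of _ "n + m"]) auto
qed

lemma power_gauss_bounded:
  assumes "0 < \<sigma>"
  shows "\<exists>K. \<forall>x::'a::euclidean_space. (1 + norm x) ^ n * gauss (\<sigma> *\<^sub>R x) \<le> K"
proof -
  define k where "k = real (Suc n)"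
  have k: "0 < k" by (simp add: k_def)
  have self_le_exp: "u \<le> exp u" for u :: real
    using exp_ge_add_one_self[of u] by linarith
  have "(1 + norm x) ^ n * gauss (\<sigma> *\<^sub>R x) \<le> k ^ Suc n * exp (1 + 1 / (2 * \<sigma>\<^sup>2))" for x :: 'a
  proof -
    let ?r = "norm x"
    have "(1 + ?r) ^ n \<le> (1 + ?r) ^ Suc n"
      by (intro power_increasing) auto
    also have "\<dots> = k ^ Suc n * ((1 + ?r) / k) ^ Suc n"
      using k by (simp only: power_mult_distrib[symmetric]) simp
    \<comment> \<open>The power is traded for a single exponential, which the Gaussian absorbs.\<close>
    also have "\<dots> \<le> k ^ Suc n * exp ((1 + ?r) / k) ^ Suc n"
      using k by (intro mult_left_mono power_mono self_le_exp divide_nonneg_pos) auto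
    also have "exp ((1 + ?r) / k) ^ Suc n = exp (1 + ?r)"
      using k unfolding exp_of_nat_mult[symmetric] k_def[symmetric] by simp
    finally have "(1 + ?r) ^ n * gauss (\<sigma> *\<^sub>R x) \<le> k ^ Suc n * exp (1 + ?r) * gauss (\<sigma> *\<^sub>R x)"
      by (intro mult_right_mono) auto
    also have "\<dots> = k ^ Suc n * exp (1 + ?r - (\<sigma> * ?r)\<^sup>2 / 2)"
      by (simp add: gauss_def mult.assoc power_mult_distrib flip: exp_add)
    also have "\<dots> \<le> k ^ Suc n * exp (1 + 1 / (2 * \<sigma>\<^sup>2))"
    proof -
      have "1 + ?r - (\<sigma> * ?r)\<^sup>2 / 2 = 1 + 1 / (2 * \<sigma>\<^sup>2) - (\<sigma> * ?r - 1 / \<sigma>)\<^sup>2 / 2"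
        using assms by (simp add: power2_eq_square field_simps)
      also have "\<dots> \<le> 1 + 1 / (2 * \<sigma>\<^sup>2)" by simp
      finally show ?thesis
        using k by (intro mult_left_mono) auto
    qed
    finally show ?thesis .
  qed
  then show ?thesis by blast
qed

definition modulated_gauss :: "real \<Rightarrow> 'a::euclidean_space \<Rightarrow> 'a \<Rightarrow> complex" where
  "modulated_gauss \<sigma> y \<omega> = of_real (gauss (\<sigma> *\<^sub>R \<omega>)) * exp (\<i> * of_real (y \<bullet> \<omega>))"

lemma modulated_gauss_has_derivative:
  fixes x y :: "'a::euclidean_space"
  shows "(modulated_gauss \<sigma> y has_derivative
     (\<lambda>v. (of_real (- \<sigma>\<^sup>2) * of_real (x \<bullet> v) + \<i> * of_real (y \<bullet> v)) * modulated_gauss \<sigma> y x)) (at x)"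
proof -
  define E where "E \<omega> = of_real (- \<sigma>\<^sup>2 / 2) * of_real (\<omega> \<bullet> \<omega>) + \<i> * complex_of_real (y \<bullet> \<omega>)" for \<omega>
  have eq: "modulated_gauss \<sigma> y = (\<lambda>\<omega>. exp (E \<omega>))"
  proof
    fix \<omega> :: 'a
    have "- (norm (\<sigma> *\<^sub>R \<omega>))\<^sup>2 / 2 = - \<sigma>\<^sup>2 / 2 * (\<omega> \<bullet> \<omega>)"
      by (simp add: power_mult_distrib power2_norm_eq_inner)
    then show "modulated_gauss \<sigma> y \<omega> = exp (E \<omega>)"
      by (simp only: modulated_gauss_def gauss_def E_def exp_add of_real_mult exp_of_real[symmetric])
  qed
  have "(E has_derivative (\<lambda>v. of_real (- \<sigma>\<^sup>2) * of_real (x \<bullet> v) + \<i> * of_real (y \<bullet> v))) (at x)"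
    unfolding E_def by (auto intro!: derivative_eq_intros simp: inner_commute)
  from has_derivative_compose[OF this, of exp "(*) (exp (E x))"]
  show ?thesis
    unfolding eq using DERIV_exp[of "E x"] by (simp add: has_field_derivative_def mult.commute)
qed

lemma iterated_deriv_modulated_gauss:
  "\<exists>p. poly_fun p \<and> iterated_deriv vs (modulated_gauss \<sigma> y) = (\<lambda>x. p x * modulated_gauss \<sigma> y x)"
proof (induction vs)
  case Nil
  show ?case
    by (rule exI[of _ "\<lambda>_. 1"]) (auto intro: poly_fun.const)
next
  case (Cons v vs)
  let ?g = "modulated_gauss \<sigma> y"
  obtain p where p: "poly_fun p" "iterated_deriv vs ?g = (\<lambda>x. p x * ?g x)"
    using Cons.IH by blast
  obtain p' where p': "\<And>x. (p has_derivative p' x) (at x)" "\<And>v. poly_fun (\<lambda>x. p' x v)"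
    using poly_fun_has_derivative[OF p(1)] by blast
  define l where "l v x = of_real (- \<sigma>\<^sup>2) * of_real (x \<bullet> v) + \<i> * complex_of_real (y \<bullet> v)" for v x
  have g': "(?g has_derivative (\<lambda>v. l v x * ?g x)) (at x)" for x
    unfolding l_def by (rule modulated_gauss_has_derivative)
  have D: "((\<lambda>x. p x * ?g x) has_derivative (\<lambda>v. p x * (l v x * ?g x) + p' x v * ?g x)) (at x)" for x
    by (rule has_derivative_mult[OF p'(1) g'])
  then have "iterated_deriv (v # vs) ?g = (\<lambda>x. p x * (l v x * ?g x) + p' x v * ?g x)"
    by (simp add: p(2) frechet_derivative_at[OF D, symmetric])
  also have "\<dots> = (\<lambda>x. (p x * l v x + p' x v) * ?g x)"
    by (simp add: algebra_simps)
  finally have "iterated_deriv (v # vs) ?g = (\<lambda>x. (p x * l v x + p' x v) * ?g x)" .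
  moreover have "poly_fun (\<lambda>x. p x * l v x + p' x v)"
    unfolding l_def by (intro poly_fun.intros p p')
  ultimately show ?case by (intro exI[of _ "\<lambda>x. p x * l v x + p' x v"]) simp
qed

lemma schwartz_modulated_gauss:
  fixes y :: "'a::euclidean_space"
  assumes "0 < \<sigma>"
  shows "schwartz (modulated_gauss \<sigma> y)"
  unfolding schwartz_def
proof (intro allI impI conjI)
  fix vs :: "'a list"
  let ?g = "modulated_gauss \<sigma> y"
  obtain p where p: "poly_fun p" "iterated_deriv vs ?g = (\<lambda>x. p x * ?g x)"
    using iterated_deriv_modulated_gauss by blast
  obtain p' where p': "\<And>x. (p has_derivative p' x) (at x)"
    using poly_fun_has_derivative[OF p(1)] by blast
  show "iterated_deriv vs ?g differentiable_on UNIV"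
    unfolding p(2) differentiable_on_def
    using has_derivative_mult[OF p' modulated_gauss_has_derivative]
    by (auto simp: differentiable_def)
  fix m :: nat
  obtain C n where C: "0 \<le> C" "\<And>x. cmod (p x) \<le> C * (1 + norm x) ^ n"
    using poly_fun_growth[OF p(1)] by blast
  obtain K where K: "\<And>x::'a. (1 + norm x) ^ (m + n) * gauss (\<sigma> *\<^sub>R x) \<le> K"
    using power_gauss_bounded[OF assms] by blast
  have "norm (norm x ^ m *\<^sub>R iterated_deriv vs ?g x) \<le> C * K" for x
  proof -
    have "norm (norm x ^ m *\<^sub>R iterated_deriv vs ?g x) = norm x ^ m * cmod (p x) * gauss (\<sigma> *\<^sub>R x)"
      by (simp add: p(2) modulated_gauss_def norm_mult)
    also have "\<dots> \<le> (1 + norm x) ^ m * (C * (1 + norm x) ^ n) * gauss (\<sigma> *\<^sub>R x)"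
      by (intro mult_right_mono mult_mono C(2) power_mono) auto
    also have "\<dots> = C * ((1 + norm x) ^ (m + n) * gauss (\<sigma> *\<^sub>R x))"
      by (simp add: power_add mult_ac)
    also have "\<dots> \<le> C * K"
      by (intro mult_left_mono K C(1))
    finally show ?thesis .
  qed
  then show "bounded (range (\<lambda>x. norm x ^ m *\<^sub>R iterated_deriv vs ?g x))"
    by (auto simp: bounded_iff)
qed

lemma fourier_modulated_gauss:
  fixes y :: "'a::euclidean_space"
  assumes "0 < \<sigma>"
  shows "fourier (modulated_gauss \<sigma> y) x = of_real (gauss_mass TYPE('a) / \<sigma> ^ DIM('a) * gauss ((y - x) /\<^sub>R \<sigma>))"
proof -
  have "modulated_gauss \<sigma> y t * exp (- (\<i> * of_real (x \<bullet> t))) = of_real (gauss (\<sigma> *\<^sub>R t)) * exp (\<i> * of_real ((y - x) \<bullet> t))" for t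
    by (simp add: modulated_gauss_def inner_diff_left algebra_simps flip: exp_add)
  then show ?thesis
    unfolding fourier_def by (simp only: integral_gauss_scaled_character[OF assms])
qed

text \<open>Tested against a modulated Gaussian, the distributional definition of the Fourier transform
  becomes a pointwise statement about mollifications.\<close>

lemma mollify_eq_inv_fourier:
  fixes f :: "'a::euclidean_space \<Rightarrow> complex"
  assumes fh: "has_fourier_transform f h" and f: "f \<in> L2" and \<sigma>: "0 < \<sigma>"
  shows "of_real ((2 * pi) ^ DIM('a)) * mollify \<sigma> f y = inv_fourier (\<lambda>\<omega>. h \<omega> * of_real (gauss (\<sigma> *\<^sub>R \<omega>))) y"
proof -
  let ?m = "gauss_mass TYPE('a)"
  let ?\<phi> = "modulated_gauss \<sigma> y"
  have I: "integrable lborel (\<lambda>x. f x * fourier ?\<phi> x)"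
    and eq: "(LINT x|lborel. f x * fourier ?\<phi> x) = (LINT \<omega>|lborel. h \<omega> * ?\<phi> \<omega>)"
    using fh schwartz_modulated_gauss[OF \<sigma>, of y] unfolding has_fourier_transform_def by blast+
  have \<sigma>0: "\<sigma> \<noteq> 0" using \<sigma> by simp
  have "(LINT x|lborel. f x * fourier ?\<phi> x) =
      (\<bar>\<sigma>\<bar> ^ DIM('a)) *\<^sub>R (LINT t|lborel. f (y + \<sigma> *\<^sub>R t) * fourier ?\<phi> (y + \<sigma> *\<^sub>R t))"
    by (rule integral_affine[OF \<sigma>0 I])
  also have "(LINT t|lborel. f (y + \<sigma> *\<^sub>R t) * fourier ?\<phi> (y + \<sigma> *\<^sub>R t)) =
      (LINT t|lborel. of_real (?m / \<sigma> ^ DIM('a)) * (of_real (gauss t) * f (y + \<sigma> *\<^sub>R t)))"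
    using \<sigma>0 by (intro Bochner_Integration.integral_cong) (simp_all add: fourier_modulated_gauss[OF \<sigma>] gauss_minus)
  also have "\<dots> = of_real (?m / \<sigma> ^ DIM('a)) * (LINT t|lborel. of_real (gauss t) * f (y + \<sigma> *\<^sub>R t))"
    by (rule integral_mult_right_zero)
  also have "(LINT t|lborel. of_real (gauss t) * f (y + \<sigma> *\<^sub>R t)) = of_real ?m * mollify \<sigma> f y"
    by (simp add: mollify_def)
  also have "(\<bar>\<sigma>\<bar> ^ DIM('a)) *\<^sub>R (of_real (?m / \<sigma> ^ DIM('a)) * (of_real ?m * mollify \<sigma> f y)) =
      of_real (?m * ?m) * mollify \<sigma> f y"
    using \<sigma> by (simp add: scaleR_conv_of_real)
  also have "?m * ?m = (2 * pi) ^ DIM('a)"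
    by (simp only: power_mult_distrib[symmetric]) simp
  finally have "of_real ((2 * pi) ^ DIM('a)) * mollify \<sigma> f y = (LINT \<omega>|lborel. h \<omega> * ?\<phi> \<omega>)"
    using eq by simp
  then show ?thesis
    by (simp add: inv_fourier_def modulated_gauss_def mult.assoc)
qed

text \<open>Plancherel's theorem for a finite combination of translates: translation by \<open>z k\<close>
  multiplies the symbol by the character \<open>\<omega> \<mapsto> exp (- \<i> \<omega> \<bullet> z k)\<close>.\<close>

lemma Plancherel_translates:
  fixes f h :: "'a::euclidean_space \<Rightarrow> complex" and c :: "'k \<Rightarrow> complex" and z :: "'k \<Rightarrow> 'a"
  assumes fh: "has_fourier_transform f h" and f: "f \<in> L2" and M: "\<And>\<omega>. cmod (h \<omega>) \<le> M"
    and F: "finite F"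
  defines "P \<equiv> \<lambda>\<omega>. \<Sum>k\<in>F. c k * exp (- (\<i> * of_real (\<omega> \<bullet> z k)))"
  shows "(\<lambda>\<omega>. P \<omega> * h \<omega>) \<in> L2"
    and "(L2_norm (\<lambda>\<omega>. P \<omega> * h \<omega>))\<^sup>2 = (2 * pi) ^ DIM('a) * (L2_norm (\<lambda>x. \<Sum>k\<in>F. c k * f (x - z k)))\<^sup>2"
proof -
  let ?C = "of_real ((2 * pi) ^ DIM('a)) :: complex"
  have [measurable]: "h \<in> borel_measurable borel"
    using fh by (simp add: has_fourier_transform_def)
  have fz: "(\<lambda>x. f (x - z k)) \<in> L2" for k
    using L2_translate[OF f, of "- z k"] by simp
  have S: "(\<lambda>x. \<Sum>k\<in>F. c k * f (x - z k)) \<in> L2"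
    using L2_sum[of F "\<lambda>k x. f (x - z k)" c] fz by simp
  have PM[measurable]: "P \<in> borel_measurable borel"
    unfolding P_def by measurable
  have bound: "cmod (P \<omega> * h \<omega>) \<le> (\<Sum>k\<in>F. cmod (c k)) * M" for \<omega>
  proof -
    have "cmod (P \<omega>) \<le> (\<Sum>k\<in>F. cmod (c k))"
      unfolding P_def by (rule sum_norm_le) (simp add: norm_mult)
    then show ?thesis
      unfolding norm_mult by (intro mult_mono M) (auto intro: sum_nonneg)
  qed
  have M0: "0 \<le> M" using M[of 0] by (meson norm_ge_zero order_trans)
  have eq: "?C * mollify \<sigma> (\<lambda>x. \<Sum>k\<in>F. c k * f (x - z k)) y =
      inv_fourier (\<lambda>\<omega>. P \<omega> * h \<omega> * of_real (gauss (\<sigma> *\<^sub>R \<omega>))) y" if \<sigma>: "0 < \<sigma>" for \<sigma> y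
  proof -
    have \<sigma>0: "\<sigma> \<noteq> 0" using \<sigma> by simp
    have I1: "integrable lborel (\<lambda>t. of_real (gauss t) * f (y + \<sigma> *\<^sub>R t - z k))" for k
      using integrable_gauss_L2[OF f \<sigma>0, of "y - z k"] by (simp add: add_diff_eq diff_add_eq)
    have I2: "integrable lborel (\<lambda>\<omega>. h \<omega> * of_real (gauss (\<sigma> *\<^sub>R \<omega>)) * exp (\<i> * of_real ((y - z k) \<bullet> \<omega>)))" for k
    proof (rule Bochner_Integration.integrable_bound)
      show "integrable lborel (\<lambda>\<omega>::'a. M * gauss (\<sigma> *\<^sub>R \<omega>))"
        by (intro integrable_mult_right integrable_gauss_scaled \<sigma>0)
    qed (use M0 M in \<open>auto simp: norm_mult intro!: mult_right_mono\<close>)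
    have "mollify \<sigma> (\<lambda>x. \<Sum>k\<in>F. c k * f (x - z k)) y = (\<Sum>k\<in>F. c k * mollify \<sigma> f (y - z k))"
    proof -
      have "(LINT t|lborel. of_real (gauss t) * (\<Sum>k\<in>F. c k * f (y + \<sigma> *\<^sub>R t - z k))) =
          (LINT t|lborel. (\<Sum>k\<in>F. c k * (of_real (gauss t) * f (y + \<sigma> *\<^sub>R t - z k))))"
        by (simp add: sum_distrib_left mult.left_commute)
      also have "\<dots> = (\<Sum>k\<in>F. c k * (LINT t|lborel. of_real (gauss t) * f (y + \<sigma> *\<^sub>R t - z k)))"
        using I1 by (subst Bochner_Integration.integral_sum) auto
      finally show ?thesis
        unfolding mollify_def by (simp add: sum_divide_distrib add_diff_eq diff_add_eq)
    qed
    then have "?C * mollify \<sigma> (\<lambda>x. \<Sum>k\<in>F. c k * f (x - z k)) y =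
        (\<Sum>k\<in>F. c k * (?C * mollify \<sigma> f (y - z k)))"
      by (simp add: sum_distrib_left mult.left_commute)
    also have "\<dots> = (\<Sum>k\<in>F. c k * inv_fourier (\<lambda>\<omega>. h \<omega> * of_real (gauss (\<sigma> *\<^sub>R \<omega>))) (y - z k))"
      by (simp only: mollify_eq_inv_fourier[OF fh f \<sigma>])
    also have "\<dots> = (LINT \<omega>|lborel. (\<Sum>k\<in>F. c k * (h \<omega> * of_real (gauss (\<sigma> *\<^sub>R \<omega>)) * exp (\<i> * of_real ((y - z k) \<bullet> \<omega>)))))"
      unfolding inv_fourier_def using I2 by (subst Bochner_Integration.integral_sum) auto
    also have "\<dots> = inv_fourier (\<lambda>\<omega>. P \<omega> * h \<omega> * of_real (gauss (\<sigma> *\<^sub>R \<omega>))) y"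
      unfolding inv_fourier_def
    proof (rule Bochner_Integration.integral_cong[OF refl])
      fix \<omega> :: 'a
      have "exp (\<i> * of_real ((y - z k) \<bullet> \<omega>)) = exp (- (\<i> * of_real (\<omega> \<bullet> z k))) * exp (\<i> * of_real (y \<bullet> \<omega>))" for k
        by (simp add: inner_diff_left inner_commute[of \<omega>] algebra_simps flip: exp_add)
      then show "(\<Sum>k\<in>F. c k * (h \<omega> * of_real (gauss (\<sigma> *\<^sub>R \<omega>)) * exp (\<i> * of_real ((y - z k) \<bullet> \<omega>)))) =
          P \<omega> * h \<omega> * of_real (gauss (\<sigma> *\<^sub>R \<omega>)) * exp (\<i> * of_real (y \<bullet> \<omega>))"
        by (simp add: P_def sum_distrib_left sum_distrib_right mult_ac)
    qed
    finally show ?thesis .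
  qed
  have "(\<lambda>\<omega>. P \<omega> * h \<omega>) \<in> borel_measurable borel"
    by measurable
  note Pl = Plancherel_if_mollify_eq[OF S this bound eq]
  show "(\<lambda>\<omega>. P \<omega> * h \<omega>) \<in> L2"
    by (rule Pl(1))
  show "(L2_norm (\<lambda>\<omega>. P \<omega> * h \<omega>))\<^sup>2 = (2 * pi) ^ DIM('a) * (L2_norm (\<lambda>x. \<Sum>k\<in>F. c k * f (x - z k)))\<^sup>2"
    by (rule Pl(2))
qed

section \<open>Trigonometric polynomials on the period cell\<close>

lemma
  assumes m: "m \<in> \<int>"
  shows integrable_character_interval:
      "integrable lborel (\<lambda>s. indicator {-pi..pi} s *\<^sub>R exp (- (\<i> * of_real (m * s))))"
    and integral_character_interval:
      "(LINT s|lborel. indicator {-pi..pi} s *\<^sub>R exp (- (\<i> * of_real (m * s)))) = (if m = 0 then of_real (2 * pi) else 0)"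
proof -
  let ?f = "\<lambda>s. exp (- (\<i> * complex_of_real (m * s)))"
  have cont: "continuous_on {-pi..pi} ?f"
    by (intro continuous_intros)
  then show "integrable lborel (\<lambda>s. indicator {-pi..pi} s *\<^sub>R ?f s)"
    using borel_integrable_atLeastAtMost'[of "-pi" pi ?f] by (simp add: set_integrable_def)
  show "(LINT s|lborel. indicator {-pi..pi} s *\<^sub>R ?f s) = (if m = 0 then of_real (2 * pi) else 0)"
  proof (cases "m = 0")
    case True
    then show ?thesis by (simp add: scaleR_conv_of_real)
  next
    case False
    define G where "G s = ?f s * (\<i> / of_real m)" for s
    have FTC: "(LINT s|lborel. indicator {-pi..pi} s *\<^sub>R ?f s) = G pi - G (- pi)"
    proof (rule integral_FTC_Icc[OF _ _ cont])
      fix s :: real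
      have "((\<lambda>z. exp (- (\<i> * of_real m * z)) * (\<i> / of_real m)) has_field_derivative ?f s) (at (of_real s))"
        using False by (auto intro!: derivative_eq_intros simp: field_simps)
      from has_vector_derivative_real_field[OF this]
      show "(G has_vector_derivative ?f s) (at s within {-pi..pi})"
        unfolding G_def by (simp add: mult.assoc)
    qed simp
    have "?f pi = ?f (- pi) * exp (- (2 * of_real m * of_real pi * \<i>))"
      by (simp add: algebra_simps flip: exp_add)
    also have "exp (- (2 * of_real m * of_real pi * \<i>)) = (1::complex)"
    proof -
      have "- m \<in> \<int>"
        using m by simp
      from exp_integer_2pi[OF this] show ?thesis by simp
    qed
    finally have "?f pi = ?f (- pi)" by simp
    then have "G pi = G (- pi)" by (simp only: G_def)
    then show ?thesis using FTC False by simp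
  qed
qed

text \<open>The cell is closed, so its translates by periods cover the space but meet along faces; the
  covering yields inequalities between integrals, not equations.\<close>

definition period_cell :: "'a::euclidean_space set" where
  "period_cell = {x. \<forall>b\<in>Basis. \<bar>x \<bullet> b\<bar> \<le> pi}"

lemma period_cell_measurable [measurable]: "(period_cell :: 'a::euclidean_space set) \<in> sets borel"
proof -
  have "period_cell = (\<Inter>b\<in>Basis. {x::'a. \<bar>x \<bullet> b\<bar> \<le> pi})"
    by (auto simp: period_cell_def)
  moreover have "closed (\<Inter>b\<in>Basis. {x::'a. \<bar>x \<bullet> b\<bar> \<le> pi})"
    by (intro closed_INT ballI closed_Collect_le continuous_intros)
  ultimately have "closed (period_cell :: 'a set)"
    by simp
  then show ?thesis by simp
qed

lemma
  fixes n :: "'a::euclidean_space"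
  assumes n: "\<And>b. b \<in> Basis \<Longrightarrow> n \<bullet> b \<in> \<int>"
  shows integrable_character_cell:
      "integrable lborel (\<lambda>\<omega>. indicator period_cell \<omega> *\<^sub>R exp (- (\<i> * of_real (\<omega> \<bullet> n))))"
    and integral_character_cell:
      "(LINT \<omega>|lborel. indicator period_cell \<omega> *\<^sub>R exp (- (\<i> * of_real (\<omega> \<bullet> n)))) =
        (if n = 0 then of_real ((2 * pi) ^ DIM('a)) else 0)"
proof -
  let ?f = "\<lambda>b s. indicator {-pi..pi} s *\<^sub>R exp (- (\<i> * of_real (n \<bullet> b * s))) :: complex"
  have ind: "indicator period_cell \<omega> = (\<Prod>b\<in>Basis. indicator {-pi..pi} (\<omega> \<bullet> b) :: real)" for \<omega> :: 'a
  proof (cases "\<omega> \<in> period_cell")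
    case True
    then have "indicator {-pi..pi} (\<omega> \<bullet> b) = (1 :: real)" if "b \<in> Basis" for b
      using that by (auto simp: period_cell_def indicator_def abs_le_iff minus_le_iff)
    with True show ?thesis by simp
  next
    case False
    then obtain b where "b \<in> Basis" "\<not> \<bar>\<omega> \<bullet> b\<bar> \<le> pi"
      by (auto simp: period_cell_def)
    then have "b \<in> Basis \<and> (indicator {-pi..pi} (\<omega> \<bullet> b) :: real) = 0"
      by (auto simp: indicator_def abs_le_iff)
    then have "(\<Prod>b\<in>Basis. indicator {-pi..pi} (\<omega> \<bullet> b) :: real) = 0"
      by (intro prod_zero) auto
    then show ?thesis using False by simp
  qed
  have eq: "indicator period_cell \<omega> *\<^sub>R exp (- (\<i> * of_real (\<omega> \<bullet> n))) = (\<Prod>b\<in>Basis. ?f b (\<omega> \<bullet> b))" for \<omega> :: 'a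
  proof -
    have "exp (- (\<i> * of_real (\<omega> \<bullet> n))) = (\<Prod>b\<in>Basis. exp (- (\<i> * of_real (n \<bullet> b * (\<omega> \<bullet> b)))) :: complex)"
      by (subst euclidean_inner) (simp add: exp_sum[symmetric] sum_distrib_left sum_negf[symmetric] mult.commute[of "n \<bullet> _"])
    then show ?thesis
      by (simp add: ind scaleR_conv_of_real prod.distrib)
  qed
  show "integrable lborel (\<lambda>\<omega>. indicator period_cell \<omega> *\<^sub>R exp (- (\<i> * of_real (\<omega> \<bullet> n))))"
    unfolding eq by (rule integrable_prod_Basis[of ?f]) (rule integrable_character_interval[OF n])
  have "(LINT \<omega>|lborel. indicator period_cell \<omega> *\<^sub>R exp (- (\<i> * of_real (\<omega> \<bullet> n)))) =
      (\<Prod>b\<in>Basis. LINT s|lborel. ?f b s)"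
    unfolding eq by (rule integral_prod_Basis[of ?f]) (rule integrable_character_interval[OF n])
  also have "\<dots> = (\<Prod>b\<in>(Basis :: 'a set). if n \<bullet> b = 0 then of_real (2 * pi) else 0)"
    by (intro prod.cong refl integral_character_interval n)
  also have "\<dots> = (if n = 0 then of_real ((2 * pi) ^ DIM('a)) else 0)"
    by (auto simp: euclidean_eq_iff[of n 0])
  finally show "(LINT \<omega>|lborel. indicator period_cell \<omega> *\<^sub>R exp (- (\<i> * of_real (\<omega> \<bullet> n)))) =
      (if n = 0 then of_real ((2 * pi) ^ DIM('a)) else 0)" .
qed

text \<open>Parseval's identity for a trigonometric polynomial, from the orthogonality of the characters
  with distinct frequencies.\<close>

lemma nn_integral_trig_poly:
  fixes z :: "'k \<Rightarrow> 'a::euclidean_space" and c :: "'k \<Rightarrow> complex"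
  assumes z: "inj z" "\<And>k b. b \<in> Basis \<Longrightarrow> z k \<bullet> b \<in> \<int>"
  defines "P \<equiv> \<lambda>F \<omega>. \<Sum>k\<in>F. c k * exp (- (\<i> * of_real (\<omega> \<bullet> z k)))"
  assumes F: "finite F"
  shows "(\<integral>\<^sup>+\<omega>. indicator period_cell \<omega> * ennreal ((cmod (P F \<omega>))\<^sup>2) \<partial>lborel) =
     ennreal ((2 * pi) ^ DIM('a) * (\<Sum>k\<in>F. (cmod (c k))\<^sup>2))"
proof -
  let ?e = "\<lambda>k l \<omega>. indicator period_cell \<omega> *\<^sub>R exp (- (\<i> * of_real (\<omega> \<bullet> (z k - z l)))) :: complex"
  have zz: "(z k - z l) \<bullet> b \<in> \<int>" if "b \<in> Basis" for k l b
    using z(2)[OF that] by (simp add: inner_diff_left)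
  have eq: "complex_of_real (indicator period_cell \<omega> * (cmod (P F \<omega>))\<^sup>2) =
      (\<Sum>k\<in>F. \<Sum>l\<in>F. c k * cnj (c l) * ?e k l \<omega>)" for \<omega>
  proof -
    have "complex_of_real ((cmod (P F \<omega>))\<^sup>2) = P F \<omega> * cnj (P F \<omega>)"
      by (rule complex_norm_square)
    also have "\<dots> = (\<Sum>k\<in>F. \<Sum>l\<in>F. c k * exp (- (\<i> * of_real (\<omega> \<bullet> z k))) * (cnj (c l) * exp (\<i> * of_real (\<omega> \<bullet> z l))))"
      by (simp add: P_def cnj_sum sum_product exp_cnj)
    also have "\<dots> = (\<Sum>k\<in>F. \<Sum>l\<in>F. c k * cnj (c l) * exp (- (\<i> * of_real (\<omega> \<bullet> (z k - z l)))))"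
    proof (intro sum.cong refl)
      fix k l
      have "exp (- (\<i> * of_real (\<omega> \<bullet> (z k - z l)))) = exp (- (\<i> * of_real (\<omega> \<bullet> z k))) * (exp (\<i> * of_real (\<omega> \<bullet> z l)) :: complex)"
        by (simp add: inner_diff_right algebra_simps flip: exp_add)
      then show "c k * exp (- (\<i> * of_real (\<omega> \<bullet> z k))) * (cnj (c l) * exp (\<i> * of_real (\<omega> \<bullet> z l))) =
          c k * cnj (c l) * exp (- (\<i> * of_real (\<omega> \<bullet> (z k - z l))))"
        by simp
    qed
    finally show ?thesis
      by (simp add: sum_distrib_left scaleR_conv_of_real mult_ac)
  qed
  have int_e: "integrable lborel (\<lambda>\<omega>. c k * cnj (c l) * ?e k l \<omega>)" for k l
    by (intro integrable_mult_right integrable_character_cell zz)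
  have "integrable lborel (\<lambda>\<omega>. complex_of_real (indicator period_cell \<omega> * (cmod (P F \<omega>))\<^sup>2))"
    unfolding eq by (intro Bochner_Integration.integrable_sum int_e)
  then have int: "integrable lborel (\<lambda>\<omega>. indicator period_cell \<omega> * (cmod (P F \<omega>))\<^sup>2)"
    using complex_of_real_integrable_eq by blast
  have "complex_of_real (LINT \<omega>|lborel. indicator period_cell \<omega> * (cmod (P F \<omega>))\<^sup>2) =
      (LINT \<omega>|lborel. (\<Sum>k\<in>F. \<Sum>l\<in>F. c k * cnj (c l) * ?e k l \<omega>))"
    unfolding integral_complex_of_real[symmetric] eq ..
  also have "\<dots> = (\<Sum>k\<in>F. \<Sum>l\<in>F. c k * cnj (c l) * (LINT \<omega>|lborel. ?e k l \<omega>))"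
    using int_e by (simp only: Bochner_Integration.integral_sum Bochner_Integration.integrable_sum integral_mult_right_zero)
  also have "\<dots> = (\<Sum>k\<in>F. \<Sum>l\<in>F. if k = l then of_real ((2 * pi) ^ DIM('a) * (cmod (c k))\<^sup>2) else 0)"
  proof (intro sum.cong refl)
    fix k l
    have "(z k - z l = 0) = (k = l)"
      using z(1) by (auto dest: injD)
    moreover have "(LINT \<omega>|lborel. ?e k l \<omega>) = (if z k - z l = 0 then of_real ((2 * pi) ^ DIM('a)) else 0)"
      by (rule integral_character_cell[OF zz])
    ultimately show "c k * cnj (c l) * (LINT \<omega>|lborel. ?e k l \<omega>) = (if k = l then of_real ((2 * pi) ^ DIM('a) * (cmod (c k))\<^sup>2) else 0)"
      by (simp only: of_real_mult complex_norm_square) simp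
  qed
  also have "\<dots> = of_real ((2 * pi) ^ DIM('a) * (\<Sum>k\<in>F. (cmod (c k))\<^sup>2))"
    using F by (simp add: sum_distrib_left)
  finally have "(LINT \<omega>|lborel. indicator period_cell \<omega> * (cmod (P F \<omega>))\<^sup>2) = (2 * pi) ^ DIM('a) * (\<Sum>k\<in>F. (cmod (c k))\<^sup>2)"
    using of_real_eq_iff by blast
  then have "(\<integral>\<^sup>+\<omega>. ennreal (indicator period_cell \<omega> * (cmod (P F \<omega>))\<^sup>2) \<partial>lborel) = ennreal ((2 * pi) ^ DIM('a) * (\<Sum>k\<in>F. (cmod (c k))\<^sup>2))"
    using int by (subst nn_integral_eq_integral) auto
  moreover have "ennreal (indicator period_cell \<omega> * (cmod (P F \<omega>))\<^sup>2) = indicator period_cell \<omega> * ennreal ((cmod (P F \<omega>))\<^sup>2)" for \<omega>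
    by (simp add: indicator_def)
  ultimately show ?thesis by simp
qed

section \<open>Periodization\<close>

definition lattice_vec :: "int^2 \<Rightarrow> real^2" where
  "lattice_vec k = (\<chi> i. of_int (k $ i))"

lemma lattice_vec_nth [simp]: "lattice_vec k $ i = of_int (k $ i)"
  by (simp add: lattice_vec_def)

lemma lattice_vec_zero: "lattice_vec 0 = 0" and lattice_vec_diff: "lattice_vec (k - l) = lattice_vec k - lattice_vec l"
  by (simp_all add: vec_eq_iff)

lemma inj_lattice_vec: "inj lattice_vec"
  by (auto simp: inj_def vec_eq_iff)

lemma lattice_vec_Basis: "b \<in> Basis \<Longrightarrow> lattice_vec k \<bullet> b \<in> \<int>"
  by (auto simp: Basis_vec_def inner_axis)

lemma inner_lattice_vec: "lattice_vec k \<bullet> lattice_vec l \<in> \<int>"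
  by (auto simp: inner_vec_def intro!: Ints_sum)

lemma finite_lattice_vec_bounded: "finite {m. norm (lattice_vec m) \<le> R}"
proof (rule finite_subset)
  let ?I = "{- \<lceil>R\<rceil>..\<lceil>R\<rceil>}"
  show "finite ((\<lambda>p. vector [fst p, snd p] :: int^2) ` (?I \<times> ?I))"
    by simp
  show "{m. norm (lattice_vec m) \<le> R} \<subseteq> (\<lambda>p. vector [fst p, snd p] :: int^2) ` (?I \<times> ?I)"
  proof
    fix m assume "m \<in> {m. norm (lattice_vec m) \<le> R}"
    then have "\<bar>of_int (m $ i)\<bar> \<le> R" for i
      using component_le_norm_cart[of "lattice_vec m" i] by simp
    then have "- \<lceil>R\<rceil> \<le> m $ i \<and> m $ i \<le> \<lceil>R\<rceil>" for i
      by (smt (verit) abs_le_iff le_of_int_ceiling of_int_le_iff of_int_minus)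
    then have "m $ i \<in> ?I" for i
      by simp
    moreover have "m = vector [m $ 1, m $ 2]"
      by (simp add: vec_eq_iff forall_2)
    ultimately show "m \<in> (\<lambda>p. vector [fst p, snd p] :: int^2) ` (?I \<times> ?I)"
      by (intro image_eqI[of _ _ "(m $ 1, m $ 2)"]) auto
  qed
qed

lemma period_cell_cover: "\<exists>k. x - (2 * pi) *\<^sub>R lattice_vec k \<in> period_cell"
proof
  let ?k = "\<chi> i. round (x $ i / (2 * pi)) :: int^2"
  have "\<bar>x $ i - 2 * pi * of_int (round (x $ i / (2 * pi)))\<bar> \<le> pi" for i
  proof -
    have "x $ i - 2 * pi * of_int (round (x $ i / (2 * pi))) =
        - (2 * pi * (of_int (round (x $ i / (2 * pi))) - x $ i / (2 * pi)))"
      by (simp add: right_diff_distrib)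
    then have "\<bar>x $ i - 2 * pi * of_int (round (x $ i / (2 * pi)))\<bar> =
        2 * pi * \<bar>of_int (round (x $ i / (2 * pi))) - x $ i / (2 * pi)\<bar>"
      by (simp only: abs_minus abs_mult) simp
    also have "\<dots> \<le> 2 * pi * (1 / 2)"
      by (intro mult_left_mono of_int_round_abs_le) auto
    finally show ?thesis by simp
  qed
  then show "x - (2 * pi) *\<^sub>R lattice_vec ?k \<in> period_cell"
    by (auto simp: period_cell_def Basis_vec_def inner_axis)
qed

lemma nn_integral_le_periodized:
  fixes u :: "real^2 \<Rightarrow> ennreal"
  assumes [measurable]: "u \<in> borel_measurable borel"
  shows "(\<integral>\<^sup>+x. u x \<partial>lborel) \<le>
    (\<integral>\<^sup>+\<omega>. indicator period_cell \<omega> * (\<integral>\<^sup>+k. u (\<omega> + (2 * pi) *\<^sub>R lattice_vec k) \<partial>count_space UNIV) \<partial>lborel)"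
proof -
  let ?L = "\<lambda>k. (2 * pi) *\<^sub>R lattice_vec k"
  have "(\<integral>\<^sup>+x. u x \<partial>lborel) \<le> (\<integral>\<^sup>+x. (\<integral>\<^sup>+k. u x * indicator period_cell (x - ?L k) \<partial>count_space UNIV) \<partial>lborel)"
  proof (rule nn_integral_mono)
    fix x
    obtain k where k: "x - ?L k \<in> period_cell"
      using period_cell_cover by blast
    have "u x = (\<integral>\<^sup>+j. u x * indicator period_cell (x - ?L k) * indicator {k} j \<partial>count_space UNIV)"
      using k by simp
    also have "\<dots> \<le> (\<integral>\<^sup>+j. u x * indicator period_cell (x - ?L j) \<partial>count_space UNIV)"
      by (intro nn_integral_mono) (auto simp: indicator_def)
    finally show "u x \<le> (\<integral>\<^sup>+k. u x * indicator period_cell (x - ?L k) \<partial>count_space UNIV)" .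
  qed
  also have "\<dots> = (\<integral>\<^sup>+k. (\<integral>\<^sup>+x. u x * indicator period_cell (x - ?L k) \<partial>lborel) \<partial>count_space UNIV)"
    by (intro nn_integral_count_space_nn_integral) auto
  also have "\<dots> = (\<integral>\<^sup>+k. (\<integral>\<^sup>+\<omega>. u (\<omega> + ?L k) * indicator period_cell \<omega> \<partial>lborel) \<partial>count_space UNIV)"
  proof (rule nn_integral_cong)
    fix k
    show "(\<integral>\<^sup>+x. u x * indicator period_cell (x - ?L k) \<partial>lborel) = (\<integral>\<^sup>+\<omega>. u (\<omega> + ?L k) * indicator period_cell \<omega> \<partial>lborel)"
      using nn_integral_translate[of "\<lambda>x. u x * indicator period_cell (x - ?L k)" "?L k"] by simp
  qed
  also have "\<dots> = (\<integral>\<^sup>+\<omega>. (\<integral>\<^sup>+k. u (\<omega> + ?L k) * indicator period_cell \<omega> \<partial>count_space UNIV) \<partial>lborel)"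
    by (intro nn_integral_count_space_nn_integral[symmetric]) auto
  also have "\<dots> = (\<integral>\<^sup>+\<omega>. indicator period_cell \<omega> * (\<integral>\<^sup>+k. u (\<omega> + ?L k) \<partial>count_space UNIV) \<partial>lborel)"
    by (intro nn_integral_cong) (simp add: nn_integral_cmult mult.commute)
  finally show ?thesis .
qed

text \<open>If every value of an integrable \<open>w\<close> is controlled by the mass of \<open>w\<close> in a ball of fixed
  radius, then the periodization of \<open>w\<close> is bounded, since the balls around the points of a
  translated lattice overlap boundedly often.\<close>

lemma periodization_bounded:
  fixes w :: "real^2 \<Rightarrow> ennreal"
  assumes w[measurable]: "w \<in> borel_measurable borel"
    and local: "\<And>p. w p \<le> C * (\<integral>\<^sup>+x. w x * indicator (ball p R) x \<partial>lborel)"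
  shows "\<exists>N::nat. \<forall>\<omega>. (\<integral>\<^sup>+k. w (\<omega> + (2 * pi) *\<^sub>R lattice_vec k) \<partial>count_space UNIV)
     \<le> C * (of_nat N * (\<integral>\<^sup>+x. w x \<partial>lborel))"
proof -
  let ?L = "\<lambda>k. (2 * pi) *\<^sub>R lattice_vec k"
  have [measurable]: "ball c R \<in> sets borel" for c :: "real^2"
    by simp
  define M where "M = {m. norm (lattice_vec m) \<le> 2 * R}"
  have finM: "finite M"
    unfolding M_def by (rule finite_lattice_vec_bounded)
  have overlap: "(\<integral>\<^sup>+k. indicator (ball (\<omega> + ?L k) R) x \<partial>count_space UNIV) \<le> of_nat (card M)" for \<omega> x
  proof -
    define K where "K = {k. x \<in> ball (\<omega> + ?L k) R}"
    have "finite K \<and> card K \<le> card M"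
    proof (cases "K = {}")
      case False
      then obtain k0 where k0: "k0 \<in> K" by blast
      \<comment> \<open>Differences with one fixed member lie in a finite set that depends on neither \<open>\<omega>\<close> nor \<open>x\<close>.\<close>
      have "(\<lambda>k. k - k0) ` K \<subseteq> M"
      proof safe
        fix k assume k: "k \<in> K"
        have "2 * pi * norm (lattice_vec (k - k0)) = norm (?L k - ?L k0)"
          by (simp add: lattice_vec_diff flip: scaleR_diff_right)
        also have "\<dots> \<le> dist (\<omega> + ?L k) x + dist x (\<omega> + ?L k0)"
          using dist_triangle[of "\<omega> + ?L k" "\<omega> + ?L k0" x] by (simp add: dist_norm)
        also have "\<dots> \<le> 2 * R"
          using k k0 by (auto simp: K_def dist_commute)
        finally have "2 * pi * norm (lattice_vec (k - k0)) \<le> 2 * R" .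
        moreover have "1 * norm (lattice_vec (k - k0)) \<le> 2 * pi * norm (lattice_vec (k - k0))"
          using pi_gt3 by (intro mult_right_mono) auto
        ultimately show "k - k0 \<in> M"
          by (simp add: M_def)
      qed
      moreover have "inj_on (\<lambda>k. k - k0) K"
        by (auto simp: inj_on_def)
      ultimately show ?thesis
        using finM by (metis card_inj_on_le inj_on_finite)
    qed simp
    moreover have "indicator (ball (\<omega> + ?L k) R) x = (indicator K k :: ennreal)" for k
      by (simp add: K_def indicator_def)
    ultimately show ?thesis
      by (simp add: emeasure_count_space_finite)
  qed
  have "(\<integral>\<^sup>+k. w (\<omega> + ?L k) \<partial>count_space UNIV) \<le> C * (of_nat (card M) * (\<integral>\<^sup>+x. w x \<partial>lborel))" for \<omega>
  proof -
    have "(\<integral>\<^sup>+k. w (\<omega> + ?L k) \<partial>count_space UNIV) \<le>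
        (\<integral>\<^sup>+k. C * (\<integral>\<^sup>+x. w x * indicator (ball (\<omega> + ?L k) R) x \<partial>lborel) \<partial>count_space UNIV)"
      by (intro nn_integral_mono local)
    also have "\<dots> = C * (\<integral>\<^sup>+k. (\<integral>\<^sup>+x. w x * indicator (ball (\<omega> + ?L k) R) x \<partial>lborel) \<partial>count_space UNIV)"
      by (rule nn_integral_cmult) simp
    also have "(\<integral>\<^sup>+k. (\<integral>\<^sup>+x. w x * indicator (ball (\<omega> + ?L k) R) x \<partial>lborel) \<partial>count_space UNIV) =
        (\<integral>\<^sup>+x. (\<integral>\<^sup>+k. w x * indicator (ball (\<omega> + ?L k) R) x \<partial>count_space UNIV) \<partial>lborel)"
      by (intro nn_integral_count_space_nn_integral[symmetric]) (simp, measurable)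
    also have "\<dots> = (\<integral>\<^sup>+x. w x * (\<integral>\<^sup>+k. indicator (ball (\<omega> + ?L k) R) x \<partial>count_space UNIV) \<partial>lborel)"
      by (simp add: nn_integral_cmult)
    also have "\<dots> \<le> (\<integral>\<^sup>+x. of_nat (card M) * w x \<partial>lborel)"
      using overlap by (intro nn_integral_mono) (simp add: mult.commute mult_left_mono)
    also have "\<dots> = of_nat (card M) * (\<integral>\<^sup>+x. w x \<partial>lborel)"
      by (rule nn_integral_cmult) simp
    finally show ?thesis by (simp add: mult_left_mono)
  qed
  then show ?thesis by blast
qed

lemma trig_poly_periodic:
  "(\<Sum>k\<in>F. c k * exp (- (\<i> * of_real ((\<omega> + (2 * pi) *\<^sub>R lattice_vec j) \<bullet> lattice_vec k)))) =
   (\<Sum>k\<in>F. c k * exp (- (\<i> * of_real (\<omega> \<bullet> lattice_vec k))))"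
proof (intro sum.cong refl)
  fix k
  have "- (lattice_vec j \<bullet> lattice_vec k) \<in> \<int>"
    using inner_lattice_vec[of j k] by simp
  from exp_integer_2pi[OF this]
  have "exp (- (2 * of_real (lattice_vec j \<bullet> lattice_vec k) * of_real pi * \<i>)) = (1::complex)"
    by simp
  moreover have "- (\<i> * complex_of_real ((\<omega> + (2 * pi) *\<^sub>R lattice_vec j) \<bullet> lattice_vec k)) =
      - (\<i> * of_real (\<omega> \<bullet> lattice_vec k)) + - (2 * of_real (lattice_vec j \<bullet> lattice_vec k) * of_real pi * \<i>)"
    by (simp add: inner_add_left algebra_simps)
  ultimately show "c k * exp (- (\<i> * of_real ((\<omega> + (2 * pi) *\<^sub>R lattice_vec j) \<bullet> lattice_vec k))) =
      c k * exp (- (\<i> * of_real (\<omega> \<bullet> lattice_vec k)))"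
    by (simp only: exp_add mult_1_right)
qed

text \<open>The Riesz bounds for integer translates are the bounds for the periodization of \<open>\<bar>h\<bar>\<^sup>2\<close>. The
  lower bound keeps its term \<open>k = 0\<close> only, the upper one comes from the local control of \<open>h\<close>.\<close>

theorem riesz_bounds_translates:
  fixes f h :: "real^2 \<Rightarrow> complex"
  assumes fh: "has_fourier_transform f h" and f: "f \<in> L2" and h1: "\<And>\<omega>. cmod (h \<omega>) \<le> M"
    and A: "0 < A" "\<And>\<omega>. \<omega> \<in> period_cell \<Longrightarrow> A \<le> (cmod (h \<omega>))\<^sup>2"
    and local: "\<And>p. ennreal ((cmod (h p))\<^sup>2) \<le>
        ennreal C * (\<integral>\<^sup>+x. ennreal ((cmod (h x))\<^sup>2) * indicator (ball p R) x \<partial>lborel)"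
  obtains B where "A \<le> B"
    "\<And>F c. finite F \<Longrightarrow> A * (\<Sum>k\<in>F. (cmod (c k))\<^sup>2) \<le> (L2_norm (\<lambda>x. \<Sum>k\<in>F. c k * f (x - lattice_vec k)))\<^sup>2"
    "\<And>F c. finite F \<Longrightarrow> (L2_norm (\<lambda>x. \<Sum>k\<in>F. c k * f (x - lattice_vec k)))\<^sup>2 \<le> B * (\<Sum>k\<in>F. (cmod (c k))\<^sup>2)"
proof -
  let ?L = "\<lambda>k. (2 * pi) *\<^sub>R lattice_vec k"
  have [measurable]: "h \<in> borel_measurable borel"
    using fh by (simp add: has_fourier_transform_def)
  have "h \<in> L2"
    using Plancherel_translates(1)[OF fh f h1, of "{0::int^2}" "\<lambda>_. 1" lattice_vec] by (simp add: lattice_vec_zero)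
  obtain N :: nat where N: "\<And>\<omega>. (\<integral>\<^sup>+k. ennreal ((cmod (h (\<omega> + ?L k)))\<^sup>2) \<partial>count_space UNIV) \<le>
      ennreal C * (of_nat N * (\<integral>\<^sup>+x. ennreal ((cmod (h x))\<^sup>2) \<partial>lborel))"
    using periodization_bounded[OF _ local] by auto
  define B0 where "B0 = max C 0 * (real N * (L2_norm h)\<^sup>2)"
  have B0: "0 \<le> B0"
    by (simp add: B0_def)
  have "(\<integral>\<^sup>+k. ennreal ((cmod (h (\<omega> + ?L k)))\<^sup>2) \<partial>count_space UNIV) \<le> ennreal B0" for \<omega>
  proof -
    have "ennreal C = ennreal (max C 0)"
      by (cases "0 \<le> C") (auto simp: max_def ennreal_neg)
    then show ?thesis
      using N[of \<omega>] unfolding nn_integral_L2[OF \<open>h \<in> L2\<close>] B0_def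
      by (simp add: ennreal_mult ennreal_of_nat_eq_real_of_nat)
  qed
  note per = this
  define P where "P F c \<omega> = (\<Sum>k\<in>F. c k * exp (- (\<i> * of_real (\<omega> \<bullet> lattice_vec k))))" for F c and \<omega> :: "real^2"
  have [measurable]: "P F c \<in> borel_measurable borel" for F c
    unfolding P_def by measurable
  let ?S = "\<lambda>c F. \<Sum>k\<in>F. (cmod (c k))\<^sup>2"
  let ?N = "\<lambda>c F. (L2_norm (\<lambda>x. \<Sum>k\<in>F. c k * f (x - lattice_vec k)))\<^sup>2"
  have cell: "(\<integral>\<^sup>+\<omega>. indicator period_cell \<omega> * ennreal ((cmod (P F c \<omega>))\<^sup>2) \<partial>lborel) = ennreal ((2 * pi)\<^sup>2 * ?S c F)"
    if "finite F" for F c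
    using nn_integral_trig_poly[OF inj_lattice_vec lattice_vec_Basis that, of c] by (simp add: P_def)
  have norm: "(\<integral>\<^sup>+\<omega>. ennreal ((cmod (P F c \<omega> * h \<omega>))\<^sup>2) \<partial>lborel) = ennreal ((2 * pi)\<^sup>2 * ?N c F)"
    if "finite F" for F c
    using Plancherel_translates[OF fh f h1 that, of c lattice_vec]
    unfolding P_def[symmetric] by (simp add: nn_integral_L2)
  have lower: "A * ?S c F \<le> ?N c F" if F: "finite F" for F c
  proof -
    have "ennreal ((2 * pi)\<^sup>2 * (A * ?S c F)) = ennreal A * (\<integral>\<^sup>+\<omega>. indicator period_cell \<omega> * ennreal ((cmod (P F c \<omega>))\<^sup>2) \<partial>lborel)"
      unfolding cell[OF F] using A(1) by (simp add: ennreal_mult[symmetric] sum_nonneg mult_ac)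
    also have "\<dots> = (\<integral>\<^sup>+\<omega>. ennreal A * (indicator period_cell \<omega> * ennreal ((cmod (P F c \<omega>))\<^sup>2)) \<partial>lborel)"
      by (rule nn_integral_cmult[symmetric]) measurable
    also have "\<dots> \<le> (\<integral>\<^sup>+\<omega>. ennreal ((cmod (P F c \<omega> * h \<omega>))\<^sup>2) \<partial>lborel)"
    proof (rule nn_integral_mono)
      fix \<omega> :: "real^2"
      show "ennreal A * (indicator period_cell \<omega> * ennreal ((cmod (P F c \<omega>))\<^sup>2)) \<le> ennreal ((cmod (P F c \<omega> * h \<omega>))\<^sup>2)"
        using A by (cases "\<omega> \<in> period_cell")
          (auto simp: ennreal_mult[symmetric] norm_mult power_mult_distrib mult.commute[of A] intro!: ennreal_leI mult_left_mono)
    qed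
    finally have "(2 * pi)\<^sup>2 * (A * ?S c F) \<le> (2 * pi)\<^sup>2 * ?N c F"
      unfolding norm[OF F] by (subst (asm) ennreal_le_iff) auto
    then show ?thesis by simp
  qed
  have upper: "?N c F \<le> B0 * ?S c F" if F: "finite F" for F c
  proof -
    have "ennreal ((2 * pi)\<^sup>2 * ?N c F) = (\<integral>\<^sup>+\<omega>. ennreal ((cmod (P F c \<omega> * h \<omega>))\<^sup>2) \<partial>lborel)"
      by (rule norm[OF F, symmetric])
    also have "\<dots> \<le> (\<integral>\<^sup>+\<omega>. indicator period_cell \<omega> *
        (\<integral>\<^sup>+k. ennreal ((cmod (P F c (\<omega> + ?L k) * h (\<omega> + ?L k)))\<^sup>2) \<partial>count_space UNIV) \<partial>lborel)"
      by (rule nn_integral_le_periodized) measurable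
    also have "\<dots> \<le> (\<integral>\<^sup>+\<omega>. ennreal B0 * (indicator period_cell \<omega> * ennreal ((cmod (P F c \<omega>))\<^sup>2)) \<partial>lborel)"
    proof (rule nn_integral_mono)
      fix \<omega> :: "real^2"
      have "(\<integral>\<^sup>+k. ennreal ((cmod (P F c (\<omega> + ?L k) * h (\<omega> + ?L k)))\<^sup>2) \<partial>count_space UNIV) =
          (\<integral>\<^sup>+k. ennreal ((cmod (P F c \<omega>))\<^sup>2) * ennreal ((cmod (h (\<omega> + ?L k)))\<^sup>2) \<partial>count_space UNIV)"
        unfolding P_def trig_poly_periodic by (simp add: norm_mult power_mult_distrib ennreal_mult)
      also have "\<dots> = ennreal ((cmod (P F c \<omega>))\<^sup>2) * (\<integral>\<^sup>+k. ennreal ((cmod (h (\<omega> + ?L k)))\<^sup>2) \<partial>count_space UNIV)"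
        by (rule nn_integral_cmult) simp
      also have "\<dots> \<le> ennreal ((cmod (P F c \<omega>))\<^sup>2) * ennreal B0"
        by (intro mult_left_mono per) auto
      finally show "indicator period_cell \<omega> *
          (\<integral>\<^sup>+k. ennreal ((cmod (P F c (\<omega> + ?L k) * h (\<omega> + ?L k)))\<^sup>2) \<partial>count_space UNIV)
          \<le> ennreal B0 * (indicator period_cell \<omega> * ennreal ((cmod (P F c \<omega>))\<^sup>2))"
        by (simp add: indicator_def mult.commute)
    qed
    also have "\<dots> = ennreal B0 * (\<integral>\<^sup>+\<omega>. indicator period_cell \<omega> * ennreal ((cmod (P F c \<omega>))\<^sup>2) \<partial>lborel)"
      by (rule nn_integral_cmult) measurable
    also have "\<dots> = ennreal ((2 * pi)\<^sup>2 * (B0 * ?S c F))"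
      unfolding cell[OF F] using B0 by (simp add: ennreal_mult[symmetric] sum_nonneg mult_ac)
    finally have "(2 * pi)\<^sup>2 * ?N c F \<le> (2 * pi)\<^sup>2 * (B0 * ?S c F)"
      using B0 by (subst (asm) ennreal_le_iff) (auto intro!: mult_nonneg_nonneg sum_nonneg)
    then show ?thesis by simp
  qed
  show thesis
  proof (rule that[of "max A B0"])
    fix F :: "(int^2) set" and c :: "int^2 \<Rightarrow> complex" assume F: "finite F"
    have "B0 * ?S c F \<le> max A B0 * ?S c F"
      by (intro mult_right_mono) (auto intro: sum_nonneg)
    with upper[OF F, of c] show "?N c F \<le> max A B0 * ?S c F" by linarith
  qed (use lower in auto)
qed

section \<open>The symbol of the hex spline\<close>

text \<open>The common modulus of the quotients in the symbol.\<close>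

definition abs_sinc :: "real \<Rightarrow> real" where
  "abs_sinc s = (if s = 0 then 1 else 2 * \<bar>sin (s / 2)\<bar> / \<bar>s\<bar>)"

lemma cmod_quot_minus: "cmod (quot_minus s) = abs_sinc s"
  using dist_exp_i_1[of "- s"]
  by (simp add: quot_minus_def abs_sinc_def norm_divide norm_mult norm_minus_commute)

lemma cmod_quot_plus: "cmod (quot_plus s) = abs_sinc s"
  using dist_exp_i_1[of s] by (simp add: quot_plus_def abs_sinc_def norm_divide norm_mult)

lemma abs_sinc_nonneg [simp]: "0 \<le> abs_sinc s"
  by (simp add: abs_sinc_def)

lemma abs_sinc_le_1: "abs_sinc s \<le> 1"
  using abs_sin_x_le_abs_x[of "s / 2"] by (simp add: abs_sinc_def divide_le_eq)

lemma abs_sinc_le: "abs_sinc s \<le> 3 / (1 + \<bar>s\<bar>)"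
proof (cases "s = 0")
  case False
  have "abs_sinc s * \<bar>s\<bar> = 2 * \<bar>sin (s / 2)\<bar>"
    using False by (simp add: abs_sinc_def)
  then have "abs_sinc s * \<bar>s\<bar> \<le> 2"
    by simp
  then have "abs_sinc s * (1 + \<bar>s\<bar>) \<le> 3"
    using abs_sinc_le_1[of s] by (simp add: distrib_left)
  then show ?thesis by (simp add: pos_le_divide_eq)
qed (simp add: abs_sinc_def)

lemma abs_sinc_ge:
  assumes "1 / 2 \<le> \<bar>sin (s / 2)\<bar>"
  shows "1 / (1 + \<bar>s\<bar>) \<le> abs_sinc s"
proof -
  have "s \<noteq> 0" using assms by auto
  have "1 / (1 + \<bar>s\<bar>) \<le> 1 / \<bar>s\<bar>"
    using \<open>s \<noteq> 0\<close> by (intro divide_left_mono) auto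
  also have "\<dots> \<le> abs_sinc s"
    using \<open>s \<noteq> 0\<close> assms by (simp add: abs_sinc_def divide_right_mono)
  finally show ?thesis .
qed

text \<open>Both bounds are multiples of \<open>1 / (1 + \<bar>s\<bar>)\<close>, which varies by at most the factor \<open>1 + D\<close> over
  distances up to \<open>D\<close>; away from the zeros of the sine at \<open>s'\<close> the lower bound is available.\<close>

lemma abs_sinc_comparable:
  assumes "\<bar>s - s'\<bar> \<le> D" "1 / 2 \<le> \<bar>sin (s' / 2)\<bar>"
  shows "abs_sinc s \<le> 3 * (1 + D) * abs_sinc s'"
proof -
  have D: "0 \<le> D" using assms(1) by linarith
  have "1 + \<bar>s'\<bar> \<le> (1 + D) * (1 + \<bar>s\<bar>)"
  proof -
    have "\<bar>s'\<bar> \<le> \<bar>s\<bar> + D"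
      using assms(1) by linarith
    moreover have "0 \<le> D * \<bar>s\<bar>"
      using D by simp
    ultimately show ?thesis
      by (simp add: algebra_simps)
  qed
  then have "3 / (1 + \<bar>s\<bar>) \<le> 3 * (1 + D) * (1 / (1 + \<bar>s'\<bar>))"
  proof -
    have "3 / a \<le> 3 * (1 + D) * (1 / b)" if "b \<le> (1 + D) * a" "0 < a" "0 < b" for a b
      using that by (simp add: field_simps)
    then show ?thesis
      using \<open>1 + \<bar>s'\<bar> \<le> (1 + D) * (1 + \<bar>s\<bar>)\<close> by (simp add: add_pos_nonneg)
  qed
  also have "\<dots> \<le> 3 * (1 + D) * abs_sinc s'"
    using D by (intro mult_left_mono abs_sinc_ge assms) auto
  finally show ?thesis
    using abs_sinc_le[of s] by linarith
qed

lemma sin_ge_half: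
  assumes "pi / 6 \<le> y" "y \<le> 5 * pi / 6"
  shows "1 / 2 \<le> sin y"
proof (cases "y \<le> pi / 2")
  case True
  then have "sin (pi / 6) \<le> sin y"
    using assms pi_gt_zero by (intro sin_monotone_2pi_le) auto
  then show ?thesis by (simp add: sin_30)
next
  case False
  then have "sin (pi / 6) \<le> sin (pi - y)"
    using assms pi_gt_zero by (intro sin_monotone_2pi_le) auto
  then show ?thesis by (simp add: sin_30)
qed

lemma abs_sin_shift: "\<bar>sin (pi * of_int m + y)\<bar> = \<bar>sin y\<bar>"
proof -
  have s: "sin (pi * of_int m) = 0"
    using sin_integer_2pi sin_npi_int by (simp add: mult.commute)
  have "(cos (pi * of_int m))\<^sup>2 = 1"
    using sin_cos_squared_add[of "pi * of_int m"] s by simp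
  then have "\<bar>cos (pi * of_int m)\<bar> = 1"
    by (simp add: power2_eq_1_iff)
  then show ?thesis
    by (simp add: sin_add s abs_mult)
qed

text \<open>The first zeros of \<open>abs_sinc\<close> are at \<open>2 * pi\<close> and \<open>- 2 * pi\<close>. Near the origin the mean value theorem
  bounds the sine from below by a multiple of its argument, and beyond by its values at \<open>pi / 3\<close> and \<open>S / 2\<close>.\<close>

lemma abs_sinc_lower_bound:
  assumes "0 < S" "S < 2 * pi"
  obtains \<delta> where "0 < \<delta>" "\<And>s. \<bar>s\<bar> \<le> S \<Longrightarrow> \<delta> \<le> abs_sinc s"
proof -
  define \<mu> where "\<mu> = min (sin (pi / 3)) (sin (pi - S / 2))"
  have \<mu>: "0 < \<mu>"
    using assms by (auto simp: \<mu>_def sin_60 intro!: sin_gt_zero)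
  define \<delta> where "\<delta> = min (1 / 2) (\<mu> / pi)"
  have half: "\<delta> \<le> abs_sinc s" if s: "0 < s" "s \<le> S" for s
  proof (cases "s / 2 \<le> pi / 3")
    case True
    have "\<exists>z>0. z < s / 2 \<and> sin (s / 2) - sin 0 = (s / 2 - 0) * cos z"
      using s by (intro MVT2) (auto intro!: derivative_eq_intros)
    then obtain z where z: "0 < z" "z < s / 2" "sin (s / 2) = s / 2 * cos z"
      by auto
    have "cos (pi / 3) \<le> cos z"
      using z True pi_gt_zero by (intro cos_monotone_0_pi_le) auto
    then have "s / 2 * (1 / 2) \<le> sin (s / 2)"
      unfolding z(3) using s by (intro mult_left_mono) (auto simp: cos_60)
    then have "1 / 2 \<le> abs_sinc s"
      using s by (auto simp: abs_sinc_def field_simps)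
    then show ?thesis by (simp add: \<delta>_def)
  next
    case False
    have "\<mu> \<le> sin (s / 2)"
    proof (cases "s / 2 \<le> pi / 2")
      case True
      then have "sin (pi / 3) \<le> sin (s / 2)"
        using False pi_gt_zero by (intro sin_monotone_2pi_le) auto
      then show ?thesis by (simp add: \<mu>_def)
    next
      case False
      have "sin (pi - S / 2) \<le> sin (pi - s / 2)"
        using False s assms pi_gt_zero by (intro sin_monotone_2pi_le) auto
      then show ?thesis by (simp add: \<mu>_def)
    qed
    have "\<mu> / pi \<le> \<mu> / (s / 2)"
      using \<mu> s assms by (intro divide_left_mono) auto
    also have "\<dots> \<le> sin (s / 2) / (s / 2)"
      using \<open>\<mu> \<le> sin (s / 2)\<close> s by (intro divide_right_mono) auto
    also have "\<dots> = abs_sinc s"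
      using s \<mu> \<open>\<mu> \<le> sin (s / 2)\<close> by (simp add: abs_sinc_def)
    finally show ?thesis by (simp add: \<delta>_def)
  qed
  have "\<delta> \<le> abs_sinc s" if "\<bar>s\<bar> \<le> S" for s
  proof -
    have "abs_sinc s = abs_sinc \<bar>s\<bar>"
      by (simp add: abs_sinc_def abs_if)
    moreover have "\<delta> \<le> abs_sinc \<bar>s\<bar>"
      using half[of "\<bar>s\<bar>"] that by (cases "s = 0") (auto simp: \<delta>_def abs_sinc_def)
    ultimately show ?thesis by simp
  qed
  then show thesis
    using \<mu> by (intro that[of \<delta>]) (auto simp: \<delta>_def)
qed

lemma cmod_hex_spline_hat:
  "cmod (hex_spline_hat \<alpha> x1 x2 x3 \<omega>) =
    abs_sinc (\<omega> \<bullet> x1) powr (\<alpha> $ 1) * abs_sinc (\<omega> \<bullet> x2) powr (\<alpha> $ 2) * abs_sinc (\<omega> \<bullet> x3) powr (\<alpha> $ 3)"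
  by (simp add: hex_spline_hat_def norm_mult norm_powr_real_powr' cmod_quot_minus cmod_quot_plus)

context
  fixes \<alpha> :: "real^3"
  assumes \<alpha>: "0 < \<alpha> $ 1" "0 < \<alpha> $ 2" "0 < \<alpha> $ 3"
begin

lemma cmod_hex_spline_hat_le_1: "cmod (hex_spline_hat \<alpha> x1 x2 x3 \<omega>) \<le> 1"
proof -
  have "abs_sinc s powr a \<le> 1" if "0 < a" for s a
    using powr_mono2[of a "abs_sinc s" 1] that abs_sinc_le_1[of s] by simp
  then show ?thesis
    unfolding cmod_hex_spline_hat using \<alpha> by (intro mult_le_one mult_nonneg_nonneg) auto
qed

lemma cmod_hex_spline_hat_ge:
  assumes "0 < \<delta>" "\<delta> \<le> abs_sinc (\<omega> \<bullet> x1)" "\<delta> \<le> abs_sinc (\<omega> \<bullet> x2)" "\<delta> \<le> abs_sinc (\<omega> \<bullet> x3)"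
  shows "\<delta> powr (\<alpha> $ 1 + \<alpha> $ 2 + \<alpha> $ 3) \<le> cmod (hex_spline_hat \<alpha> x1 x2 x3 \<omega>)"
  unfolding cmod_hex_spline_hat powr_add using assms \<alpha>
  by (intro mult_mono powr_mono2 mult_nonneg_nonneg) auto

lemma cmod_hex_spline_hat_comparable:
  assumes D: "0 \<le> D"
    and "abs_sinc (\<omega> \<bullet> x1) \<le> D * abs_sinc (\<omega>' \<bullet> x1)"
    and "abs_sinc (\<omega> \<bullet> x2) \<le> D * abs_sinc (\<omega>' \<bullet> x2)"
    and "abs_sinc (\<omega> \<bullet> x3) \<le> D * abs_sinc (\<omega>' \<bullet> x3)"
  shows "cmod (hex_spline_hat \<alpha> x1 x2 x3 \<omega>) \<le>
    D powr (\<alpha> $ 1 + \<alpha> $ 2 + \<alpha> $ 3) * cmod (hex_spline_hat \<alpha> x1 x2 x3 \<omega>')"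
proof -
  have 1: "abs_sinc s powr a \<le> D powr a * abs_sinc s' powr a" if "abs_sinc s \<le> D * abs_sinc s'" "0 < a" for s s' a
    using powr_mono2[of a "abs_sinc s" "D * abs_sinc s'"] that D by (simp add: powr_mult)
  have "cmod (hex_spline_hat \<alpha> x1 x2 x3 \<omega>) \<le>
      (D powr (\<alpha> $ 1) * abs_sinc (\<omega>' \<bullet> x1) powr (\<alpha> $ 1)) *
      (D powr (\<alpha> $ 2) * abs_sinc (\<omega>' \<bullet> x2) powr (\<alpha> $ 2)) *
      (D powr (\<alpha> $ 3) * abs_sinc (\<omega>' \<bullet> x3) powr (\<alpha> $ 3))"
    unfolding cmod_hex_spline_hat using assms \<alpha>
    by (intro mult_mono 1 mult_nonneg_nonneg) auto
  then show ?thesis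
    by (simp add: cmod_hex_spline_hat powr_add mult_ac)
qed

end

lemma inner_real2: "(x :: real^2) \<bullet> y = x $ 1 * y $ 1 + x $ 2 * y $ 2"
  by (simp add: inner_vec_def sum_2)

lemma norm_real2_le: "norm (x :: real^2) \<le> \<bar>x $ 1\<bar> + \<bar>x $ 2\<bar>"
  using norm_le_l1_cart[of x] by (simp add: sum_2)

text \<open>In the coordinates \<open>s1 = \<omega> \<bullet> x1\<close> and \<open>s2 = \<omega> \<bullet> x2\<close> the moduli of the three sines have
  period \<open>2 * pi\<close> in each variable. They exceed \<open>1 / 2\<close> near \<open>(2 * pi / 3, 2 * pi / 3)\<close>, where
  the half-arguments are \<open>pi / 3\<close>, \<open>pi / 3\<close> and \<open>2 * pi / 3\<close>, hence also near every translate of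
  this point by a period.\<close>

lemma good_ball_nearby:
  fixes x1 x2 :: "real^2"
  assumes x12: "x1 + x2 = vector [1, 0]" and x1: "x1 $ 2 \<noteq> 0"
  shows "\<exists>r R. 0 < r \<and> (\<forall>p. \<exists>q. ball q r \<subseteq> ball p R \<and> (\<forall>\<omega>\<in>ball q r.
     1 / 2 \<le> \<bar>sin (\<omega> \<bullet> x1 / 2)\<bar> \<and> 1 / 2 \<le> \<bar>sin (\<omega> \<bullet> x2 / 2)\<bar> \<and> 1 / 2 \<le> \<bar>sin (\<omega> \<bullet> (x1 + x2) / 2)\<bar>))"
proof -
  have x2: "x2 $ 1 = 1 - x1 $ 1" "x2 $ 2 = - x1 $ 2"
    using arg_cong[OF x12, of "\<lambda>x. x $ 1"] arg_cong[OF x12, of "\<lambda>x. x $ 2"] by (auto simp: algebra_simps eq_neg_iff_add_eq_0)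
  define r where "r = 1 / (4 * (1 + norm x1 + norm x2))"
  define W where "W = 4 * pi + (2 * pi + 4 * pi * \<bar>x1 $ 1\<bar>) / \<bar>x1 $ 2\<bar>"
  have pos: "0 < 1 + norm x1 + norm x2"
    by (simp add: add_pos_nonneg)
  have r: "0 < r" "r * norm x1 \<le> 1 / 4" "r * norm x2 \<le> 1 / 4"
    using pos by (auto simp: r_def divide_simps)
  have "\<exists>q. ball q r \<subseteq> ball p (W + r) \<and> (\<forall>\<omega>\<in>ball q r.
     1 / 2 \<le> \<bar>sin (\<omega> \<bullet> x1 / 2)\<bar> \<and> 1 / 2 \<le> \<bar>sin (\<omega> \<bullet> x2 / 2)\<bar> \<and> 1 / 2 \<le> \<bar>sin (\<omega> \<bullet> (x1 + x2) / 2)\<bar>)" for p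
  proof -
    define m where "m x = \<lfloor>p \<bullet> x / (2 * pi)\<rfloor>" for x
    define t where "t x = 2 * pi * of_int (m x) + 2 * pi / 3" for x
    have t: "\<bar>t x - p \<bullet> x\<bar> \<le> 2 * pi" for x
    proof -
      have "of_int (m x) \<le> p \<bullet> x / (2 * pi)" "p \<bullet> x / (2 * pi) < of_int (m x) + 1"
        unfolding m_def by linarith+
      then have "2 * pi * of_int (m x) \<le> p \<bullet> x" "p \<bullet> x < 2 * pi * of_int (m x) + 2 * pi"
        by (auto simp: field_simps)
      then show ?thesis
        unfolding t_def abs_le_iff using pi_gt_zero by auto
    qed
    define u v where "u = t x1 - p \<bullet> x1" and "v = t x2 - p \<bullet> x2"
    have uv: "\<bar>u\<bar> \<le> 2 * pi" "\<bar>v\<bar> \<le> 2 * pi"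
      using t by (auto simp: u_def v_def)
    \<comment> \<open>The step that changes the two coordinates of \<open>p\<close> by \<open>u\<close> and \<open>v\<close>.\<close>
    define w :: "real^2" where "w = vector [u + v, (u - (u + v) * x1 $ 1) / x1 $ 2]"
    have w: "w \<bullet> x1 = u" "w \<bullet> x2 = v"
      using x1 by (auto simp: w_def inner_real2 x2 field_simps)
    have "norm w \<le> W"
    proof -
      have "\<bar>u - (u + v) * x1 $ 1\<bar> \<le> 2 * pi + 4 * pi * \<bar>x1 $ 1\<bar>"
      proof -
        have "\<bar>(u + v) * x1 $ 1\<bar> \<le> 4 * pi * \<bar>x1 $ 1\<bar>"
          unfolding abs_mult using uv by (intro mult_right_mono) auto
        then show ?thesis using uv by linarith
      qed
      then have "\<bar>(u - (u + v) * x1 $ 1) / x1 $ 2\<bar> \<le> (2 * pi + 4 * pi * \<bar>x1 $ 1\<bar>) / \<bar>x1 $ 2\<bar>"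
        by (simp add: divide_right_mono)
      moreover have "\<bar>u + v\<bar> \<le> 4 * pi"
        using uv by linarith
      ultimately show ?thesis
        using norm_real2_le[of w] by (simp add: w_def W_def)
    qed
    have "ball (p + w) r \<subseteq> ball p (W + r)"
    proof
      fix x assume "x \<in> ball (p + w) r"
      then have "dist p x < W + r"
        using \<open>norm w \<le> W\<close> dist_triangle[of p x "p + w"] by (simp add: dist_norm)
      then show "x \<in> ball p (W + r)" by simp
    qed
    moreover have "1 / 2 \<le> \<bar>sin (\<omega> \<bullet> x1 / 2)\<bar> \<and> 1 / 2 \<le> \<bar>sin (\<omega> \<bullet> x2 / 2)\<bar> \<and> 1 / 2 \<le> \<bar>sin (\<omega> \<bullet> (x1 + x2) / 2)\<bar>"
      if \<omega>: "\<omega> \<in> ball (p + w) r" for \<omega>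
    proof -
      define d where "d = \<omega> - (p + w)"
      have "norm d \<le> r"
        using \<omega> by (simp add: d_def dist_norm norm_minus_commute)
      have d: "\<bar>d \<bullet> x\<bar> \<le> 1 / 4" if "r * norm x \<le> 1 / 4" for x
        using Cauchy_Schwarz_ineq2[of d x] mult_right_mono[OF \<open>norm d \<le> r\<close> norm_ge_zero[of x]] that by linarith
      have \<omega>_eq: "\<omega> = p + w + d"
        by (simp add: d_def)
      have e1: "\<omega> \<bullet> x1 / 2 = pi * of_int (m x1) + (pi / 3 + d \<bullet> x1 / 2)"
        by (simp add: \<omega>_eq inner_add_left w u_def t_def field_simps)
      have e2: "\<omega> \<bullet> x2 / 2 = pi * of_int (m x2) + (pi / 3 + d \<bullet> x2 / 2)"
        by (simp add: \<omega>_eq inner_add_left w v_def t_def field_simps)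
      have e3: "\<omega> \<bullet> (x1 + x2) / 2 = pi * of_int (m x1 + m x2) + (2 * pi / 3 + (d \<bullet> x1 + d \<bullet> x2) / 2)"
        using e1 e2 by (simp add: inner_add_right field_simps)
      have d1: "d \<bullet> x1 \<le> 1 / 4" "- (1 / 4) \<le> d \<bullet> x1" and d2: "d \<bullet> x2 \<le> 1 / 4" "- (1 / 4) \<le> d \<bullet> x2"
        using d[OF r(2)] d[OF r(3)] by linarith+
      have "1 / 2 \<le> sin (pi / 3 + d \<bullet> x1 / 2)"
        using d1 pi_gt3 by (intro sin_ge_half) (simp_all add: field_simps)
      moreover have "1 / 2 \<le> sin (pi / 3 + d \<bullet> x2 / 2)"
        using d2 pi_gt3 by (intro sin_ge_half) (simp_all add: field_simps)
      moreover have "1 / 2 \<le> sin (2 * pi / 3 + (d \<bullet> x1 + d \<bullet> x2) / 2)"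
        using d1 d2 pi_gt3 by (intro sin_ge_half) (simp_all add: field_simps)
      ultimately show ?thesis
        unfolding e1 e2 e3 abs_sin_shift by linarith
    qed
    ultimately show ?thesis by blast
  qed
  then show ?thesis
    using r(1) by blast
qed

text \<open>The modulus of the symbol is at most a constant times a slowly varying function, and at least
  a constant times the same function on balls of a fixed radius near every point. Comparing the
  values and integrating over such a ball gives the bound.\<close>

lemma hex_spline_hat_local_bound:
  fixes \<alpha> :: "real^3" and x1 x2 :: "real^2"
  assumes \<alpha>: "0 < \<alpha> $ 1" "0 < \<alpha> $ 2" "0 < \<alpha> $ 3"
    and x12: "x1 + x2 = vector [1, 0]" and x1: "x1 $ 2 \<noteq> 0"
    and meas: "hex_spline_hat \<alpha> x1 x2 (x1 + x2) \<in> borel_measurable borel"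
  shows "\<exists>C R. \<forall>p. ennreal ((cmod (hex_spline_hat \<alpha> x1 x2 (x1 + x2) p))\<^sup>2) \<le> ennreal C *
    (\<integral>\<^sup>+x. ennreal ((cmod (hex_spline_hat \<alpha> x1 x2 (x1 + x2) x))\<^sup>2) * indicator (ball p R) x \<partial>lborel)"
proof -
  let ?h = "hex_spline_hat \<alpha> x1 x2 (x1 + x2)"
  note [measurable] = meas
  have [measurable]: "ball c R \<in> sets borel" for c :: "real^2" and R
    by simp
  obtain r R where r: "0 < r" and good: "\<And>p. \<exists>q. ball q r \<subseteq> ball p R \<and> (\<forall>\<omega>\<in>ball q r.
     1 / 2 \<le> \<bar>sin (\<omega> \<bullet> x1 / 2)\<bar> \<and> 1 / 2 \<le> \<bar>sin (\<omega> \<bullet> x2 / 2)\<bar> \<and> 1 / 2 \<le> \<bar>sin (\<omega> \<bullet> (x1 + x2) / 2)\<bar>)"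
    using good_ball_nearby[OF x12 x1] by blast
  define D where "D = max R 0 * (norm x1 + norm x2)"
  define E where "E = (3 * (1 + D)) powr (\<alpha> $ 1 + \<alpha> $ 2 + \<alpha> $ 3)"
  define V where "V = unit_ball_vol 2 * r\<^sup>2"
  have D: "0 \<le> D"
    by (simp add: D_def)
  have V: "0 < V"
    using r by (simp add: V_def unit_ball_vol_2)
  have "ennreal ((cmod (?h p))\<^sup>2) \<le> ennreal (E\<^sup>2 / V) *
      (\<integral>\<^sup>+x. ennreal ((cmod (?h x))\<^sup>2) * indicator (ball p R) x \<partial>lborel)" for p
  proof -
    obtain q where q: "ball q r \<subseteq> ball p R" "\<And>\<omega>. \<omega> \<in> ball q r \<Longrightarrow>
        1 / 2 \<le> \<bar>sin (\<omega> \<bullet> x1 / 2)\<bar> \<and> 1 / 2 \<le> \<bar>sin (\<omega> \<bullet> x2 / 2)\<bar> \<and> 1 / 2 \<le> \<bar>sin (\<omega> \<bullet> (x1 + x2) / 2)\<bar>"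
      using good by blast
    have comparable: "(cmod (?h p))\<^sup>2 \<le> E\<^sup>2 * (cmod (?h x))\<^sup>2" if x: "x \<in> ball q r" for x
    proof -
      have px: "norm (p - x) \<le> max R 0"
        using q(1) x by (auto simp: dist_norm)
      have close: "\<bar>p \<bullet> y - x \<bullet> y\<bar> \<le> D" if "norm y \<le> norm x1 + norm x2" for y
      proof -
        have "\<bar>p \<bullet> y - x \<bullet> y\<bar> \<le> norm (p - x) * norm y"
          using Cauchy_Schwarz_ineq2[of "p - x" y] by (simp add: inner_diff_left)
        also have "\<dots> \<le> D"
          unfolding D_def using px that by (intro mult_mono) auto
        finally show ?thesis .
      qed
      have "cmod (?h p) \<le> E * cmod (?h x)"
        unfolding E_def using D q(2)[OF x] norm_triangle_ineq[of x1 x2]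
        by (intro cmod_hex_spline_hat_comparable[OF \<alpha>] abs_sinc_comparable close) auto
      then have "(cmod (?h p))\<^sup>2 \<le> (E * cmod (?h x))\<^sup>2"
        by (intro power_mono) auto
      then show ?thesis by (simp add: power_mult_distrib)
    qed
    have "ennreal ((cmod (?h p))\<^sup>2) * ennreal V = (\<integral>\<^sup>+x. ennreal ((cmod (?h p))\<^sup>2) * indicator (ball q r) x \<partial>lborel)"
      using r by (simp add: nn_integral_cmult_indicator emeasure_ball V_def)
    also have "\<dots> \<le> (\<integral>\<^sup>+x. ennreal (E\<^sup>2) * (ennreal ((cmod (?h x))\<^sup>2) * indicator (ball p R) x) \<partial>lborel)"
      using comparable q(1)
      by (intro nn_integral_mono) (auto simp: indicator_def ennreal_mult[symmetric] intro!: ennreal_leI)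
    also have "\<dots> = ennreal (E\<^sup>2) * (\<integral>\<^sup>+x. ennreal ((cmod (?h x))\<^sup>2) * indicator (ball p R) x \<partial>lborel)"
      by (rule nn_integral_cmult) simp
    finally have "ennreal (1 / V) * (ennreal ((cmod (?h p))\<^sup>2) * ennreal V) \<le>
        ennreal (1 / V) * (ennreal (E\<^sup>2) * (\<integral>\<^sup>+x. ennreal ((cmod (?h x))\<^sup>2) * indicator (ball p R) x \<partial>lborel))"
      by (rule mult_left_mono) simp
    moreover have "ennreal (1 / V) * (ennreal ((cmod (?h p))\<^sup>2) * ennreal V) = ennreal ((cmod (?h p))\<^sup>2)"
      using V by (simp add: ennreal_mult[symmetric])
    moreover have "ennreal (1 / V) * ennreal (E\<^sup>2) = ennreal (E\<^sup>2 / V)"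
      using V by (simp add: ennreal_mult[symmetric])
    ultimately show ?thesis
      by (simp only: mult.assoc[symmetric])
  qed
  then show ?thesis by blast
qed

text \<open>On the cell \<open>\<bar>\<omega> \<bullet> x\<bar>\<close> is at most \<open>pi\<close> times the \<open>l1\<close> norm of \<open>x\<close>, which is less than 2 for
  \<open>x1\<close> and \<open>x2\<close> and equal to 1 for their sum; so no quotient reaches its first zero.\<close>

lemma hex_spline_hat_lower_bound:
  fixes \<alpha> :: "real^3" and x1 x2 :: "real^2"
  assumes \<alpha>: "0 < \<alpha> $ 1" "0 < \<alpha> $ 2" "0 < \<alpha> $ 3"
    and x12: "x1 + x2 = vector [1, 0]"
    and \<theta>: "\<bar>x1 $ 1\<bar> + \<bar>x1 $ 2\<bar> < 2" "\<bar>x2 $ 1\<bar> + \<bar>x2 $ 2\<bar> < 2"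
  obtains A where "0 < A" "\<And>\<omega>. \<omega> \<in> period_cell \<Longrightarrow> A \<le> (cmod (hex_spline_hat \<alpha> x1 x2 (x1 + x2) \<omega>))\<^sup>2"
proof -
  define l where "l x = \<bar>x $ 1\<bar> + \<bar>x $ 2\<bar>" for x :: "real^2"
  define S where "S = pi * max 1 (max (l x1) (l x2))"
  have "max 1 (max (l x1) (l x2)) < 2"
    using \<theta> by (simp add: l_def)
  then have S: "0 < S" "S < 2 * pi"
    by (auto simp: S_def less_max_iff_disj)
  obtain \<delta> where \<delta>: "0 < \<delta>" "\<And>s. \<bar>s\<bar> \<le> S \<Longrightarrow> \<delta> \<le> abs_sinc s"
    by (rule abs_sinc_lower_bound[OF S]) (rule that)
  have inner: "\<bar>\<omega> \<bullet> x\<bar> \<le> S" if \<omega>: "\<omega> \<in> period_cell" and x: "l x \<le> max 1 (max (l x1) (l x2))" for \<omega> x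
  proof -
    have \<omega>i: "\<bar>\<omega> $ i\<bar> \<le> pi" for i
      using \<omega> by (auto simp: period_cell_def Basis_vec_def inner_axis)
    have "\<bar>\<omega> \<bullet> x\<bar> \<le> \<bar>\<omega> $ 1\<bar> * \<bar>x $ 1\<bar> + \<bar>\<omega> $ 2\<bar> * \<bar>x $ 2\<bar>"
      unfolding inner_real2 by (simp flip: abs_mult)
    also have "\<dots> \<le> pi * \<bar>x $ 1\<bar> + pi * \<bar>x $ 2\<bar>"
      by (intro add_mono mult_right_mono \<omega>i) auto
    also have "\<dots> = pi * l x"
      by (simp add: l_def distrib_left)
    also have "\<dots> \<le> S"
      unfolding S_def using x by (intro mult_left_mono) auto
    finally show ?thesis .
  qed
  show thesis
  proof (rule that[of "(\<delta> powr (\<alpha> $ 1 + \<alpha> $ 2 + \<alpha> $ 3))\<^sup>2"])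
    fix \<omega> :: "real^2" assume \<omega>: "\<omega> \<in> period_cell"
    have "l (x1 + x2) \<le> 1"
      by (simp add: l_def x12)
    then show "(\<delta> powr (\<alpha> $ 1 + \<alpha> $ 2 + \<alpha> $ 3))\<^sup>2 \<le> (cmod (hex_spline_hat \<alpha> x1 x2 (x1 + x2) \<omega>))\<^sup>2"
      by (intro power_mono cmod_hex_spline_hat_ge \<alpha> \<delta> inner[OF \<omega>]) (auto simp: le_max_iff_disj)
  qed (use \<delta>(1) in simp)
qed

section \<open>The Riesz basis of hex splines\<close>

theorem theorem6p1:
  fixes x1 x2 x3 :: "real^2" and \<alpha> :: "real^3"
    and \<theta>1 \<theta>2 :: real and B :: "real^2 \<Rightarrow> complex"
  assumes "x1 \<noteq> x2" and "independent {x1, x2}"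
    and "x3 = x1 + x2" and "x3 = vector [1, 0]"
    and "0 < \<theta>1" and "\<bar>x1 $ 1\<bar> + \<bar>x1 $ 2\<bar> \<le> \<theta>1" and "\<theta>1 < 2"
    and "0 < \<theta>2" and "\<bar>x2 $ 1\<bar> + \<bar>x2 $ 2\<bar> \<le> \<theta>2" and "\<theta>2 < 2"
    and "x1 $ 1 \<noteq> 0" and "x1 $ 2 / x1 $ 1 \<notin> \<rat>"
    and "x2 $ 1 \<noteq> 0" and "x2 $ 2 / x2 $ 1 \<notin> \<rat>"
    and "0 < \<alpha> $ 1" and "0 < \<alpha> $ 2" and "0 < \<alpha> $ 3"
    and "\<alpha> $ 1 + \<alpha> $ 2 + \<alpha> $ 3 > 1"
    and "is_hex_spline \<alpha> x1 x2 x3 B"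
    and "\<And>k. int_shift B k \<in> L2"
  shows "riesz_basis (int_shift B) (shift_invariant_space B)"
proof -
  let ?h = "hex_spline_hat \<alpha> x1 x2 (x1 + x2)"
  have x12: "x1 + x2 = vector [1, 0]"
    using assms(3,4) by simp
  have shift: "int_shift B = (\<lambda>k x. B (x - lattice_vec k))"
    by (simp add: int_shift_def lattice_vec_def fun_eq_iff)
  have B: "B \<in> L2"
    using assms(20)[of 0] by (simp add: shift lattice_vec_zero)
  have Bh: "has_fourier_transform B ?h"
    using assms(3,19) by (simp add: is_hex_spline_def)
  have meas: "?h \<in> borel_measurable borel"
    using Bh by (simp add: has_fourier_transform_def)
  have x1: "x1 $ 2 \<noteq> 0"
    using assms(12) by (metis Rats_0 div_0)
  have \<theta>: "\<bar>x1 $ 1\<bar> + \<bar>x1 $ 2\<bar> < 2" "\<bar>x2 $ 1\<bar> + \<bar>x2 $ 2\<bar> < 2"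
    using assms(6,7,9,10) by linarith+
  obtain A where A: "0 < A" "\<And>\<omega>. \<omega> \<in> period_cell \<Longrightarrow> A \<le> (cmod (?h \<omega>))\<^sup>2"
    using hex_spline_hat_lower_bound[OF assms(15-17) x12 \<theta>] by metis
  obtain C R where C: "\<And>p. ennreal ((cmod (?h p))\<^sup>2) \<le> ennreal C *
      (\<integral>\<^sup>+x. ennreal ((cmod (?h x))\<^sup>2) * indicator (ball p R) x \<partial>lborel)"
    using hex_spline_hat_local_bound[OF assms(15-17) x12 x1 meas] by blast
  obtain B' where B': "A \<le> B'"
    "\<And>F c. finite F \<Longrightarrow> A * (\<Sum>k\<in>F. (cmod (c k))\<^sup>2) \<le> (L2_norm (\<lambda>x. \<Sum>k\<in>F. c k * B (x - lattice_vec k)))\<^sup>2"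
    "\<And>F c. finite F \<Longrightarrow> (L2_norm (\<lambda>x. \<Sum>k\<in>F. c k * B (x - lattice_vec k)))\<^sup>2 \<le> B' * (\<Sum>k\<in>F. (cmod (c k))\<^sup>2)"
    by (rule riesz_bounds_translates[OF Bh B cmod_hex_spline_hat_le_1[OF assms(15-17)] A C]) (assumption, rule that)
  show ?thesis
    unfolding shift_invariant_space_def shift
    by (rule riesz_basis_if_finite_bounds[OF assms(20)[unfolded shift] A(1) B'])
qed

end
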